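(* Let $\varphi(t)=\dfrac{1-\sqrt{1-t}}{t}$ for $t\in(0,1)$. Then for all integers $n\geq 30$, $g(n)<\varphi(s(n))$, where $s(n)=u_{n-1}+u_{n+1}-u_{n-1}u_{n+1}$.
   Context: $\overline{p}(n)$ denotes the number of overpartitions of $n$ (nonincreasing sequences of positive integers summing to $n$ in which the first occurrence of each distinct part may be overlined), with $\overline{p}(0)=1$. For integers $m\geq 1$, $u_m=\dfrac{\overline{p}(m-1)\overline{p}(m+1)}{\overline{p}(m)^2}$. For integers $m\geq 2$, with $x=\pi\sqrt{m-1}$, $y=\pi\sqrt{m}$, $z=\pi\sqrt{m+1}$, define \[ g(m)=e^{x-2y+z}\frac{(x^6-x^5+1)\,y^{16}\,(z^6-z^5+1)}{x^8(y^6-y^5-1)^2z^8}. \] *)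

theory Defs
  imports Complex_Main "HOL-Library.Multiset"
begin

text \<open>An overpartition of n: a partition of n (a multiset of positive parts summing to n)
  together with the set of distinct parts whose first occurrence is overlined.\<close>
definition overpartitions :: "nat \<Rightarrow> (nat multiset \<times> nat set) set" where
  "overpartitions n = {(M, S). (\<forall>x \<in># M. 0 < x) \<and> sum_mset M = n \<and> S \<subseteq> set_mset M}"

definition overpart :: "nat \<Rightarrow> nat" where
  "overpart n = card (overpartitions n)"

definition u :: "nat \<Rightarrow> real" where
  "u m = real (overpart (m - 1)) * real (overpart (m + 1)) / (real (overpart m))^2"

definition g :: "nat \<Rightarrow> real" where
  "g m = (let x = pi * sqrt (real m - 1); y = pi * sqrt (real m); z = pi * sqrt (real m + 1)
          in exp (x - 2*y + z) * ((x^6 - x^5 + 1) * y^16 * (z^6 - z^5 + 1))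
             / (x^8 * (y^6 - y^5 - 1)^2 * z^8))"

definition phi :: "real \<Rightarrow> real" where
  "phi t = (1 - sqrt (1 - t)) / t"

definition s :: "nat \<Rightarrow> real" where
  "s n = u (n - 1) + u (n + 1) - u (n - 1) * u (n + 1)"

end

theory Submission
  imports Defs "HOL-Probability.Probability" "HOL-Complex_Analysis.Complex_Analysis"
begin

text \<open>Put \<open>b = 1 - u (n - 1)\<close> and \<open>c = 1 - u (n + 1)\<close>. Then \<open>s n = 1 - b c\<close>, so \<open>phi (s n) = 1 / (1 + sqrt (b c))\<close>
  and the claim is \<open>sqrt (b c) < 1 / g n - 1\<close>. An elementary function \<open>ell n\<close>, obtained from Taylor bounds
  and matching \<open>1 - u n\<close> to sufficient order, is a lower bound of \<open>1 / g n - 1\<close>, so that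
  \<open>b c < (ell n)\<^sup>2\<close> remains.

  For large arguments, \<open>1 - u k\<close> is bounded by an asymptotic formula for overpartitions with explicit error.
  Their generating function is \<open>1 / \<Theta>(q)\<close> with \<open>\<Theta>(q) = \<Sum>\<^sub>j (-1)\<^sup>j q^(j\<^sup>2)\<close> by Gauss's identity,
  for which Shanks's finite form is used. Polya's limit of a binomial identity gives the behaviour of \<open>\<Theta>(e\<^sup>-\<^sup>t)\<close>
  for real \<open>t \<rightarrow> 0\<close>, and analytic continuation for complex \<open>t\<close>. Up to a bounded function,
  \<open>1 / \<Theta>(e\<^sup>-\<^sup>t)\<close> is near \<open>t = 0\<close> an entire function of \<open>1 / t\<close>, whose contribution is a residue. Away from \<open>t = 0\<close> the product formula suffices. The remaining \<open>n < 900\<close> are computed with the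
  recurrence \<open>\<Theta> F = 1\<close>: exactly up to 80, from rounded values beyond.\<close>

section \<open>Overpartitions and the theta series\<close>

text \<open>With \<open>t = 1 / n\<close>, both \<open>1 - u n\<close> and
  \<open>1 / g n - 1\<close> expand as
  \<open>pi/4 t^(3/2) - t^2 + 3/(4 pi) t^(5/2) + c t^3 + ...\<close>. They part only at
  \<open>t^3\<close>, with \<open>c = 1/pi^2 - pi^2/32\<close>, about -0.207, for the first and
  about 0.406 for the second; the inequality lives in this gap. From \<open>n = 81\<close> on the
  product over \<open>n - 1\<close> and \<open>n + 1\<close> is bounded by AM-GM, which costs a
  second difference of order \<open>t^(7/2)\<close> and eats much of the gap when \<open>n\<close>
  is small. Relative errors of the overpartition numbers must be a small multiple of
  \<open>t^3\<close>, hence the target \<open>1 / (50 n^3)\<close>. The analytic obstacle is a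
  branch point: near 0, \<open>1 / \<Theta>\<close> behaves like
  \<open>sqrt t * exp (pi^2 / (4 t))\<close>, which cannot be integrated around 0. With
  \<open>w = pi / (2 sqrt t)\<close>, split \<open>exp (w^2) / w\<close> by
  \<open>1 = erf w + erfc w\<close>: the \<open>erf\<close> part is even in \<open>w\<close>, hence
  single-valued in \<open>t\<close>, and the \<open>erfc\<close> part is bounded when
  \<open>Re w \<ge> 0\<close>, up to the factor \<open>1 / w\<close>. The residue then comes out in
  elementary functions, and no Bessel function needs to be estimated.\<close>

definition bounded_overpartitions :: "nat \<Rightarrow> nat \<Rightarrow> (nat multiset \<times> nat set) set" where
  "bounded_overpartitions N n = {(M, S) \<in> overpartitions n. \<forall>x\<in>#M. x \<le> N}"

text \<open>Bounding the parts by \<open>N\<close> gives generating functions that are finite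
  products, with coefficients that are already final up to index \<open>N\<close>.\<close>

definition bounded_overpart :: "nat \<Rightarrow> nat \<Rightarrow> nat" where
  "bounded_overpart N n = card (bounded_overpartitions N n)"

lemma mem_le_sum_mset: "x \<in># (M :: nat multiset) \<Longrightarrow> x \<le> sum_mset M"
  by (metis le_add1 mset_add sum_mset.add_mset)

lemma size_le_sum_mset: "\<forall>x\<in>#M. 0 < x \<Longrightarrow> size M \<le> sum_mset (M :: nat multiset)"
  by (induction M) auto

lemma finite_overpartitions: "finite (overpartitions n)"
proof -
  have "finite {M :: nat multiset. size M \<le> n \<and> set_mset M \<subseteq> {..n}}"
  proof -
    have "{M :: nat multiset. size M \<le> n \<and> set_mset M \<subseteq> {..n}}
        \<subseteq> mset ` {xs. set xs \<subseteq> {..n} \<and> length xs \<le> n}"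
    proof
      fix M :: "nat multiset" assume M: "M \<in> {M. size M \<le> n \<and> set_mset M \<subseteq> {..n}}"
      obtain xs where "M = mset xs" using ex_mset by metis
      then show "M \<in> mset ` {xs. set xs \<subseteq> {..n} \<and> length xs \<le> n}" using M by auto
    qed
    then show ?thesis
      using finite_lists_length_le[of "{..n}" n] by (meson finite_atMost finite_imageI finite_subset)
  qed
  then have "finite ({M :: nat multiset. size M \<le> n \<and> set_mset M \<subseteq> {..n}} \<times> Pow {..n})"
    by simp
  moreover have "overpartitions n
      \<subseteq> {M :: nat multiset. size M \<le> n \<and> set_mset M \<subseteq> {..n}} \<times> Pow {..n}"
  proof clarify
    fix M :: "nat multiset" and S assume "(M, S) \<in> overpartitions n"
    then have M: "\<forall>x\<in>#M. 0 < x" "sum_mset M = n" "S \<subseteq> set_mset M" by (auto simp: overpartitions_def)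
    have "size M \<le> n" using size_le_sum_mset[OF M(1)] M(2) by simp
    moreover have "set_mset M \<subseteq> {..n}" using mem_le_sum_mset M(2) by blast
    ultimately show "M \<in> {M. size M \<le> n \<and> set_mset M \<subseteq> {..n}} \<and> S \<in> Pow {..n}" using M(3) by blast
  qed
  ultimately show ?thesis by (rule finite_subset[rotated])
qed

lemma finite_bounded_overpartitions: "finite (bounded_overpartitions N n)"
  using finite_overpartitions by (rule finite_subset[rotated]) (auto simp: bounded_overpartitions_def)

lemma bounded_overpart_le: "bounded_overpart N n \<le> overpart n"
  unfolding bounded_overpart_def overpart_def
  by (intro card_mono finite_overpartitions) (auto simp: bounded_overpartitions_def)

lemma bounded_overpart_eq: "n \<le> N \<Longrightarrow> bounded_overpart N n = overpart n"
  unfolding bounded_overpart_def overpart_def bounded_overpartitions_def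
  by (rule arg_cong[where f = card]) (auto simp: overpartitions_def dest: mem_le_sum_mset)

lemma bounded_overpart_0: "bounded_overpart 0 n = (if n = 0 then 1 else 0)"
proof -
  have empty: "M = {#} \<and> S = {} \<and> n = 0" if "(M, S) \<in> bounded_overpartitions 0 n" for M S
  proof -
    have M: "\<forall>x\<in>#M. 0 < x" "sum_mset M = n" "S \<subseteq> set_mset M" "\<forall>x\<in>#M. x \<le> 0"
      using that by (auto simp: bounded_overpartitions_def overpartitions_def)
    have "M = {#}" using M(1,4) by (metis multiset_nonemptyE not_less)
    then show ?thesis using M(2,3) by simp
  qed
  moreover have "({#}, {}) \<in> bounded_overpartitions 0 0"
    by (simp add: bounded_overpartitions_def overpartitions_def)
  ultimately have "bounded_overpartitions 0 n = (if n = 0 then {({#}, {})} else {})"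
    by auto
  then show ?thesis by (simp add: bounded_overpart_def)
qed

text \<open>Removing one copy of the part \<open>Suc N\<close>: either another copy remains, and the overlining is kept,
  or none remains, and the removed copy was overlined or not.\<close>
lemma bounded_overpart_Suc:
  "bounded_overpart (Suc N) n =
     (if n < Suc N then bounded_overpart N n
      else bounded_overpart N n + bounded_overpart (Suc N) (n - Suc N) + bounded_overpart N (n - Suc N))"
proof -
  let ?B = bounded_overpartitions
  let ?K = "Suc N"
  define W where "W n = {(M, S) \<in> ?B ?K n. ?K \<in># M}" for n
  have split: "?B ?K n = ?B N n \<union> W n" "?B N n \<inter> W n = {}" for n
    unfolding W_def bounded_overpartitions_def by (auto simp: le_Suc_eq)
  have fin: "finite (W n)" for n
    by (rule finite_subset[OF _ finite_bounded_overpartitions[of ?K n]]) (auto simp: W_def)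
  have card_split: "bounded_overpart ?K n = bounded_overpart N n + card (W n)" for n
    unfolding bounded_overpart_def split(1)
    by (rule card_Un_disjoint) (auto simp: fin finite_bounded_overpartitions split)
  have W_small: "W n = {}" if "n < ?K" for n
    using that by (auto simp: W_def bounded_overpartitions_def overpartitions_def dest!: mem_le_sum_mset)
  have "card (W n) = bounded_overpart ?K (n - ?K) + bounded_overpart N (n - ?K)" if n: "n \<ge> ?K"
  proof -
    let ?f1 = "\<lambda>(M, S). (add_mset ?K M, S)" and ?f2 = "\<lambda>(M, S). (add_mset ?K M, insert ?K S)"
    have notin: "?K \<notin># M" "?K \<notin> S" if "(M, S) \<in> ?B N k" for M S k
    proof -
      have M: "S \<subseteq> set_mset M" "\<forall>x\<in>#M. x \<le> N"
        using that by (auto simp: bounded_overpartitions_def overpartitions_def)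
      show "?K \<notin># M" using M(2) by auto
      then show "?K \<notin> S" using M(1) by auto
    qed
    have W: "W n = ?f1 ` ?B ?K (n - ?K) \<union> ?f2 ` ?B N (n - ?K)" (is "_ = ?R")
    proof (rule set_eqI)
      fix p :: "nat multiset \<times> nat set"
      obtain M S where p: "p = (M, S)" by (cases p)
      show "p \<in> W n \<longleftrightarrow> p \<in> ?R"
      proof
        assume "p \<in> W n"
        then have MS: "\<forall>x\<in>#M. 0 < x" "sum_mset M = n" "S \<subseteq> set_mset M" "\<forall>x\<in>#M. x \<le> ?K" "?K \<in># M"
          by (auto simp: p W_def bounded_overpartitions_def overpartitions_def)
        obtain M' where M': "M = add_mset ?K M'" using MS(5) by (meson mset_add)
        show "p \<in> ?R"
        proof (cases "?K \<in># M' \<or> ?K \<notin> S")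
          case True
          then have "(M', S) \<in> ?B ?K (n - ?K)"
            using MS by (auto simp: M' bounded_overpartitions_def overpartitions_def)
          then show ?thesis using p M' by force
        next
          case False
          have "x \<le> N" if "x \<in># M'" for x
            using that MS(4) False M' by (metis le_SucE union_iff add_mset_add_single)
          then have "(M', S - {?K}) \<in> ?B N (n - ?K)"
            using MS False by (auto simp: M' bounded_overpartitions_def overpartitions_def)
          moreover have "insert ?K (S - {?K}) = S" using False by blast
          ultimately show ?thesis using p M' by force
        qed
      next
        assume "p \<in> ?R"
        then show "p \<in> W n" using n
          by (auto simp: p W_def bounded_overpartitions_def overpartitions_def le_SucI)
      qed
    qed
    have "inj_on ?f1 (?B ?K (n - ?K))" by (auto simp: inj_on_def)
    moreover have "inj_on ?f2 (?B N (n - ?K))"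
      using notin by (auto simp: inj_on_def) (metis insert_ident)+
    moreover have "?f1 ` ?B ?K (n - ?K) \<inter> ?f2 ` ?B N (n - ?K) = {}"
    proof -
      have False if "(M, insert ?K S) \<in> ?B ?K (n - ?K)" "(M, S) \<in> ?B N (n - ?K)" for M S
      proof -
        have "?K \<in># M" using that(1) by (auto simp: bounded_overpartitions_def overpartitions_def)
        then show False using notin(1)[OF that(2)] by simp
      qed
      then show ?thesis by auto
    qed
    ultimately show ?thesis
      unfolding W bounded_overpart_def
      by (subst card_Un_disjoint) (auto simp: card_image finite_bounded_overpartitions)
  qed
  then show ?thesis using card_split[of n] W_small[of n] by (cases "n < ?K") auto
qed

section \<open>Gauss's theta identity in Shanks's finite form\<close>

definition gauss_prod :: "nat \<Rightarrow> complex \<Rightarrow> complex" where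
  "gauss_prod N q = (\<Prod>k=1..N. (1 - q ^ k) / (1 + q ^ k))"

definition gauss_sum :: "nat \<Rightarrow> complex \<Rightarrow> complex" where
  "gauss_sum N q = 1 + 2 * (\<Sum>k=1..N. (-1) ^ k * q ^ (k\<^sup>2))"

lemma one_plus_power_nz:
  fixes q :: complex assumes "norm q < 1" "k \<ge> 1" shows "1 + q ^ k \<noteq> 0" "1 - q ^ k \<noteq> 0"
proof -
  have "norm (q ^ k) < 1" using assms by (simp add: norm_power power_less_one_iff)
  then show "1 + q ^ k \<noteq> 0" "1 - q ^ k \<noteq> 0"
    by (metis add.inverse_unique less_irrefl norm_minus_cancel norm_one,
        metis eq_iff_diff_eq_0 less_irrefl norm_one)
qed

lemma gauss_prod_nz: "norm q < 1 \<Longrightarrow> gauss_prod N q \<noteq> 0"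
  unfolding gauss_prod_def by (subst prod_zero_iff) (auto dest: one_plus_power_nz)

lemma gauss_prod_Suc: "gauss_prod (Suc N) q = gauss_prod N q * ((1 - q ^ Suc N) / (1 + q ^ Suc N))"
  by (simp add: gauss_prod_def)

text \<open>At \<open>k = 0\<close> this is \<open>gauss_prod N q\<close> itself. For
  \<open>k \<ge> 1\<close> the power \<open>q ^ (k * (N + 1))\<close> makes the term vanish as
  \<open>N\<close> grows, so only the product survives in the limit.\<close>

definition shanks_term :: "nat \<Rightarrow> nat \<Rightarrow> complex \<Rightarrow> complex" where
  "shanks_term N k q = (-1) ^ k * q ^ (k * (N + 1)) * (2 / (1 + q ^ k)) * (gauss_prod N q / gauss_prod k q)"

text \<open>Certificate of a WZ-type telescoping: its difference in \<open>k\<close> is the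
  difference of \<open>shanks_term\<close> in \<open>N\<close>.\<close>

definition shanks_rem :: "nat \<Rightarrow> nat \<Rightarrow> complex \<Rightarrow> complex" where
  "shanks_rem N k q = 2 * (-1) ^ k * q ^ (k * (N + 1) + N + 1) * (gauss_prod N q / gauss_prod k q)
     / (1 + q ^ Suc N)"

text \<open>The telescoping identity behind Shanks's finite form of Gauss's theorem.\<close>
lemma shanks_term_diff:
  assumes q: "norm q < 1"
  shows "shanks_term (Suc N) (Suc k) q - shanks_term N (Suc k) q = shanks_rem N k q - shanks_rem N (Suc k) q"
proof -
  define a b where "a = q ^ Suc N" and "b = q ^ Suc k"
  have nz: "1 + a \<noteq> 0" "1 + b \<noteq> 0" "1 - a \<noteq> 0" "1 - b \<noteq> 0" "gauss_prod N q \<noteq> 0" "gauss_prod k q \<noteq> 0"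
    unfolding a_def b_def
    by (intro one_plus_power_nz[OF q] gauss_prod_nz[OF q]; simp)+
  \<comment> \<open>All powers of \<open>q\<close> reduce to products of \<open>a\<close>,
    \<open>b\<close> and \<open>c\<close>, which turns the claim into a rational identity.\<close>
  define c where "c = q ^ (Suc k * (N + 1))"
  have e: "q ^ (Suc k * (Suc N + 1)) = c * b" "q ^ (Suc k * (N + 1)) = c"
    "q ^ (k * (N + 1) + N + 1) = c" "q ^ (Suc k * (N + 1) + N + 1) = c * a"
    unfolding c_def a_def b_def by (simp_all flip: power_add power_Suc add: algebra_simps)
  show ?thesis
    unfolding shanks_term_def shanks_rem_def gauss_prod_Suc e
    unfolding a_def[symmetric] b_def[symmetric]
    using nz by (simp add: divide_simps) (simp add: algebra_simps)
qed

text \<open>Induction on \<open>N\<close>: telescoping leaves two boundary terms. The one at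
  \<open>k = 0\<close> is the change of the product; the one at \<open>k = N\<close>, joined with
  the new summand \<open>k = Suc N\<close>, gives the new square term of
  \<open>gauss_sum\<close>.\<close>

lemma shanks_identity:
  assumes q: "norm q < 1"
  shows "gauss_sum N q = gauss_prod N q + (\<Sum>k=1..N. shanks_term N k q)"
proof (induction N)
  case 0
  show ?case by (simp add: gauss_sum_def gauss_prod_def)
next
  case (Suc N)
  have nz: "1 + q ^ Suc N \<noteq> 0" "gauss_prod N q \<noteq> 0"
    by (intro one_plus_power_nz[OF q] gauss_prod_nz[OF q]; simp)+
  have "(\<Sum>k=1..N. shanks_term (Suc N) k q - shanks_term N k q)
      = (\<Sum>k<N. shanks_rem N k q - shanks_rem N (Suc k) q)"
    using shanks_term_diff[OF q, of N]
    by (simp add: sum.atLeast1_atMost_eq)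
  also have "\<dots> = shanks_rem N 0 q - shanks_rem N N q"
    by (rule sum_lessThan_telescope')
  finally have tel: "(\<Sum>k=1..N. shanks_term (Suc N) k q)
      = (\<Sum>k=1..N. shanks_term N k q) + (shanks_rem N 0 q - shanks_rem N N q)"
    by (simp add: sum_subtractf algebra_simps)
  have r0: "shanks_rem N 0 q = gauss_prod N q - gauss_prod (Suc N) q"
    unfolding gauss_prod_Suc shanks_rem_def using nz
    by (simp add: gauss_prod_def divide_simps) (simp add: algebra_simps)
  have sq: "(Suc N)\<^sup>2 = N * (N + 1) + N + 1" "Suc N * (Suc N + 1) = (Suc N)\<^sup>2 + Suc N"
    by (simp_all add: power2_eq_square)
  have last: "shanks_term (Suc N) (Suc N) q - shanks_rem N N q = 2 * (-1) ^ Suc N * q ^ ((Suc N)\<^sup>2)"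
    unfolding shanks_term_def shanks_rem_def sq(2) power_add[of q "(Suc N)\<^sup>2"] sq(1)[symmetric]
    using nz gauss_prod_nz[OF q, of "Suc N"]
    by (simp add: divide_simps del: power_Suc) (simp add: algebra_simps)
  have "gauss_sum (Suc N) q = gauss_sum N q + 2 * (-1) ^ Suc N * q ^ ((Suc N)\<^sup>2)"
    by (simp add: gauss_sum_def algebra_simps)
  also have "\<dots> = gauss_prod N q + (\<Sum>k=1..N. shanks_term N k q)
      + (shanks_term (Suc N) (Suc N) q - shanks_rem N N q)"
    using Suc last by simp
  also have "\<dots> = gauss_prod (Suc N) q + (\<Sum>k=1..Suc N. shanks_term (Suc N) k q)"
    using tel r0 by (simp add: algebra_simps)
  finally show ?case .
qed

lemma one_plus_div_one_minus_le:
  fixes x :: real assumes "0 \<le> x" "x \<le> r" "r < 1"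
  shows "(1 + x) / (1 - x) \<le> exp (2 * x / (1 - r))"
proof -
  have "(1 + x) / (1 - x) = 1 + 2 * x / (1 - x)" using assms by (simp add: divide_simps)
  also have "\<dots> \<le> 1 + 2 * x / (1 - r)" using assms by (intro add_left_mono divide_left_mono) auto
  also have "\<dots> \<le> exp (2 * x / (1 - r))" by (rule exp_ge_add_one_self)
  finally show ?thesis .
qed

lemma prod_one_plus_div_one_minus_le:
  fixes r :: real assumes r: "0 \<le> r" "r < 1"
  shows "(\<Prod>k=1..N. (1 + r ^ k) / (1 - r ^ k)) \<le> exp (2 * r / (1 - r)\<^sup>2)"
proof -
  have le: "r ^ k \<le> r" if "k \<ge> 1" for k
    using power_decreasing[of 1 k r] r that by simp
  have "(\<Prod>k=1..N. (1 + r ^ k) / (1 - r ^ k)) \<le> (\<Prod>k=1..N. exp (2 * r ^ k / (1 - r)))"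
    using r le by (intro prod_mono conjI one_plus_div_one_minus_le divide_nonneg_nonneg)
      (auto intro: power_le_one)
  also have "\<dots> = exp ((\<Sum>k=1..N. r ^ k) * (2 / (1 - r)))"
    by (simp add: exp_sum[symmetric] sum_distrib_left sum_divide_distrib algebra_simps)
  also have "\<dots> \<le> exp (2 * r / (1 - r)\<^sup>2)"
  proof -
    have "(\<Sum>k=1..N. r ^ k) = r * (\<Sum>k<N. r ^ k)"
      by (simp add: sum.atLeast1_atMost_eq sum_distrib_left)
    also have "(\<Sum>k<N. r ^ k) \<le> 1 / (1 - r)"
      using r by (simp add: sum_gp_strict divide_simps)
    finally have "(\<Sum>k=1..N. r ^ k) \<le> r * (1 / (1 - r))" using r by (simp add: mult_left_mono)
    then have "(\<Sum>k=1..N. r ^ k) * (2 / (1 - r)) \<le> r * (1 / (1 - r)) * (2 / (1 - r))"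
      using r by (intro mult_right_mono) auto
    also have "\<dots> = 2 * r / (1 - r)\<^sup>2" by (simp add: power2_eq_square)
    finally show ?thesis by simp
  qed
  finally show ?thesis .
qed

text \<open>Both bounds are free of \<open>N\<close>. Together they control the quotients in
  \<open>shanks_term\<close>; the second one alone keeps the limit away from 0 and bounds the
  partial sums of the overpartition series.\<close>

lemma norm_gauss_prod_le:
  assumes q: "norm q < 1"
  shows "norm (gauss_prod N q) \<le> exp (2 * norm q / (1 - norm q)\<^sup>2)"
    and "norm (1 / gauss_prod N q) \<le> exp (2 * norm q / (1 - norm q)\<^sup>2)"
proof -
  have b: "1 - norm q ^ k \<le> norm (1 + q ^ k)" "norm (1 + q ^ k) \<le> 1 + norm q ^ k"
    "1 - norm q ^ k \<le> norm (1 - q ^ k)" "norm (1 - q ^ k) \<le> 1 + norm q ^ k" for k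
    using norm_diff_ineq[of 1 "q ^ k"] norm_triangle_ineq[of 1 "q ^ k"]
      norm_triangle_ineq2[of 1 "q ^ k"] norm_triangle_ineq4[of 1 "q ^ k"] by (simp_all add: norm_power)
  have lt: "norm q ^ k < 1" if "k \<in> {1..N}" for k
    using that q by (auto simp: power_less_one_iff)
  have "norm (gauss_prod N q) = (\<Prod>k=1..N. norm (1 - q ^ k) / norm (1 + q ^ k))"
    by (simp add: gauss_prod_def norm_divide flip: prod_norm)
  also have "\<dots> \<le> (\<Prod>k=1..N. (1 + norm q ^ k) / (1 - norm q ^ k))"
    using b lt by (intro prod_mono conjI frac_le divide_nonneg_nonneg) auto
  also have "\<dots> \<le> exp (2 * norm q / (1 - norm q)\<^sup>2)"
    using q by (intro prod_one_plus_div_one_minus_le) auto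
  finally show "norm (gauss_prod N q) \<le> exp (2 * norm q / (1 - norm q)\<^sup>2)" .
  have "norm (1 / gauss_prod N q) = (\<Prod>k=1..N. norm (1 + q ^ k) / norm (1 - q ^ k))"
    by (simp add: gauss_prod_def norm_divide prod_dividef flip: prod_norm)
  also have "\<dots> \<le> (\<Prod>k=1..N. (1 + norm q ^ k) / (1 - norm q ^ k))"
    using b lt by (intro prod_mono conjI frac_le divide_nonneg_nonneg) auto
  also have "\<dots> \<le> exp (2 * norm q / (1 - norm q)\<^sup>2)"
    using q by (intro prod_one_plus_div_one_minus_le) auto
  finally show "norm (1 / gauss_prod N q) \<le> exp (2 * norm q / (1 - norm q)\<^sup>2)" .
qed

text \<open>Because \<open>k * (N + 1) \<ge> N + (k - 1)\<close> for \<open>k \<ge> 1\<close>, each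
  Shanks term is at most a constant times \<open>r ^ N * r ^ (k - 1)\<close>. The sum over
  \<open>k\<close> is geometric, and the factor \<open>r ^ N\<close> remains.\<close>

lemma gauss_sum_minus_gauss_prod:
  assumes q: "norm q < 1"
  shows "(\<lambda>N. gauss_sum N q - gauss_prod N q) \<longlonglongrightarrow> 0"
proof -
  define r K where "r = norm q" and "K = exp (2 * norm q / (1 - norm q)\<^sup>2)"
  have r: "0 \<le> r" "r < 1" using q by (auto simp: r_def)
  have K: "K > 0" by (simp add: K_def)
  have bound: "norm (shanks_term N k q) \<le> 2 / (1 - r) * (K * K) * r ^ N * r ^ (k - 1)"
    if k: "k \<in> {1..N}" for N k
  proof -
    have "r ^ k \<le> r ^ 1" using k r by (intro power_decreasing) auto
    then have "1 - r \<le> norm (1 + q ^ k)"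
      using norm_diff_ineq[of 1 "q ^ k"] by (simp add: norm_power r_def)
    then have "2 / norm (1 + q ^ k) \<le> 2 / (1 - r)"
      using r by (intro divide_left_mono mult_pos_pos) linarith+
    moreover have "norm (gauss_prod N q / gauss_prod k q) \<le> K * K"
      using mult_mono[OF norm_gauss_prod_le(1)[OF q, of N] norm_gauss_prod_le(2)[OF q, of k]]
      by (simp add: K_def norm_divide)
    moreover have "r ^ (k * (N + 1)) \<le> r ^ (N + (k - 1))"
    proof (rule power_decreasing)
      obtain j where "k = Suc j" using k by (cases k) auto
      then show "N + (k - 1) \<le> k * (N + 1)" by simp
    qed (use r in auto)
    ultimately have "r ^ (k * (N + 1)) * (2 / norm (1 + q ^ k)) * norm (gauss_prod N q / gauss_prod k q)
        \<le> r ^ (N + (k - 1)) * (2 / (1 - r)) * (K * K)"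
      using r by (intro mult_mono) auto
    also have "r ^ (k * (N + 1)) * (2 / norm (1 + q ^ k)) * norm (gauss_prod N q / gauss_prod k q)
        = norm (shanks_term N k q)"
      by (simp add: shanks_term_def norm_mult norm_divide norm_power r_def)
    also have "r ^ (N + (k - 1)) * (2 / (1 - r)) * (K * K) = 2 / (1 - r) * (K * K) * r ^ N * r ^ (k - 1)"
      by (simp add: power_add)
    finally show ?thesis .
  qed
  have "norm (gauss_sum N q - gauss_prod N q) \<le> 2 / (1 - r) * (K * K) * (1 / (1 - r)) * r ^ N" for N
  proof -
    have "norm (gauss_sum N q - gauss_prod N q) = norm (\<Sum>k=1..N. shanks_term N k q)"
      using shanks_identity[OF q, of N] by simp
    also have "\<dots> \<le> (\<Sum>k=1..N. 2 / (1 - r) * (K * K) * r ^ N * r ^ (k - 1))"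
      by (intro sum_norm_le bound)
    also have "\<dots> = 2 / (1 - r) * (K * K) * r ^ N * (\<Sum>k<N. r ^ k)"
      by (simp add: sum.atLeast1_atMost_eq sum_distrib_left)
    also have "\<dots> \<le> 2 / (1 - r) * (K * K) * r ^ N * (1 / (1 - r))"
      using r K by (intro mult_left_mono) (simp_all add: sum_gp_strict divide_simps)
    also have "\<dots> = 2 / (1 - r) * (K * K) * (1 / (1 - r)) * r ^ N"
      by simp
    finally show ?thesis .
  qed
  moreover have "(\<lambda>N. 2 / (1 - r) * (K * K) * (1 / (1 - r)) * r ^ N) \<longlonglongrightarrow> 0"
    using LIMSEQ_power_zero[of r] r by (intro tendsto_mult_right_zero) auto
  ultimately show ?thesis
    by (rule Lim_null_comparison[OF eventuallyI])
qed

section \<open>The theta series and the generating function of overpartitions\<close>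

text \<open>Jacobi's \<open>theta_4\<close> at argument 0 as a function of the nome, with the terms
  for \<open>k\<close> and \<open>-k\<close> merged.\<close>

definition theta :: "complex \<Rightarrow> complex" where
  "theta q = 1 + 2 * (\<Sum>k. (-1) ^ Suc k * q ^ ((Suc k)\<^sup>2))"

lemma summable_theta:
  fixes q :: complex
  assumes q: "norm q < 1"
  shows "summable (\<lambda>k. norm ((-1) ^ Suc k * q ^ ((Suc k)\<^sup>2)))"
proof (rule summable_comparison_test'[of "\<lambda>k. norm q ^ k"])
  show "summable (\<lambda>k. norm q ^ k)" using q by (simp add: summable_geometric)
  fix k :: nat
  have "k \<le> (Suc k)\<^sup>2" by (simp add: power2_eq_square)
  then show "norm (norm ((-1) ^ Suc k * q ^ ((Suc k)\<^sup>2))) \<le> norm q ^ k"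
    using q power_decreasing[of k "(Suc k)\<^sup>2" "norm q"] by (simp add: norm_mult norm_power)
qed

lemma gauss_prod_tendsto_theta:
  assumes q: "norm q < 1"
  shows "(\<lambda>N. gauss_prod N q) \<longlonglongrightarrow> theta q"
proof -
  have "(\<lambda>N. \<Sum>k<N. (-1) ^ Suc k * q ^ ((Suc k)\<^sup>2)) \<longlonglongrightarrow> (\<Sum>k. (-1) ^ Suc k * q ^ ((Suc k)\<^sup>2))"
    using summable_norm_cancel[OF summable_theta[OF q]] by (rule summable_LIMSEQ)
  then have "(\<lambda>N. gauss_sum N q) \<longlonglongrightarrow> theta q"
    unfolding gauss_sum_def theta_def
    by (intro tendsto_intros) (simp add: sum.atLeast1_atMost_eq)
  from tendsto_diff[OF this gauss_sum_minus_gauss_prod[OF q]] show ?thesis by simp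
qed

text \<open>A limit of nonzero products could vanish; the uniform bound on
  \<open>1 / gauss_prod N q\<close> excludes it.\<close>

lemma theta_nz:
  assumes q: "norm q < 1" shows "theta q \<noteq> 0"
proof
  assume "theta q = 0"
  then have "(\<lambda>N. norm (gauss_prod N q)) \<longlonglongrightarrow> 0"
    using tendsto_norm[OF gauss_prod_tendsto_theta[OF q]] by simp
  moreover have "norm (gauss_prod N q) \<ge> 1 / exp (2 * norm q / (1 - norm q)\<^sup>2)" for N
    using norm_gauss_prod_le(2)[OF q, of N] gauss_prod_nz[OF q, of N]
    by (simp add: norm_divide divide_simps mult_ac)
  ultimately have "1 / exp (2 * norm q / (1 - norm q)\<^sup>2) \<le> 0"
    by (intro LIMSEQ_le_const) auto
  then show False by simp
qed

lemma sums_shift_power: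
  fixes q :: "'a::real_normed_field"
  assumes "(\<lambda>n. h n * q ^ n) sums S"
  shows "(\<lambda>n. if n < K then 0 else h (n - K) * q ^ n) sums (q ^ K * S)"
proof -
  have "(\<lambda>n. q ^ K * (h n * q ^ n)) sums (q ^ K * S)" using assms by (rule sums_mult)
  then have "(\<lambda>n. (\<lambda>n. if n < K then 0 else h (n - K) * q ^ n) (n + K)) sums (q ^ K * S)"
    by (simp add: power_add mult_ac)
  then show ?thesis by (subst (asm) sums_zero_iff_shift) auto
qed

text \<open>Summability has to precede any functional equation. With \<open>T\<close> the sum for
  \<open>N\<close>, the recurrence gives \<open>s \<le> T + r ^ K * s + r ^ K * T\<close> for every
  partial sum \<open>s\<close>, and \<open>r ^ K < 1\<close> allows solving for
  \<open>s\<close>.\<close>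

lemma bounded_overpart_summable:
  fixes r :: real assumes r: "0 \<le> r" "r < 1"
  shows "summable (\<lambda>n. real (bounded_overpart N n) * r ^ n)"
proof (induction N)
  case 0
  show ?case
    by (rule summable_finite[of "{0}"]) (auto simp: bounded_overpart_0)
next
  case (Suc N)
  let ?K = "Suc N" and ?f = "\<lambda>N n. real (bounded_overpart N n) * r ^ n"
  define T where "T = suminf (?f N)"
  have rK: "r ^ ?K < 1" using r by (simp add: power_less_one_iff del: power_Suc)
  have part: "sum (?f N) {..<M} \<le> T" for M
    unfolding T_def using r by (intro sum_le_suminf Suc) auto
  have shift: "(\<Sum>n<M. if n < ?K then 0 else h (n - ?K) * r ^ n) \<le> r ^ ?K * (\<Sum>n<M. h n * r ^ n)"
    if "\<And>n. h n \<ge> 0" for h :: "nat \<Rightarrow> real" and M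
  proof -
    have "(\<Sum>n<M. if n < ?K then 0 else h (n - ?K) * r ^ n) = (\<Sum>n\<in>{?K..<M}. h (n - ?K) * r ^ n)"
      by (rule sum.mono_neutral_cong_right) auto
    also have "\<dots> = (\<Sum>n<M - ?K. h n * r ^ (n + ?K))"
      by (rule sum.reindex_bij_witness[of _ "\<lambda>n. n + ?K" "\<lambda>n. n - ?K"]) auto
    also have "\<dots> \<le> (\<Sum>n<M. h n * r ^ (n + ?K))"
      using that r by (intro sum_mono2) auto
    also have "\<dots> = r ^ ?K * (\<Sum>n<M. h n * r ^ n)"
      by (simp add: sum_distrib_left power_add mult_ac)
    finally show ?thesis .
  qed
  have bound: "sum (?f ?K) {..<M} \<le> (1 + r ^ ?K) * T / (1 - r ^ ?K)" for M
  proof -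
    have "sum (?f ?K) {..<M} = sum (?f N) {..<M}
       + (\<Sum>n<M. if n < ?K then 0 else real (bounded_overpart ?K (n - ?K)) * r ^ n)
       + (\<Sum>n<M. if n < ?K then 0 else real (bounded_overpart N (n - ?K)) * r ^ n)"
      unfolding sum.distrib[symmetric]
      by (rule sum.cong[OF refl], subst bounded_overpart_Suc) (simp add: distrib_right)
    also have "\<dots> \<le> T + r ^ ?K * sum (?f ?K) {..<M} + r ^ ?K * T"
      using shift[of "\<lambda>n. real (bounded_overpart ?K n)" M] shift[of "\<lambda>n. real (bounded_overpart N n)" M]
        part[of M] mult_left_mono[OF part[of M], of "r ^ ?K"] r by (simp del: power_Suc)
    finally have "sum (?f ?K) {..<M} * (1 - r ^ ?K) \<le> (1 + r ^ ?K) * T" by (simp add: algebra_simps)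
    then show ?thesis using rK by (simp add: pos_le_divide_eq del: power_Suc)
  qed
  show ?case
    using r bound[of "Suc n" for n]
    by (intro bounded_imp_summable[where B = "(1 + r ^ ?K) * T / (1 - r ^ ?K)"])
      (simp_all only: lessThan_Suc_atMost mult_nonneg_nonneg of_nat_0_le_iff zero_le_power)
qed

text \<open>The recurrence for \<open>bounded_overpart\<close> becomes
  \<open>S = p + q ^ K * S + q ^ K * p\<close> with \<open>p = 1 / gauss_prod N q\<close>, which
  multiplies \<open>p\<close> by \<open>(1 + q ^ K) / (1 - q ^ K)\<close>.\<close>

lemma bounded_overpart_sums:
  assumes q: "norm q < 1"
  shows "(\<lambda>n. of_nat (bounded_overpart N n) * q ^ n) sums (1 / gauss_prod N q)"
proof (induction N)
  case 0
  show ?case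
    using sums_single[of 0 "\<lambda>n. of_nat (bounded_overpart 0 n) * q ^ n"]
    by (simp add: bounded_overpart_0 gauss_prod_def if_distrib[of of_nat] if_distrib[of "\<lambda>x. x * _"] cong: if_cong)
next
  case (Suc N)
  let ?K = "Suc N"
  have "summable (\<lambda>n. norm (of_nat (bounded_overpart ?K n) * q ^ n))"
    using bounded_overpart_summable[of "norm q" ?K] q by (simp add: norm_mult norm_power)
  then obtain S where S: "(\<lambda>n. of_nat (bounded_overpart ?K n) * q ^ n) sums S"
    by (metis summable_norm_cancel summable_sums)
  have "(\<lambda>n. of_nat (bounded_overpart N n) * q ^ n
       + (if n < ?K then 0 else of_nat (bounded_overpart ?K (n - ?K)) * q ^ n)
       + (if n < ?K then 0 else of_nat (bounded_overpart N (n - ?K)) * q ^ n))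
       sums (1 / gauss_prod N q + q ^ ?K * S + q ^ ?K * (1 / gauss_prod N q))"
    by (intro sums_add Suc sums_shift_power S)
  also have "(\<lambda>n. of_nat (bounded_overpart N n) * q ^ n
       + (if n < ?K then 0 else of_nat (bounded_overpart ?K (n - ?K)) * q ^ n)
       + (if n < ?K then 0 else of_nat (bounded_overpart N (n - ?K)) * q ^ n))
       = (\<lambda>n. of_nat (bounded_overpart ?K n) * q ^ n)"
  proof (rule ext)
    fix n show "of_nat (bounded_overpart N n) * q ^ n
       + (if n < ?K then 0 else of_nat (bounded_overpart ?K (n - ?K)) * q ^ n)
       + (if n < ?K then 0 else of_nat (bounded_overpart N (n - ?K)) * q ^ n)
       = of_nat (bounded_overpart ?K n) * q ^ n"
      by (simp add: bounded_overpart_Suc[of N n] distrib_right)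
  qed
  finally have "S = 1 / gauss_prod N q + q ^ ?K * S + q ^ ?K * (1 / gauss_prod N q)"
    using S sums_unique2 by blast
  then have eq: "S * (1 - q ^ ?K) = (1 + q ^ ?K) * (1 / gauss_prod N q)"
  proof -
    have "x * (1 - c) = (1 + c) * p" if "x = p + c * x + c * p" for x c p :: complex
      using that by algebra
    then show ?thesis by (metis \<open>S = 1 / gauss_prod N q + q ^ ?K * S + q ^ ?K * (1 / gauss_prod N q)\<close>)
  qed
  have nz: "1 + q ^ ?K \<noteq> 0" "1 - q ^ ?K \<noteq> 0" by (rule one_plus_power_nz[OF q]; simp)+
  have "S = (1 + q ^ ?K) * (1 / gauss_prod N q) / (1 - q ^ ?K)"
    using nz(2) eq by (metis nonzero_eq_divide_eq)
  also have "\<dots> = 1 / gauss_prod ?K q" unfolding gauss_prod_Suc using nz(1) by simp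
  finally have "S = 1 / gauss_prod ?K q" .
  then show ?case using S by simp
qed

text \<open>Partial sums up to \<open>N\<close> see only coefficients of the truncated series, so
  the uniform product bound gives absolute convergence. Afterwards the truncation error is dominated
  by a tail of the convergent series.\<close>

theorem overpart_sums:
  assumes q: "norm q < 1"
  shows "summable (\<lambda>n. norm (of_nat (overpart n) * q ^ n))"
    and "(\<lambda>n. of_nat (overpart n) * q ^ n) sums (1 / theta q)"
proof -
  define r where "r = norm q"
  have r: "0 \<le> r" "r < 1" using q by (auto simp: r_def)
  have nr: "norm (complex_of_real r) < 1" using r by simp
  let ?B = "exp (2 * norm (complex_of_real r) / (1 - norm (complex_of_real r))\<^sup>2)"
  have "sum (\<lambda>n. real (overpart n) * r ^ n) {..N} \<le> ?B" for N
  proof -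
    have "sum (\<lambda>n. real (overpart n) * r ^ n) {..N} = sum (\<lambda>n. real (bounded_overpart N n) * r ^ n) {..N}"
      by (rule sum.cong) (auto simp: bounded_overpart_eq)
    also have "\<dots> \<le> (\<Sum>n. real (bounded_overpart N n) * r ^ n)"
      using r by (intro sum_le_suminf bounded_overpart_summable) auto
    also have "\<dots> = norm (complex_of_real (\<Sum>n. real (bounded_overpart N n) * r ^ n))"
      using r by (simp add: suminf_nonneg bounded_overpart_summable)
    also have "complex_of_real (\<Sum>n. real (bounded_overpart N n) * r ^ n)
        = (\<Sum>n. of_nat (bounded_overpart N n) * complex_of_real r ^ n)"
      using suminf_of_real[OF bounded_overpart_summable[OF r], of N, where ?'a = complex] by simp
    also have "\<dots> = 1 / gauss_prod N (complex_of_real r)"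
      using bounded_overpart_sums[OF nr] by (simp add: sums_iff)
    also have "norm \<dots> \<le> ?B" by (rule norm_gauss_prod_le[OF nr])
    finally show ?thesis .
  qed
  then have sr: "summable (\<lambda>n. real (overpart n) * r ^ n)"
    using r by (intro bounded_imp_summable) auto
  then show sn: "summable (\<lambda>n. norm (of_nat (overpart n) * q ^ n))"
    by (simp add: norm_mult norm_power r_def)
  let ?F = "\<Sum>n. of_nat (overpart n) * q ^ n"
  have sF: "summable (\<lambda>n. of_nat (overpart n) * q ^ n)" using sn by (rule summable_norm_cancel)
  have "norm (?F - 1 / gauss_prod N q) \<le> (\<Sum>n. real (overpart (n + Suc N)) * r ^ (n + Suc N))" for N
  proof -
    let ?d = "\<lambda>n. (of_nat (overpart n) - of_nat (bounded_overpart N n)) * q ^ n"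
    have "?d sums (?F - 1 / gauss_prod N q)"
      using sums_diff[OF summable_sums[OF sF] bounded_overpart_sums[OF q, of N]]
      by (simp add: algebra_simps)
    then have "(\<lambda>n. ?d (n + Suc N)) sums (?F - 1 / gauss_prod N q)"
      by (subst sums_zero_iff_shift) (auto simp: bounded_overpart_eq)
    then have eq: "?F - 1 / gauss_prod N q = (\<Sum>n. ?d (n + Suc N))" by (simp add: sums_iff)
    have dn: "norm (?d n) \<le> real (overpart n) * r ^ n" for n
    proof -
      have "norm (of_nat (overpart n) - of_nat (bounded_overpart N n) :: complex)
          = real (overpart n - bounded_overpart N n)"
        using bounded_overpart_le[of N n] by (metis norm_of_nat of_nat_diff)
      also have "\<dots> \<le> real (overpart n)" by simp
      finally show ?thesis by (simp add: norm_mult norm_power r_def mult_right_mono)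
    qed
    have s: "summable (\<lambda>n. real (overpart (n + Suc N)) * r ^ (n + Suc N))"
      using sr by (rule summable_ignore_initial_segment)
    show ?thesis unfolding eq using dn by (intro norm_suminf_le s)
  qed
  moreover have "(\<lambda>N. \<Sum>n. real (overpart (n + Suc N)) * r ^ (n + Suc N)) \<longlonglongrightarrow> 0"
    using LIMSEQ_Suc[OF suminf_exist_split2[OF sr]] by simp
  ultimately have "(\<lambda>N. ?F - 1 / gauss_prod N q) \<longlonglongrightarrow> 0"
    by (rule Lim_null_comparison[OF eventuallyI])
  moreover have "(\<lambda>N. ?F - 1 / gauss_prod N q) \<longlonglongrightarrow> ?F - 1 / theta q"
    by (intro tendsto_intros gauss_prod_tendsto_theta theta_nz q)
  ultimately have "?F = 1 / theta q" using LIMSEQ_unique by fastforce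
  then show "(\<lambda>n. of_nat (overpart n) * q ^ n) sums (1 / theta q)"
    using summable_sums[OF sF] by simp
qed

text \<open>The exponent \<open>m\<close> of the sign may stand for its root \<open>k\<close>, since
  \<open>k\<close> and its square have equal parity.\<close>

definition theta_coeff :: "nat \<Rightarrow> complex" where
  "theta_coeff m = (if m = 0 then 1 else if \<exists>k. m = k\<^sup>2 then 2 * (-1) ^ m else 0)"

lemma theta_coeff_sums:
  assumes q: "norm q < 1"
  shows "(\<lambda>m. theta_coeff m * q ^ m) sums theta q"
    and "summable (\<lambda>m. norm (theta_coeff m * q ^ m))"
proof -
  define c where "c m = (if m = 0 then 0 else theta_coeff m)" for m
  have mono: "strict_mono (\<lambda>k. (Suc k)\<^sup>2)" by (rule strict_monoI) (simp add: power_strict_mono)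
  have zero: "c m * q ^ m = 0" if "m \<notin> range (\<lambda>k. (Suc k)\<^sup>2)" for m
  proof -
    have "\<not> ((\<exists>k. m = k\<^sup>2) \<and> m \<noteq> 0)"
    proof
      assume "(\<exists>k. m = k\<^sup>2) \<and> m \<noteq> 0"
      then obtain k where "m = k\<^sup>2" "k \<noteq> 0" by auto
      then obtain j where "k = Suc j" by (cases k) auto
      then show False using that \<open>m = k\<^sup>2\<close> by blast
    qed
    then show ?thesis by (auto simp: c_def theta_coeff_def)
  qed
  have at: "c ((Suc k)\<^sup>2) * q ^ ((Suc k)\<^sup>2) = 2 * ((-1) ^ Suc k * q ^ ((Suc k)\<^sup>2))" for k
    by (simp add: c_def theta_coeff_def minus_one_power_iff del: power_Suc)
  have "(\<lambda>k. 2 * ((-1) ^ Suc k * q ^ ((Suc k)\<^sup>2))) sums (2 * (\<Sum>k. (-1) ^ Suc k * q ^ ((Suc k)\<^sup>2)))"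
    using summable_theta[OF q] by (intro sums_mult summable_sums) (rule summable_norm_cancel)
  then have "(\<lambda>m. c m * q ^ m) sums (2 * (\<Sum>k. (-1) ^ Suc k * q ^ ((Suc k)\<^sup>2)))"
    unfolding at[symmetric] by (subst (asm) sums_mono_reindex[OF mono]) (use zero in auto)
  from sums_add[OF sums_single[of 0 "\<lambda>_. 1"] this]
  have "(\<lambda>m. (if m = 0 then 1 else 0) + c m * q ^ m) sums theta q"
    by (simp add: theta_def)
  also have "(\<lambda>m. (if m = 0 then 1 else 0) + c m * q ^ m) = (\<lambda>m. theta_coeff m * q ^ m)"
    by (rule ext) (simp add: c_def theta_coeff_def)
  finally show "(\<lambda>m. theta_coeff m * q ^ m) sums theta q" .
  have "summable (\<lambda>m. 2 * norm q ^ m)" using q by (intro summable_mult summable_geometric) simp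
  then show "summable (\<lambda>m. norm (theta_coeff m * q ^ m))"
    by (rule summable_comparison_test'[of _ 0])
      (auto simp: theta_coeff_def norm_mult norm_power)
qed

text \<open>Coefficients are compared in \<open>\<Theta> * (1 / \<Theta>) = 1\<close>. This is the
  recurrence by which the small cases are computed.\<close>

lemma overpart_convolution:
  assumes "n > 0" shows "(\<Sum>i\<le>n. theta_coeff i * of_nat (overpart (n - i))) = 0"
proof -
  define d where "d n = (\<Sum>i\<le>n. theta_coeff i * of_nat (overpart (n - i)))" for n
  have "(\<lambda>n. d n * q ^ n) sums 1" if q: "norm q < 1" for q
  proof -
    have "(\<lambda>n. \<Sum>i\<le>n. theta_coeff i * q ^ i * (of_nat (overpart (n - i)) * q ^ (n - i)))
        sums ((\<Sum>n. theta_coeff n * q ^ n) * (\<Sum>n. of_nat (overpart n) * q ^ n))"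
      by (intro Cauchy_product_sums theta_coeff_sums(2) overpart_sums(1) q)
    also have "(\<Sum>n. theta_coeff n * q ^ n) * (\<Sum>n. of_nat (overpart n) * q ^ n) = 1"
      using theta_coeff_sums(1)[OF q] overpart_sums(2)[OF q] theta_nz[OF q] by (simp add: sums_iff)
    also have "(\<lambda>n. \<Sum>i\<le>n. theta_coeff i * q ^ i * (of_nat (overpart (n - i)) * q ^ (n - i)))
        = (\<lambda>n. d n * q ^ n)"
    proof (rule ext)
      fix n
      have "q ^ i * q ^ (n - i) = q ^ n" if "i \<le> n" for i
        using that by (simp flip: power_add)
      then show "(\<Sum>i\<le>n. theta_coeff i * q ^ i * (of_nat (overpart (n - i)) * q ^ (n - i))) = d n * q ^ n"
        unfolding d_def sum_distrib_right by (intro sum.cong refl) (simp add: mult_ac)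
    qed
    finally show ?thesis .
  qed
  then have zero: "(\<lambda>m. (d m - (if m = 0 then 1 else 0)) * (q - 0) ^ m) sums 0" if "norm (q - 0) < 1" for q
    using that sums_diff[OF _ sums_single[of 0 "\<lambda>_. 1"], of "\<lambda>n. d n * q ^ n" 1]
    by (simp add: left_diff_distrib if_distrib[of "\<lambda>x. x * _"] cong: if_cong)
  show ?thesis
  proof (rule ccontr)
    assume "\<not> ?thesis"
    then have nzd: "d n - (if n = 0 then 1 else 0) \<noteq> 0" using assms by (simp add: d_def)
    \<comment> \<open>A nonzero coefficient would keep the zero function away from 0 in some
      punctured disc.\<close>
    show False
    proof (rule powser_0_nonzero[where r = 1 and \<xi> = 0 and f = "\<lambda>_. 0" and m = n
          and a = "\<lambda>m. d m - (if m = 0 then 1 else 0)"])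
      fix e :: real assume "0 < e" "\<And>z. z \<in> cball 0 e - {0 :: complex} \<Longrightarrow> (0 :: complex) \<noteq> 0"
      from this(1) this(2)[of "complex_of_real e"] show False by simp
    qed (use zero nzd assms in auto)
  qed
qed

section \<open>Polya's proof of the theta transformation\<close>

definition binom_ratio :: "nat \<Rightarrow> nat \<Rightarrow> real" where
  "binom_ratio m d = real ((2 * m) choose (m + d)) / real ((2 * m) choose m)"

lemma binom_ratio_eq_0: "d > m \<Longrightarrow> binom_ratio m d = 0"
  by (simp add: binom_ratio_def)

lemma binom_ratio_Suc:
  "binom_ratio m (Suc d) = binom_ratio m d * (real m - real d) / (real m + real d + 1)"
proof (cases "d \<le> m")
  case True
  have "Suc (m + d) * ((2 * m) choose Suc (m + d)) = (2 * m - (m + d)) * ((2 * m) choose (m + d))"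
    using binomial_absorb_comp[of "2 * m" "m + d"] binomial_absorption[of "m + d" "2 * m - 1"]
    by (metis Suc_times_binomial_eq add_diff_cancel_left binomial_absorption mult.commute)
  then have "real (Suc (m + d)) * real ((2 * m) choose Suc (m + d)) = real (2 * m - (m + d)) * real ((2 * m) choose (m + d))"
    by (metis of_nat_mult)
  moreover have "real (2 * m - (m + d)) = real m - real d" using True by (simp add: of_nat_diff)
  ultimately have "real ((2 * m) choose Suc (m + d)) = (real m - real d) * real ((2 * m) choose (m + d)) / (real m + real d + 1)"
    by (simp add: eq_divide_eq algebra_simps)
  then show ?thesis by (simp add: binom_ratio_def mult_ac)
qed (simp add: binom_ratio_eq_0)

lemma sum_odd_numbers: "(\<Sum>i<d. 2 * real i + 1) = (real d)\<^sup>2"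
  by (induction d) (simp_all add: power2_eq_square algebra_simps)

text \<open>Product of the successive ratios
  \<open>(m - e) / (m + e + 1) = 1 - (2 e + 1) / (m + e + 1)\<close>; the odd numbers add up to
  \<open>d^2\<close>. The lower bound \<open>binom_ratio_ge\<close> runs the same way with
  \<open>1 - x \<ge> exp (- x / (1 - x))\<close>.\<close>

lemma binom_ratio_le:
  assumes "d \<le> m" "m > 0"
  shows "0 \<le> binom_ratio m d" "binom_ratio m d \<le> exp (- (real d)\<^sup>2 / (real m + real d))"
proof -
  show "0 \<le> binom_ratio m d" by (simp add: binom_ratio_def)
  have "binom_ratio m e \<le> exp (- (\<Sum>i<e. 2 * real i + 1) / (real m + real d))" if "e \<le> d" for e
    using that
  proof (induction e)
    case 0
    show ?case by (simp add: binom_ratio_def)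
  next
    case (Suc e)
    have "(real m - real e) / (real m + real e + 1) = 1 + (- (2 * real e + 1) / (real m + real e + 1))"
      by (simp add: field_simps)
    also have "\<dots> \<le> exp (- (2 * real e + 1) / (real m + real e + 1))" by (rule exp_ge_add_one_self)
    also have "\<dots> \<le> exp (- (2 * real e + 1) / (real m + real d))"
    proof -
      have "(2 * real e + 1) / (real m + real d) \<le> (2 * real e + 1) / (real m + real e + 1)"
        using Suc.prems by (intro divide_left_mono) auto
      then show ?thesis by (simp only: minus_divide_left[symmetric] neg_le_iff_le exp_le_cancel_iff)
    qed
    finally have "binom_ratio m e * ((real m - real e) / (real m + real e + 1))
        \<le> exp (- (\<Sum>i<e. 2 * real i + 1) / (real m + real d)) * exp (- (2 * real e + 1) / (real m + real d))"
      using Suc assms by (intro mult_mono) (auto simp: binom_ratio_def)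
    also have "\<dots> = exp (- (\<Sum>i<Suc e. 2 * real i + 1) / (real m + real d))"
      by (simp add: exp_add[symmetric] add_divide_distrib diff_divide_distrib algebra_simps)
    finally show ?case by (simp add: binom_ratio_Suc)
  qed
  from this[of d] show "binom_ratio m d \<le> exp (- (real d)\<^sup>2 / (real m + real d))"
    by (simp add: sum_odd_numbers)
qed

lemma one_minus_ge_exp:
  fixes x :: real assumes "x < 1" shows "exp (- x / (1 - x)) \<le> 1 - x"
proof -
  have "1 / (1 - x) = 1 + x / (1 - x)" using assms by (simp add: field_simps)
  also have "\<dots> \<le> exp (x / (1 - x))" by (rule exp_ge_add_one_self)
  finally have "1 / exp (x / (1 - x)) \<le> 1 - x" using assms by (simp add: field_simps)
  then show ?thesis by (simp add: exp_minus field_simps)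
qed

lemma binom_ratio_ge:
  assumes "d < m"
  shows "exp (- (real d)\<^sup>2 / (real m - real d)) \<le> binom_ratio m d"
proof -
  have "exp (- (\<Sum>i<e. 2 * real i + 1) / (real m - real d)) \<le> binom_ratio m e" if "e \<le> d" for e
    using that
  proof (induction e)
    case 0
    show ?case by (simp add: binom_ratio_def)
  next
    case (Suc e)
    let ?x = "(2 * real e + 1) / (real m + real e + 1)"
    have em: "real e < real m" using Suc assms by simp
    have x: "1 - ?x = (real m - real e) / (real m + real e + 1)"
      by (simp add: field_simps)
    then have x1: "?x < 1" using em by (smt (verit) divide_pos_pos of_nat_0_le_iff)
    have "?x / (1 - ?x) = (2 * real e + 1) / (real m - real e)"
      unfolding x using em by (simp add: divide_simps)
    moreover have "(2 * real e + 1) / (real m - real e) \<le> (2 * real e + 1) / (real m - real d)"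
      using Suc.prems assms em by (intro divide_left_mono) auto
    ultimately have "exp (- (2 * real e + 1) / (real m - real d)) \<le> exp (- ?x / (1 - ?x))"
      by (simp only: minus_divide_left[symmetric] exp_le_cancel_iff neg_le_iff_le)
    also have "\<dots> \<le> 1 - ?x" by (rule one_minus_ge_exp[OF x1])
    finally have "exp (- (\<Sum>i<e. 2 * real i + 1) / (real m - real d)) * exp (- (2 * real e + 1) / (real m - real d))
        \<le> binom_ratio m e * ((real m - real e) / (real m + real e + 1))"
      unfolding x using Suc assms em by (intro mult_mono) (auto simp: binom_ratio_def)
    also have "exp (- (\<Sum>i<e. 2 * real i + 1) / (real m - real d)) * exp (- (2 * real e + 1) / (real m - real d))
        = exp (- (\<Sum>i<Suc e. 2 * real i + 1) / (real m - real d))"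
      by (simp add: exp_add[symmetric] add_divide_distrib diff_divide_distrib algebra_simps)
    finally show ?case by (simp add: binom_ratio_Suc)
  qed
  from this[of d] show ?thesis by (simp add: sum_odd_numbers)
qed

text \<open>Expresses the partial products of Wallis by central binomials, so that their limit
  yields the asymptotics of \<open>(2 n) choose n\<close>.\<close>

lemma central_binomial_wallis:
  "(\<Prod>k=1..n. (4 * real k ^ 2) / (4 * real k ^ 2 - 1)) = (4 ^ n / real ((2 * n) choose n))\<^sup>2 / (2 * real n + 1)"
proof (induction n)
  case (Suc n)
  define B where "B = real ((2 * n) choose n)"
  have B: "B > 0" by (simp add: B_def)
  have c': "real ((2 * Suc n) choose Suc n) = 2 * (2 * real n + 1) * B / (real n + 1)"
  proof -
    have "real ((2 * Suc n) choose Suc n) = fact (Suc (Suc (2 * n))) / (fact (Suc n) * fact (Suc n))"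
      using binomial_fact[of "Suc n" "2 * Suc n", where 'a = real] by simp
    also have "\<dots> = (2 * (real n + 1) * (2 * real n + 1) * fact (2 * n)) / ((real n + 1) * fact n * ((real n + 1) * fact n))"
      unfolding fact_Suc by (simp add: algebra_simps)
    also have "\<dots> = 2 * (2 * real n + 1) * (fact (2 * n) / (fact n * fact n)) / (real n + 1)"
      by (simp add: divide_simps) (simp add: algebra_simps)
    also have "fact (2 * n) / (fact n * fact n) = B"
      using binomial_fact[of n "2 * n", where 'a = real] by (simp add: B_def)
    finally show ?thesis .
  qed
  have sq: "4 * real (Suc n) ^ 2 - 1 = (2 * real n + 1) * (2 * real n + 3)"
    by (simp add: power2_eq_square algebra_simps)
  have "(\<Prod>k=1..Suc n. (4 * real k ^ 2) / (4 * real k ^ 2 - 1))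
      = (4 ^ n / B)\<^sup>2 / (2 * real n + 1) * (4 * (real n + 1) ^ 2 / ((2 * real n + 1) * (2 * real n + 3)))"
    using Suc sq by (simp add: B_def add.commute)
  also have "\<dots> = (4 ^ Suc n / (2 * (2 * real n + 1) * B / (real n + 1)))\<^sup>2 / (2 * real n + 3)"
  proof -
    have "(F / B)\<^sup>2 / a * (4 * c ^ 2 / (a * b)) = (4 * F / (2 * a * B / c))\<^sup>2 / b"
      if "a \<noteq> 0" "b \<noteq> 0" "c \<noteq> 0" for a b c F :: real
      using that B by (simp add: field_simps power2_eq_square)
    from this[of "2 * real n + 1" "2 * real n + 3" "real n + 1" "4 ^ n"] show ?thesis by simp
  qed
  finally show ?case unfolding c' by (simp add: algebra_simps)
qed simp

lemma central_binomial_asymp: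
  "(\<lambda>n. 4 ^ n / real ((2 * n) choose n) / sqrt (real n)) \<longlonglongrightarrow> sqrt pi"
proof -
  have "(\<lambda>n. (4 ^ n / real ((2 * n) choose n))\<^sup>2 / (2 * real n + 1) * ((2 * real n + 1) / real n)) \<longlonglongrightarrow> pi / 2 * 2"
    by (intro tendsto_mult wallis[unfolded central_binomial_wallis]) real_asymp
  then have "(\<lambda>n. sqrt ((4 ^ n / real ((2 * n) choose n))\<^sup>2 / (2 * real n + 1) * ((2 * real n + 1) / real n))) \<longlonglongrightarrow> sqrt (pi / 2 * 2)"
    by (rule tendsto_real_sqrt)
  also have "(\<lambda>n. sqrt ((4 ^ n / real ((2 * n) choose n))\<^sup>2 / (2 * real n + 1) * ((2 * real n + 1) / real n)))
     = (\<lambda>n. 4 ^ n / real ((2 * n) choose n) / sqrt (real n))"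
  proof
    fix n
    have "2 * real n + 1 \<noteq> 0" by (smt (verit) of_nat_0_le_iff)
    then have "(4 ^ n / real ((2 * n) choose n))\<^sup>2 / (2 * real n + 1) * ((2 * real n + 1) / real n) = (4 ^ n / real ((2 * n) choose n))\<^sup>2 / real n"
      by simp
    then show "sqrt ((4 ^ n / real ((2 * n) choose n))\<^sup>2 / (2 * real n + 1) * ((2 * real n + 1) / real n)) = 4 ^ n / real ((2 * n) choose n) / sqrt (real n)"
      by (simp only: real_sqrt_divide real_sqrt_abs) simp
  qed
  finally show ?thesis by simp
qed

lemma tannery_uniform:
  fixes a :: "nat \<Rightarrow> nat \<Rightarrow> real"
  assumes "\<And>k. (\<lambda>n. a k n) \<longlonglongrightarrow> b k"
    and "eventually (\<lambda>n. \<forall>k. \<bar>a k n\<bar> \<le> M k) sequentially" and "summable M"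
  shows "(\<lambda>n. \<Sum>k. a k n) \<longlonglongrightarrow> (\<Sum>k. b k)"
proof -
  have "eventually (\<lambda>(k, n). norm (a k n) \<le> M k) (at_top \<times>\<^sub>F sequentially)"
    unfolding eventually_prod_filter
    using assms(2) by (intro exI[of _ "\<lambda>_. True"] exI[of _ "\<lambda>n. \<forall>k. \<bar>a k n\<bar> \<le> M k"]) auto
  from tannerys_theorem[OF assms(1) this assms(3)] show ?thesis by simp
qed

section \<open>Polya's trigonometric identity\<close>

lemma cos_double_power:
  "(2 * cos x) ^ (2 * m) = (\<Sum>i\<le>2*m. real ((2 * m) choose i) * cos (2 * x * (real i - real m)))"
proof -
  have "complex_of_real ((2 * cos x) ^ (2 * m)) = (cis x + cis (- x)) ^ (2 * m)"
    by (simp add: complex_eq_iff flip: cis_cnj)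
  also have "\<dots> = (\<Sum>i\<le>2*m. of_nat ((2 * m) choose i) * cis x ^ i * cis (- x) ^ (2 * m - i))"
    by (rule binomial_ring)
  also have "\<dots> = (\<Sum>i\<le>2*m. of_nat ((2 * m) choose i) * cis (2 * x * (real i - real m)))"
  proof (rule sum.cong[OF refl])
    fix i assume "i \<in> {..2*m}"
    then have "real i * x + real (2 * m - i) * (- x) = 2 * x * (real i - real m)"
      by (simp add: of_nat_diff algebra_simps)
    then show "of_nat ((2 * m) choose i) * cis x ^ i * cis (- x) ^ (2 * m - i)
        = of_nat ((2 * m) choose i) * cis (2 * x * (real i - real m))"
      unfolding Complex.DeMoivre mult.assoc cis_mult by simp
  qed
  finally have "Re (complex_of_real ((2 * cos x) ^ (2 * m)))
      = Re (\<Sum>i\<le>2*m. of_nat ((2 * m) choose i) * cis (2 * x * (real i - real m)))" by simp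
  then show ?thesis unfolding Re_complex_of_real by (simp add: Re_sum)
qed

lemma sum_central_binomial_even:
  assumes even: "\<And>d. f (- d) = f d"
  shows "(\<Sum>i\<le>2*m. real ((2 * m) choose i) * f (real i - real m))
    = real ((2 * m) choose m) * (f 0 + 2 * (\<Sum>d=1..m. binom_ratio m d * f (real d)))"
proof -
  let ?c = "\<lambda>i. real ((2 * m) choose i) * f (real i - real m)"
  have un: "{..2*m} = {..<m} \<union> insert m {m<..2*m}" by auto
  have "sum ?c {..2*m} = sum ?c {..<m} + sum ?c (insert m {m<..2*m})"
    unfolding un by (rule sum.union_disjoint) auto
  also have "sum ?c (insert m {m<..2*m}) = ?c m + sum ?c {m<..2*m}" by simp
  also have "sum ?c {..<m} = sum ?c {m<..2*m}"
  proof (rule sum.reindex_bij_witness[of _ "\<lambda>i. 2 * m - i" "\<lambda>i. 2 * m - i"])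
    fix i assume i: "i \<in> {..<m}"
    then have "f (real (2 * m - i) - real m) = f (- (real i - real m))" by (simp add: of_nat_diff)
    moreover have "(2 * m) choose (2 * m - i) = (2 * m) choose i"
      using i by (intro binomial_symmetric[symmetric]) auto
    ultimately show "?c (2 * m - i) = ?c i" using even[of "real i - real m"] by simp
  qed auto
  also have "sum ?c {m<..2*m} = (\<Sum>d=1..m. real ((2 * m) choose (m + d)) * f (real d))"
    by (rule sum.reindex_bij_witness[of _ "\<lambda>d. m + d" "\<lambda>i. i - m"]) (auto simp: of_nat_diff)
  also have "\<dots> = real ((2 * m) choose m) * (\<Sum>d=1..m. binom_ratio m d * f (real d))"
    by (simp add: binom_ratio_def sum_distrib_left)
  finally show ?thesis by (simp add: algebra_simps)
qed

text \<open>Root-of-unity filter on odd multiples of \<open>pi / (2 h)\<close>: a geometric sum of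
  powers of \<open>w\<close>, zero unless \<open>w = 1\<close>. The half step in the nodes
  contributes the sign \<open>(-1)^k\<close> at \<open>d = 2 h k\<close>.\<close>

lemma sum_cos_roots:
  assumes h: "h > 0"
  shows "(\<Sum>j<2*h. cos (pi * (2 * real j + 1) / (2 * real h) * real d))
    = (if 2 * h dvd d then 2 * real h * (-1) ^ (d div (2 * h)) else 0)"
proof -
  define w where "w = cis (pi * real d / real h)"
  have cis_eq: "cis (pi * (2 * real j + 1) / (2 * real h) * real d) = cis (pi * real d / (2 * real h)) * w ^ j" for j
  proof -
    have "pi * (2 * real j + 1) / (2 * real h) * real d = pi * real d / (2 * real h) + real j * (pi * real d / real h)"
      using h by (simp add: field_simps)
    then show ?thesis unfolding w_def by (metis Complex.DeMoivre cis_mult)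
  qed
  have wpow: "w ^ (2 * h) = 1"
  proof -
    have "w ^ (2 * h) = cis (2 * pi * real d)"
      unfolding w_def Complex.DeMoivre using h by (simp add: mult_ac)
    then show ?thesis by (simp add: cis_multiple_2pi)
  qed
  have sum: "(\<Sum>j<2*h. cis (pi * (2 * real j + 1) / (2 * real h) * real d))
      = cis (pi * real d / (2 * real h)) * (\<Sum>j<2*h. w ^ j)"
    unfolding cis_eq by (simp add: sum_distrib_left)
  have Re: "(\<Sum>j<2*h. cos (pi * (2 * real j + 1) / (2 * real h) * real d))
     = Re (cis (pi * real d / (2 * real h)) * (\<Sum>j<2*h. w ^ j))"
    unfolding sum[symmetric] by (simp add: Re_sum)
  show ?thesis
  proof (cases "2 * h dvd d")
    case True
    then obtain k where k: "d = 2 * h * k" by blast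
    have "pi * real d / real h = 2 * pi * real k" unfolding k using h by simp
    then have "w = 1" unfolding w_def by (simp add: cis_multiple_2pi)
    moreover have "cis (pi * real d / (2 * real h)) = (-1) ^ k"
    proof -
      have "pi * real d / (2 * real h) = real k * pi" unfolding k using h by simp
      then show ?thesis by (metis Complex.DeMoivre cis_pi)
    qed
    ultimately show ?thesis using k h unfolding Re
      by (simp add: minus_one_power_iff)
  next
    case False
    have "w \<noteq> 1"
    proof
      assume "w = 1"
      then have "cos (pi * real d / real h) = 1" unfolding w_def by (simp add: complex_eq_iff)
      then obtain n :: int where n: "pi * real d / real h = of_int n * 2 * pi" by (auto simp: cos_one_2pi_int)
      then have "real d = of_int n * 2 * real h" using h by (simp add: field_simps)
      then have "real_of_int (int d) = real_of_int (n * (2 * int h))" by simp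
      then have "int d = n * (2 * int h)" by (simp only: of_int_eq_iff)
      then have "int (2 * h) dvd int d" by simp
      then show False using False by (simp only: int_dvd_int_iff)
    qed
    then have "(\<Sum>j<2*h. w ^ j) = 0" using wpow by (simp add: geometric_sum)
    then show ?thesis unfolding Re using False by simp
  qed
qed

text \<open>Sum \<open>(2 cos x) ^ (2 m)\<close> over \<open>2 h\<close> equally spaced nodes: the
  filter keeps the binomials whose distance from the middle is a multiple of \<open>2 h\<close>.
  Nodes \<open>j\<close> and \<open>2 h - 1 - j\<close> are supplementary angles, which halves the
  right-hand sum. For \<open>m\<close> of order \<open>h^2\<close> the left side leads to a theta
  series and the right side to a Gaussian sum.\<close>

lemma polya_identity:
  assumes h: "h > 0" and m: "m > 0"
  shows "real ((2 * m) choose m) * (1 + 2 * (\<Sum>k. (-1) ^ Suc k * binom_ratio m (2 * h * Suc k)))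
    = 4 ^ m / real h * (\<Sum>j<h. cos (pi * (2 * real j + 1) / (4 * real h)) ^ (2 * m))"
proof -
  let ?x = "\<lambda>j. pi * (2 * real j + 1) / (4 * real h)"
  define f where "f t = (\<Sum>j<2*h. cos (2 * ?x j * t))" for t
  have f: "f (real d) = (if 2 * h dvd d then 2 * real h * (-1) ^ (d div (2 * h)) else 0)" for d
  proof -
    have "2 * ?x j = pi * (2 * real j + 1) / (2 * real h)" for j by simp
    then show ?thesis unfolding f_def using sum_cos_roots[OF h, of d] by (simp only:)
  qed
  have "(\<Sum>j<2*h. (2 * cos (?x j)) ^ (2 * m)) = (\<Sum>i\<le>2*m. real ((2 * m) choose i) * f (real i - real m))"
    unfolding cos_double_power f_def sum_distrib_left by (rule sum.swap)
  also have "\<dots> = real ((2 * m) choose m) * (f 0 + 2 * (\<Sum>d=1..m. binom_ratio m d * f (real d)))"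
    by (rule sum_central_binomial_even) (simp add: f_def)
  also have "(\<Sum>d=1..m. binom_ratio m d * f (real d))
     = 2 * real h * (\<Sum>k. (-1) ^ Suc k * binom_ratio m (2 * h * Suc k))"
  proof -
    have inj: "inj_on (\<lambda>k. 2 * h * Suc k) A" for A using h by (auto simp: inj_on_def)
    have "(\<Sum>d=1..m. binom_ratio m d * f (real d))
        = (\<Sum>d\<in>(\<lambda>k. 2 * h * Suc k) ` {..<m}. binom_ratio m d * f (real d))"
    proof (rule sum.mono_neutral_cong)
      fix d assume "d \<in> (\<lambda>k. 2 * h * Suc k) ` {..<m} - {1..m}"
      then have "d > m" using h by auto
      then show "binom_ratio m d * f (real d) = 0" by (simp add: binom_ratio_eq_0)
    next
      fix d assume d: "d \<in> {1..m} - (\<lambda>k. 2 * h * Suc k) ` {..<m}"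
      have "\<not> 2 * h dvd d"
      proof
        assume "2 * h dvd d"
        then obtain k where k: "d = 2 * h * k" by blast
        with d obtain k' where k': "k = Suc k'" by (cases k) auto
        have "k' < m" using d k k' h by (cases h) auto
        then show False using d k k' by blast
      qed
      then show "binom_ratio m d * f (real d) = 0" by (simp add: f)
    qed auto
    also have "\<dots> = (\<Sum>k<m. binom_ratio m (2 * h * Suc k) * (2 * real h * (-1) ^ Suc k))"
      unfolding sum.reindex[OF inj] o_def f using h by simp
    also have "\<dots> = (\<Sum>k. binom_ratio m (2 * h * Suc k) * (2 * real h * (-1) ^ Suc k))"
    proof (rule suminf_finite[symmetric])
      fix k assume "k \<notin> {..<m}"
      then have "2 * h * Suc k > m" using h by (cases h) auto
      then show "binom_ratio m (2 * h * Suc k) * (2 * real h * (-1) ^ Suc k) = 0"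
        by (simp only: binom_ratio_eq_0)
    qed simp
    also have "\<dots> = (\<Sum>k. 2 * real h * ((-1) ^ Suc k * binom_ratio m (2 * h * Suc k)))"
      by (simp only: mult_ac)
    also have "\<dots> = 2 * real h * (\<Sum>k. (-1) ^ Suc k * binom_ratio m (2 * h * Suc k))"
    proof (rule suminf_mult, rule summable_finite[of "{..<m}"])
      fix k assume "k \<notin> {..<m}"
      then have "2 * h * Suc k > m" using h by (cases h) auto
      then show "(-1) ^ Suc k * binom_ratio m (2 * h * Suc k) = 0" by (simp only: binom_ratio_eq_0)
    qed simp
    finally show ?thesis .
  qed
  also have "f 0 = 2 * real h" using f[of 0] by simp
  finally have 1: "(\<Sum>j<2*h. (2 * cos (?x j)) ^ (2 * m)) = 2 * real h * (real ((2 * m) choose m) *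
     (1 + 2 * (\<Sum>k. (-1) ^ Suc k * binom_ratio m (2 * h * Suc k))))"
    by (simp add: algebra_simps)
  have "(\<Sum>j<2*h. (2 * cos (?x j)) ^ (2 * m)) = (\<Sum>j<h. (2 * cos (?x j)) ^ (2 * m)) + (\<Sum>j\<in>{h..<2*h}. (2 * cos (?x j)) ^ (2 * m))"
    by (subst sum.union_disjoint[symmetric]) (auto intro: sum.cong)
  also have "(\<Sum>j\<in>{h..<2*h}. (2 * cos (?x j)) ^ (2 * m)) = (\<Sum>j<h. (2 * cos (?x j)) ^ (2 * m))"
  proof (rule sum.reindex_bij_witness[of _ "\<lambda>j. 2 * h - 1 - j" "\<lambda>j. 2 * h - 1 - j"])
    fix j assume j: "j \<in> {h..<2*h}"
    then have "?x (2 * h - 1 - j) = pi - ?x j" using h by (simp add: of_nat_diff field_simps)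
    then show "(2 * cos (?x (2 * h - 1 - j))) ^ (2 * m) = (2 * cos (?x j)) ^ (2 * m)"
      by (simp only: cos_pi_minus power_mult) simp
  qed auto
  also have "(\<Sum>j<h. (2 * cos (?x j)) ^ (2 * m)) = 4 ^ m * (\<Sum>j<h. cos (?x j) ^ (2 * m))"
    by (simp add: power_mult_distrib power_mult sum_distrib_left)
  finally have "2 * real h * (real ((2 * m) choose m) *
     (1 + 2 * (\<Sum>k. (-1) ^ Suc k * binom_ratio m (2 * h * Suc k)))) = 2 * (4 ^ m * (\<Sum>j<h. cos (?x j) ^ (2 * m)))"
    using 1 by simp
  then show ?thesis using h by (simp add: field_simps)
qed

section \<open>Passing to the limit in Polya's identity\<close>

lemma jordan_sin:
  fixes x :: real assumes "0 \<le> x" "x \<le> pi / 2" shows "2 * x / pi \<le> sin x"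
proof -
  have conv: "convex_on {0..pi/2} (\<lambda>x. - sin x)"
    by (rule f''_ge0_imp_convex[where f' = "\<lambda>x. - cos x" and f'' = sin])
      (auto intro!: derivative_eq_intros sin_ge_zero)
  have "- sin ((1 - 2 * x / pi) *\<^sub>R 0 + (2 * x / pi) *\<^sub>R (pi / 2))
      \<le> (1 - 2 * x / pi) * (- sin 0) + (2 * x / pi) * (- sin (pi / 2))"
    by (rule convex_onD[OF conv]) (use assms in \<open>auto simp: field_simps\<close>)
  then show ?thesis by simp
qed

text \<open>Chosen so that \<open>(2 h k)^2 / m\<close> tends to \<open>a k^2\<close>, the exponent
  wanted in the theta series.\<close>

definition polya_m :: "real \<Rightarrow> nat \<Rightarrow> nat" where
  "polya_m a h = nat \<lfloor>4 * real h ^ 2 / a\<rfloor>"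

lemma polya_m_le: "a > 0 \<Longrightarrow> real (polya_m a h) \<le> 4 * real h ^ 2 / a"
  unfolding polya_m_def by (simp add: of_nat_nat)

lemma polya_m_ge: "a > 0 \<Longrightarrow> real (polya_m a h) \<ge> 4 * real h ^ 2 / a - 1"
proof -
  assume "a > 0"
  then have "4 * real h ^ 2 / a \<ge> 0" by simp
  then have "real (polya_m a h) = real_of_int \<lfloor>4 * real h ^ 2 / a\<rfloor>"
    unfolding polya_m_def by (simp add: of_nat_nat)
  then show ?thesis by linarith
qed

lemma polya_m_ratio:
  assumes a: "a > 0" shows "(\<lambda>h. real (polya_m a h) / real h ^ 2) \<longlonglongrightarrow> 4 / a"
proof (rule tendsto_sandwich)
  show "\<forall>\<^sub>F h in sequentially. 4 / a - 1 / real h ^ 2 \<le> real (polya_m a h) / real h ^ 2"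
    using eventually_gt_at_top[of 0]
  proof eventually_elim
    case (elim h)
    have "(4 * real h ^ 2 / a - 1) / real h ^ 2 \<le> real (polya_m a h) / real h ^ 2"
      by (intro divide_right_mono polya_m_ge a) auto
    then show ?case using elim by (simp add: diff_divide_distrib)
  qed
  show "\<forall>\<^sub>F h in sequentially. real (polya_m a h) / real h ^ 2 \<le> 4 / a"
    using eventually_gt_at_top[of 0]
  proof eventually_elim
    case (elim h)
    then show ?case using polya_m_le[OF a, of h] a by (simp add: field_simps)
  qed
  show "(\<lambda>h. 4 / a - 1 / real h ^ 2) \<longlonglongrightarrow> 4 / a"
    by real_asymp
qed simp

lemma binom_ratio_tendsto:
  assumes a: "a > 0"
  shows "(\<lambda>h. binom_ratio (polya_m a h) (2 * h * Suc k)) \<longlonglongrightarrow> exp (- a * real (Suc k) ^ 2)"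
proof -
  let ?m = "\<lambda>h. real (polya_m a h)" and ?d = "\<lambda>h. real (2 * h * Suc k)"
  define c where "c = 2 * real (Suc k)"
  have c0: "(\<lambda>h. c / real h) \<longlonglongrightarrow> 0" by real_asymp
  \<comment> \<open>With \<open>d = c h\<close>, the two bounds of \<open>binom_ratio\<close> have
    exponents of this form, with \<open>e = 1\<close> above and \<open>e = -1\<close> below; both
    tend to \<open>- c^2 a / 4\<close>.\<close>
  have lim: "(\<lambda>h. exp (- c\<^sup>2 / (?m h / real h ^ 2 + e * (c / real h)))) \<longlonglongrightarrow> exp (- a * real (Suc k) ^ 2)" for e :: real
  proof -
    have "(\<lambda>h. exp (- c\<^sup>2 / (?m h / real h ^ 2 + e * (c / real h)))) \<longlonglongrightarrow> exp (- c\<^sup>2 / (4 / a + e * 0))"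
      using a by (intro tendsto_intros polya_m_ratio c0) auto
    also have "- c\<^sup>2 / (4 / a + e * 0) = - a * real (Suc k) ^ 2"
      by (simp add: c_def power_mult_distrib del: of_nat_Suc)
    finally show ?thesis .
  qed
  have lt: "eventually (\<lambda>h. c / real h < ?m h / real h ^ 2) sequentially"
  proof -
    have "eventually (\<lambda>h. c / real h < 2 / a) sequentially"
      by (rule order_tendstoD(2)[OF c0]) (use a in simp)
    moreover have "eventually (\<lambda>h. 2 / a < ?m h / real h ^ 2) sequentially"
      by (rule order_tendstoD(1)[OF polya_m_ratio[OF a]]) (use a in \<open>simp add: divide_strict_right_mono\<close>)
    ultimately show ?thesis by eventually_elim linarith
  qed
  have ev: "eventually (\<lambda>h. 2 * h * Suc k < polya_m a h \<and>
      (?d h)\<^sup>2 / (?m h + ?d h) = c\<^sup>2 / (?m h / real h ^ 2 + 1 * (c / real h)) \<and>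
      (?d h)\<^sup>2 / (?m h - ?d h) = c\<^sup>2 / (?m h / real h ^ 2 + (-1) * (c / real h))) sequentially"
    using lt eventually_gt_at_top[of 0]
  proof eventually_elim
    case (elim h)
    have h: "real h > 0" using elim by simp
    have d: "?d h = c * real h" by (simp add: c_def algebra_simps)
    have "?d h < ?m h" using elim(1) h unfolding d by (simp add: field_simps power2_eq_square)
    then have "2 * h * Suc k < polya_m a h" by (simp only: of_nat_less_iff)
    moreover have "(?d h)\<^sup>2 / (?m h + e * ?d h) = c\<^sup>2 / (?m h / real h ^ 2 + e * (c / real h))" for e
    proof -
      have "?m h / real h ^ 2 + e * (c / real h) = (?m h + e * ?d h) / real h ^ 2"
        unfolding d using h by (simp add: field_simps power2_eq_square)
      then show ?thesis unfolding d by (simp add: power_mult_distrib)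
    qed
    note eq = this
    have "(?d h)\<^sup>2 / (?m h + ?d h) = c\<^sup>2 / (?m h / real h ^ 2 + 1 * (c / real h))"
      using eq[of 1] by (simp only: mult_1_left)
    moreover have "(?d h)\<^sup>2 / (?m h - ?d h) = c\<^sup>2 / (?m h / real h ^ 2 + (-1) * (c / real h))"
      using eq[of "-1"] by (simp only: mult_minus1 add_uminus_conv_diff)
    ultimately show ?case by blast
  qed
  show ?thesis
  proof (rule tendsto_sandwich[OF _ _ lim[of "-1"] lim[of 1]])
    show "\<forall>\<^sub>F h in sequentially. exp (- c\<^sup>2 / (?m h / real h ^ 2 + (-1) * (c / real h))) \<le> binom_ratio (polya_m a h) (2 * h * Suc k)"
      using ev
    proof eventually_elim
      case (elim h)
      then show ?case using binom_ratio_ge[of "2 * h * Suc k" "polya_m a h"]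
        by (simp only: minus_divide_left[symmetric])
    qed
    show "\<forall>\<^sub>F h in sequentially. binom_ratio (polya_m a h) (2 * h * Suc k) \<le> exp (- c\<^sup>2 / (?m h / real h ^ 2 + 1 * (c / real h)))"
      using ev
    proof eventually_elim
      case (elim h)
      then have "2 * h * Suc k \<le> polya_m a h" "polya_m a h > 0" by linarith+
      from binom_ratio_le(2)[OF this] elim show ?case
        by (simp only: minus_divide_left[symmetric])
    qed
  qed
qed

text \<open>Domination for Tannery's theorem. With \<open>k\<close> for \<open>Suc k\<close>,
  \<open>d \<le> m\<close> and \<open>m \<le> 4 h^2 / a\<close> make the exponent
  \<open>d^2 / (m + d)\<close> at least \<open>a k^2 / 2\<close>; it is weakened to be linear in
  \<open>k\<close>, which gives a geometric majorant.\<close>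

lemma binom_ratio_bound:
  assumes a: "a > 0" and h: "h > 0"
  shows "\<bar>(-1) ^ Suc k * binom_ratio (polya_m a h) (2 * h * Suc k)\<bar> \<le> exp (- a / 2) ^ Suc k"
proof (cases "2 * h * Suc k \<le> polya_m a h")
  case True
  let ?m = "real (polya_m a h)" and ?d = "real (2 * h * Suc k)"
  have d0: "?d > 0" using h by (simp only: of_nat_0_less_iff) simp
  have dm: "?d \<le> ?m" using True by (simp only: of_nat_le_iff)
  have "a * real (Suc k) / 2 * (?m + ?d) \<le> a * real (Suc k) / 2 * (2 * ?m)"
    using a dm by (intro mult_left_mono) auto
  also have "\<dots> = a * real (Suc k) * ?m" by simp
  also have "\<dots> \<le> a * real (Suc k) * (4 * real h ^ 2 / a)"
    using a polya_m_le[OF a, of h] by (intro mult_left_mono) auto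
  also have "\<dots> = 4 * real h ^ 2 * real (Suc k)" using a by simp
  also have "\<dots> \<le> 4 * real h ^ 2 * (real (Suc k))\<^sup>2"
    by (intro mult_left_mono) (auto simp: power2_eq_square)
  also have "\<dots> = ?d\<^sup>2" by (simp add: power2_eq_square algebra_simps)
  finally have "a * real (Suc k) / 2 \<le> ?d\<^sup>2 / (?m + ?d)"
    using d0 dm by (simp add: pos_le_divide_eq del: of_nat_Suc of_nat_mult)
  then have "exp (- (?d\<^sup>2) / (?m + ?d)) \<le> exp (- (a * real (Suc k) / 2))"
    by (simp only: minus_divide_left[symmetric] exp_le_cancel_iff neg_le_iff_le)
  also have "\<dots> = exp (- a / 2) ^ Suc k" by (simp flip: exp_of_nat_mult add: mult_ac del: power_Suc of_nat_Suc)
  finally have "exp (- (?d\<^sup>2) / (?m + ?d)) \<le> exp (- a / 2) ^ Suc k" .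
  moreover have "polya_m a h > 0" using d0 dm by linarith
  ultimately show ?thesis using binom_ratio_le[OF True] by (simp add: abs_mult power_abs del: of_nat_mult of_nat_Suc power_Suc)
next
  case False
  then have "binom_ratio (polya_m a h) (2 * h * Suc k) = 0" by (intro binom_ratio_eq_0) simp
  then show ?thesis by (simp del: power_Suc)
qed

lemma cos_power_le:
  assumes "0 \<le> x" "x \<le> pi / 2"
  shows "cos x ^ (2 * m) \<le> exp (- real m * (2 * x / pi)\<^sup>2)"
proof -
  have "(2 * x / pi)\<^sup>2 \<le> (sin x)\<^sup>2" using assms by (intro power_mono jordan_sin) auto
  then have "(cos x)\<^sup>2 \<le> 1 + (- (2 * x / pi)\<^sup>2)" by (simp add: cos_squared_eq)
  also have "\<dots> \<le> exp (- (2 * x / pi)\<^sup>2)" by (rule exp_ge_add_one_self)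
  finally have "((cos x)\<^sup>2) ^ m \<le> exp (- (2 * x / pi)\<^sup>2) ^ m" by (intro power_mono) auto
  then show ?thesis by (simp add: power_mult flip: exp_of_nat_mult)
qed

text \<open>Since \<open>m sin^2 (c / h)\<close> tends to \<open>4 c^2 / a\<close>, the two
  exponential bounds of \<open>1 - x\<close> at \<open>x = sin^2 (c / h)\<close> squeeze the
  power.\<close>

lemma cos_power_tendsto:
  assumes a: "a > 0" and c: "c > 0"
  shows "(\<lambda>h. cos (c / real h) ^ (2 * polya_m a h)) \<longlonglongrightarrow> exp (- 4 * c\<^sup>2 / a)"
proof -
  let ?s = "\<lambda>h. (sin (c / real h))\<^sup>2" and ?m = "\<lambda>h. real (polya_m a h)"
  have "(\<lambda>h. c / real h) \<longlonglongrightarrow> 0" by real_asymp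
  then have "?s \<longlonglongrightarrow> (sin 0)\<^sup>2" by (intro tendsto_intros)
  then have s0: "?s \<longlonglongrightarrow> 0" by simp
  have "(\<lambda>h. real h * sin (c / real h)) \<longlonglongrightarrow> c" by real_asymp
  then have "(\<lambda>h. ?m h / real h ^ 2 * (real h * sin (c / real h))\<^sup>2) \<longlonglongrightarrow> 4 / a * c\<^sup>2"
    by (intro tendsto_mult polya_m_ratio a tendsto_power)
  also have "?this \<longleftrightarrow> (\<lambda>h. ?m h * ?s h) \<longlonglongrightarrow> 4 / a * c\<^sup>2"
    by (rule tendsto_cong) (use eventually_gt_at_top[of 0] in eventually_elim, simp add: power_mult_distrib)
  finally have ms: "(\<lambda>h. ?m h * ?s h) \<longlonglongrightarrow> 4 / a * c\<^sup>2" .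
  have l1: "(\<lambda>h. exp (- (?m h * ?s h) / (1 - ?s h))) \<longlonglongrightarrow> exp (- 4 * c\<^sup>2 / a)"
    using tendsto_exp[OF tendsto_divide[OF tendsto_minus[OF ms] tendsto_diff[OF tendsto_const[of 1] s0]]] by simp
  have l2: "(\<lambda>h. exp (- (?m h * ?s h))) \<longlonglongrightarrow> exp (- 4 * c\<^sup>2 / a)"
    using tendsto_exp[OF tendsto_minus[OF ms]] by simp
  have cosp: "cos (c / real h) ^ (2 * polya_m a h) = (1 - ?s h) ^ polya_m a h" for h
    by (simp add: power_mult cos_squared_eq)
  have lt1: "eventually (\<lambda>h. ?s h < 1) sequentially" using order_tendstoD(2)[OF s0, of 1] by simp
  show ?thesis unfolding cosp
  proof (rule tendsto_sandwich[OF _ _ l1 l2])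
    show "\<forall>\<^sub>F h in sequentially. exp (- (?m h * ?s h) / (1 - ?s h)) \<le> (1 - ?s h) ^ polya_m a h"
      using lt1
    proof eventually_elim
      case (elim h)
      from power_mono[OF one_minus_ge_exp[OF elim], of "polya_m a h"]
      show ?case by (simp flip: exp_of_nat_mult)
    qed
    show "\<forall>\<^sub>F h in sequentially. (1 - ?s h) ^ polya_m a h \<le> exp (- (?m h * ?s h))"
      using lt1
    proof eventually_elim
      case (elim h)
      have "1 - ?s h \<le> exp (- ?s h)" using exp_ge_add_one_self[of "- ?s h"] by simp
      then have "(1 - ?s h) ^ polya_m a h \<le> exp (- ?s h) ^ polya_m a h" using elim by (intro power_mono) auto
      then show ?case by (simp flip: exp_of_nat_mult)
    qed
  qed
qed

lemma real_theta_transform: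
  assumes a: "a > 0"
  shows "1 + 2 * (\<Sum>k. (-1) ^ Suc k * exp (- a * real (Suc k) ^ 2))
    = 2 * sqrt (pi / a) * (\<Sum>j. exp (- (pi\<^sup>2 * (2 * real j + 1)\<^sup>2 / (4 * a))))"
proof -
  let ?m = "polya_m a"
  define L where "L h = (\<Sum>k. (-1) ^ Suc k * binom_ratio (?m h) (2 * h * Suc k))" for h
  define R where "R h = (\<Sum>j<h. cos (pi * (2 * real j + 1) / (4 * real h)) ^ (2 * ?m h))" for h
  have L: "L \<longlonglongrightarrow> (\<Sum>k. (-1) ^ Suc k * exp (- a * real (Suc k) ^ 2))"
    unfolding L_def
  proof (rule tannery_uniform)
    show "(\<lambda>h. (-1) ^ Suc k * binom_ratio (?m h) (2 * h * Suc k)) \<longlonglongrightarrow> (-1) ^ Suc k * exp (- a * real (Suc k) ^ 2)" for k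
      by (intro tendsto_intros binom_ratio_tendsto a)
    show "\<forall>\<^sub>F h in sequentially. \<forall>k. \<bar>(-1) ^ Suc k * binom_ratio (?m h) (2 * h * Suc k)\<bar> \<le> exp (- a / 2) ^ Suc k"
      using eventually_gt_at_top[of 0] by eventually_elim (use binom_ratio_bound[OF a] in blast)
    show "summable (\<lambda>k. exp (- a / 2) ^ Suc k)"
      using a by (subst summable_Suc_iff) (auto intro: summable_geometric)
  qed
  have R: "R \<longlonglongrightarrow> (\<Sum>j. exp (- (pi\<^sup>2 * (2 * real j + 1)\<^sup>2 / (4 * a))))"
  proof -
    have "(\<lambda>h. \<Sum>j. if j < h then cos (pi * (2 * real j + 1) / (4 * real h)) ^ (2 * ?m h) else 0)
        \<longlonglongrightarrow> (\<Sum>j. exp (- (pi\<^sup>2 * (2 * real j + 1)\<^sup>2 / (4 * a))))"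
    proof (rule tannery_uniform)
      fix j
      have "(\<lambda>h. cos (pi * (2 * real j + 1) / 4 / real h) ^ (2 * ?m h)) \<longlonglongrightarrow> exp (- 4 * (pi * (2 * real j + 1) / 4)\<^sup>2 / a)"
        by (intro cos_power_tendsto a) (auto intro!: mult_pos_pos divide_pos_pos add_nonneg_pos)
      also have "- 4 * (pi * (2 * real j + 1) / 4)\<^sup>2 / a = - (pi\<^sup>2 * (2 * real j + 1)\<^sup>2 / (4 * a))"
        by (simp add: power_mult_distrib power_divide)
      also have "(\<lambda>h. cos (pi * (2 * real j + 1) / 4 / real h) ^ (2 * ?m h)) \<longlonglongrightarrow> exp (- (pi\<^sup>2 * (2 * real j + 1)\<^sup>2 / (4 * a)))
        \<longleftrightarrow> (\<lambda>h. if j < h then cos (pi * (2 * real j + 1) / (4 * real h)) ^ (2 * ?m h) else 0) \<longlonglongrightarrow> exp (- (pi\<^sup>2 * (2 * real j + 1)\<^sup>2 / (4 * a)))"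
        by (rule tendsto_cong) (use eventually_gt_at_top[of j] in eventually_elim, simp)
      finally show "(\<lambda>h. if j < h then cos (pi * (2 * real j + 1) / (4 * real h)) ^ (2 * ?m h) else 0) \<longlonglongrightarrow> exp (- (pi\<^sup>2 * (2 * real j + 1)\<^sup>2 / (4 * a)))" .
    next
      show "\<forall>\<^sub>F h in sequentially. \<forall>j. \<bar>if j < h then cos (pi * (2 * real j + 1) / (4 * real h)) ^ (2 * ?m h) else 0\<bar> \<le> exp (- (1 / (2 * a))) ^ j"
      proof -
        \<comment> \<open>The limit of \<open>m / h^2\<close> is \<open>4 / a\<close>; half of it is
          a lower bound from some \<open>h\<close> on.\<close>
        have "eventually (\<lambda>h. 2 / a < real (?m h) / real h ^ 2) sequentially"
          by (rule order_tendstoD(1)[OF polya_m_ratio[OF a]]) (use a in \<open>simp add: divide_strict_right_mono\<close>)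
        then show ?thesis using eventually_gt_at_top[of 0]
      proof eventually_elim
        case (elim h)
        show ?case
        proof
          fix j
          show "\<bar>if j < h then cos (pi * (2 * real j + 1) / (4 * real h)) ^ (2 * ?m h) else 0\<bar> \<le> exp (- (1 / (2 * a))) ^ j"
          proof (cases "j < h")
            case True
            let ?x = "pi * (2 * real j + 1) / (4 * real h)"
            have jh: "2 * real j + 1 \<le> 2 * real h" using True by linarith
            have "pi * (2 * real j + 1) \<le> pi * (2 * real h)" using jh by (intro mult_left_mono) auto
            then have x: "0 \<le> ?x" "?x \<le> pi / 2" using elim by (auto simp: pos_divide_le_eq)
            have mh: "2 / a \<le> real (?m h) / real h ^ 2" using elim a by (auto intro: less_imp_le)
            have "real (?m h) * (2 * ?x / pi)\<^sup>2 = real (?m h) / real h ^ 2 * ((2 * real j + 1)\<^sup>2 / 4)"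
              using elim by (simp add: power2_eq_square field_simps)
            also have "\<dots> \<ge> 2 / a * ((2 * real j + 1)\<^sup>2 / 4)"
              by (intro mult_right_mono mh) auto
            also have "2 / a * ((2 * real j + 1)\<^sup>2 / 4) = (2 * real j + 1)\<^sup>2 / (2 * a)" by simp
            also have "\<dots> \<ge> real j / (2 * a)"
            proof (intro divide_right_mono)
              have "real j \<le> (2 * real j + 1) * 1" by simp
              also have "\<dots> \<le> (2 * real j + 1)\<^sup>2" unfolding power2_eq_square by (intro mult_left_mono) auto
              finally show "real j \<le> (2 * real j + 1)\<^sup>2" .
            qed (use a in auto)
            finally have "exp (- real (?m h) * (2 * ?x / pi)\<^sup>2) \<le> exp (- (real j / (2 * a)))" by simp
            also have "\<dots> = exp (- (1 / (2 * a))) ^ j" by (simp flip: exp_of_nat_mult)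
            finally have "cos ?x ^ (2 * ?m h) \<le> exp (- (1 / (2 * a))) ^ j"
              using cos_power_le[OF x, of "?m h"] by linarith
            moreover have "0 \<le> cos ?x ^ (2 * ?m h)" by (simp add: power_mult)
            ultimately show ?thesis using True by simp
          qed simp
        qed
      qed
      qed
      show "summable (\<lambda>j. exp (- (1 / (2 * a))) ^ j)" using a by (intro summable_geometric) simp
    qed
    also have "(\<lambda>h. \<Sum>j. if j < h then cos (pi * (2 * real j + 1) / (4 * real h)) ^ (2 * ?m h) else 0) = R"
      unfolding R_def by (rule ext, subst suminf_finite[of "{..<h}" for h]) auto
    finally show ?thesis .
  qed
  have mtop: "filterlim ?m at_top sequentially"
  proof (rule filterlim_at_top_mono)
    show "filterlim (\<lambda>h. nat \<lfloor>4 * real h ^ 2 / a\<rfloor>) at_top sequentially" using a by real_asymp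
  qed (simp add: polya_m_def)
  have cb: "(\<lambda>h. 4 ^ ?m h / real ((2 * ?m h) choose ?m h) / sqrt (real (?m h))) \<longlonglongrightarrow> sqrt pi"
    using filterlim_compose[OF central_binomial_asymp mtop] .
  have sq: "(\<lambda>h. sqrt (real (?m h) / real h ^ 2)) \<longlonglongrightarrow> sqrt (4 / a)"
    by (intro tendsto_real_sqrt polya_m_ratio a)
  \<comment> \<open>The prefactor of Polya's identity splits into a central binomial part with limit
    \<open>sqrt pi\<close> and \<open>sqrt (m / h^2)\<close> with limit
    \<open>sqrt (4 / a)\<close>.\<close>
  have "(\<lambda>h. 4 ^ ?m h / real ((2 * ?m h) choose ?m h) / sqrt (real (?m h)) * sqrt (real (?m h) / real h ^ 2) * R h)
      \<longlonglongrightarrow> sqrt pi * sqrt (4 / a) * (\<Sum>j. exp (- (pi\<^sup>2 * (2 * real j + 1)\<^sup>2 / (4 * a))))"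
    by (intro tendsto_mult cb sq R)
  also have "?this \<longleftrightarrow> (\<lambda>h. 1 + 2 * L h) \<longlonglongrightarrow> sqrt pi * sqrt (4 / a) * (\<Sum>j. exp (- (pi\<^sup>2 * (2 * real j + 1)\<^sup>2 / (4 * a))))"
  proof (rule tendsto_cong)
    show "\<forall>\<^sub>F h in sequentially. 4 ^ ?m h / real ((2 * ?m h) choose ?m h) / sqrt (real (?m h)) * sqrt (real (?m h) / real h ^ 2) * R h = 1 + 2 * L h"
      using eventually_gt_at_top[of 0] eventually_compose_filterlim[OF eventually_gt_at_top[of 0] mtop]
    proof eventually_elim
      case (elim h)
      from polya_identity[OF elim] have "real ((2 * ?m h) choose ?m h) * (1 + 2 * L h) = 4 ^ ?m h / real h * R h"
        unfolding L_def R_def .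
      then have "1 + 2 * L h = 4 ^ ?m h / real h * R h / real ((2 * ?m h) choose ?m h)"
        by (metis nonzero_mult_div_cancel_left of_nat_0_eq_iff binomial_eq_0_iff le_add1 mult_2 not_le)
      then show ?case using elim by (simp add: real_sqrt_divide)
    qed
  qed
  finally have "(\<lambda>h. 1 + 2 * L h) \<longlonglongrightarrow> sqrt pi * sqrt (4 / a) * (\<Sum>j. exp (- (pi\<^sup>2 * (2 * real j + 1)\<^sup>2 / (4 * a))))" .
  moreover have "(\<lambda>h. 1 + 2 * L h) \<longlonglongrightarrow> 1 + 2 * (\<Sum>k. (-1) ^ Suc k * exp (- a * real (Suc k) ^ 2))"
    by (intro tendsto_intros L)
  ultimately have "1 + 2 * (\<Sum>k. (-1) ^ Suc k * exp (- a * real (Suc k) ^ 2))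
      = sqrt pi * sqrt (4 / a) * (\<Sum>j. exp (- (pi\<^sup>2 * (2 * real j + 1)\<^sup>2 / (4 * a))))"
    by (rule LIMSEQ_unique[symmetric])
  also have "sqrt pi * sqrt (4 / a) = 2 * sqrt (pi / a)"
    by (simp add: real_sqrt_divide)
  finally show ?thesis .
qed

section \<open>The theta transformation for complex arguments\<close>

text \<open>Ramanujan's psi. Triangular numbers enter through
  \<open>(2 j + 1)^2 = 8 * triangle j + 1\<close>, which splits \<open>exp (- pi^2 / (4 a))\<close>
  off the Gaussian sum.\<close>

definition psi :: "complex \<Rightarrow> complex" where
  "psi q = (\<Sum>k. q ^ triangle k)"

lemma le_triangle: "k \<le> triangle k"
  by (induction k) auto

lemma summable_psi:
  fixes q :: complex assumes q: "norm q < 1" shows "summable (\<lambda>k. norm (q ^ triangle k))"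
proof (rule summable_comparison_test'[of "\<lambda>k. norm q ^ k"])
  show "summable (\<lambda>k. norm q ^ k)" using q by (simp add: summable_geometric)
  show "norm (norm (q ^ triangle k)) \<le> norm q ^ k" for k
    using q le_triangle[of k] by (simp add: norm_power power_decreasing)
qed

lemma psi_holomorphic: "psi holomorphic_on ball 0 1"
proof (rule power_series_holomorphic)
  fix q :: complex assume "q \<in> ball 0 1"
  then have q: "norm q < 1" by simp
  have mono: "strict_mono triangle" by (rule strict_monoI_Suc) simp
  let ?a = "\<lambda>n. if n \<in> range triangle then 1 else 0 :: complex"
  have "(\<lambda>k. q ^ triangle k) sums psi q"
    unfolding psi_def using summable_psi[OF q] by (intro summable_sums) (rule summable_norm_cancel)
  then have "(\<lambda>k. ?a (triangle k) * q ^ triangle k) sums psi q" by simp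
  then show "(\<lambda>n. ?a n * (q - 0) ^ n) sums psi q"
    by (subst (asm) sums_mono_reindex[OF mono, where f = "\<lambda>n. ?a n * q ^ n"]) auto
qed

lemma norm_psi_minus_1:
  assumes q: "norm q < 1" shows "norm (psi q - 1) \<le> norm q / (1 - norm q)"
proof -
  have s: "summable (\<lambda>k. q ^ triangle k)" using summable_psi[OF q] by (rule summable_norm_cancel)
  have "psi q - 1 = (\<Sum>k. q ^ triangle (Suc k))"
    unfolding psi_def using suminf_split_head[OF s] by simp
  also have "norm \<dots> \<le> (\<Sum>k. norm q ^ Suc k)"
  proof (rule norm_suminf_le)
    show "norm (q ^ triangle (Suc k)) \<le> norm q ^ Suc k" for k
      using q le_triangle[of "Suc k"] unfolding norm_power by (intro power_decreasing) auto
    show "summable (\<lambda>k. norm q ^ Suc k)" using q by (subst summable_Suc_iff) (auto intro: summable_geometric)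
  qed
  also have "\<dots> = norm q / (1 - norm q)"
    using suminf_mult[OF summable_geometric[of "norm q"], of "norm q"] q by (simp add: suminf_geometric)
  finally show ?thesis .
qed

lemma theta_holomorphic: "theta holomorphic_on ball 0 1"
  by (rule power_series_holomorphic[of _ _ theta_coeff]) (use theta_coeff_sums(1) in auto)

lemma norm_exp_lt_1: "Re t > 0 \<Longrightarrow> norm (exp (- t)) < 1"
  by simp

lemma Re_divide_pos: "c > 0 \<Longrightarrow> Re t > 0 \<Longrightarrow> Re (complex_of_real c / t) > 0"
  by (simp add: Re_divide divide_pos_pos sum_power2_gt_zero_iff)

lemma theta_transform_real:
  assumes a: "a > 0"
  shows "theta (exp (- complex_of_real a)) * csqrt (complex_of_real a) =
    2 * of_real (sqrt pi) * exp (- (of_real (pi\<^sup>2) / (4 * complex_of_real a))) * psi (exp (- (of_real (2 * pi\<^sup>2) / complex_of_real a)))"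
proof -
  let ?q = "exp (- complex_of_real a)" and ?p = "exp (- (of_real (2 * pi\<^sup>2) / complex_of_real a))"
  have q: "norm ?q < 1" using a by simp
  have p: "norm ?p < 1" using a by (intro norm_exp_lt_1 Re_divide_pos) auto
  have e1: "(-1) ^ Suc k * ?q ^ ((Suc k)\<^sup>2) = complex_of_real ((-1) ^ Suc k * exp (- a * real (Suc k) ^ 2))" for k
  proof -
    have "?q ^ ((Suc k)\<^sup>2) = complex_of_real (exp (- a) ^ ((Suc k)\<^sup>2))"
      by (simp add: exp_of_real del: of_real_minus flip: of_real_minus)
    also have "exp (- a) ^ ((Suc k)\<^sup>2) = exp (- a * real (Suc k) ^ 2)"
      by (simp flip: exp_of_nat_mult add: mult.commute)
    finally show ?thesis by (simp del: power_Suc add: of_real_power)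
  qed
  have s1: "summable (\<lambda>k. (-1) ^ Suc k * exp (- a * real (Suc k) ^ 2))"
  proof -
    have "summable (\<lambda>k. norm ((-1) ^ Suc k * exp (- a * real (Suc k) ^ 2)))"
      using summable_theta[OF q] unfolding e1 norm_of_real by (simp add: abs_mult)
    then show ?thesis by (rule summable_norm_cancel)
  qed
  have th: "theta ?q = complex_of_real (1 + 2 * (\<Sum>k. (-1) ^ Suc k * exp (- a * real (Suc k) ^ 2)))"
    unfolding theta_def e1 suminf_of_real[OF s1, symmetric] by (simp del: power_Suc)
  define E where "E = exp (- (pi\<^sup>2 / (4 * a)))"
  have e2: "complex_of_real E * ?p ^ triangle j = complex_of_real (exp (- (pi\<^sup>2 * (2 * real j + 1)\<^sup>2 / (4 * a))))" for j
  proof -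
    have tri: "2 * real (triangle j) = real j * (real j + 1)"
    proof -
      have "2 * triangle j = j * Suc j" by (induction j) auto
      then show ?thesis by (metis of_nat_Suc of_nat_mult of_nat_numeral add.commute)
    qed
    have p1: "?p ^ triangle j = complex_of_real (exp (- (2 * pi\<^sup>2 / a)) ^ triangle j)"
      by (simp add: exp_of_real flip: of_real_minus of_real_divide of_real_mult of_real_power)
    have "exp (- (2 * pi\<^sup>2 / a)) ^ triangle j = exp (- (pi\<^sup>2 / a * (2 * real (triangle j))))"
      by (simp flip: exp_of_nat_mult add: mult_ac)
    then have "E * exp (- (2 * pi\<^sup>2 / a)) ^ triangle j = E * exp (- (pi\<^sup>2 / a * (2 * real (triangle j))))" by simp
    also have "\<dots> = exp (- (pi\<^sup>2 * (2 * real j + 1)\<^sup>2 / (4 * a)))"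
      unfolding tri E_def exp_add[symmetric] using a by (simp add: field_simps power2_eq_square)
    finally show ?thesis unfolding p1 of_real_mult[symmetric] by (rule arg_cong)
  qed
  have s2: "summable (\<lambda>j. exp (- (pi\<^sup>2 * (2 * real j + 1)\<^sup>2 / (4 * a))))"
  proof -
    have "summable (\<lambda>j. norm (complex_of_real E * ?p ^ triangle j))"
      unfolding norm_mult by (intro summable_mult summable_psi p)
    then show ?thesis unfolding e2 norm_of_real by simp
  qed
  have ps: "complex_of_real E * psi ?p = complex_of_real (\<Sum>j. exp (- (pi\<^sup>2 * (2 * real j + 1)\<^sup>2 / (4 * a))))"
    unfolding psi_def using suminf_mult[OF summable_norm_cancel[OF summable_psi[OF p]], of "complex_of_real E"]
    unfolding e2 suminf_of_real[OF s2] by (rule sym)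
  have E: "exp (- (of_real (pi\<^sup>2) / (4 * complex_of_real a))) = complex_of_real E"
  proof -
    have "of_real (pi\<^sup>2) / (4 * complex_of_real a) = of_real (pi\<^sup>2 / (4 * a))" by simp
    then show ?thesis unfolding E_def by (metis exp_of_real of_real_minus)
  qed
  have sq: "csqrt (complex_of_real a) = complex_of_real (sqrt a)" using a by (simp add: csqrt_of_real_nonneg)
  have "theta ?q * csqrt (complex_of_real a) = complex_of_real (2 * sqrt (pi / a) * sqrt a * (\<Sum>j. exp (- (pi\<^sup>2 * (2 * real j + 1)\<^sup>2 / (4 * a)))))"
    unfolding th sq real_theta_transform[OF a] by simp
  also have "2 * sqrt (pi / a) * sqrt a = 2 * sqrt pi" using a by (simp add: real_sqrt_divide)
  also have "complex_of_real (2 * sqrt pi * (\<Sum>j. exp (- (pi\<^sup>2 * (2 * real j + 1)\<^sup>2 / (4 * a)))))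
      = 2 * of_real (sqrt pi) * (complex_of_real E * psi ?p)"
    unfolding ps by simp
  finally show ?thesis unfolding E by (simp add: mult.assoc)
qed

theorem theta_transform:
  assumes t: "Re t > 0"
  shows "theta (exp (- t)) * csqrt t =
    2 * of_real (sqrt pi) * exp (- (of_real (pi\<^sup>2) / (4 * t))) * psi (exp (- (of_real (2 * pi\<^sup>2) / t)))"
proof -
  define f where "f t = theta (exp (- t)) * csqrt t -
    2 * of_real (sqrt pi) * exp (- (of_real (pi\<^sup>2) / (4 * t))) * psi (exp (- (of_real (2 * pi\<^sup>2) / t)))" for t
  let ?S = "{t. Re t > 0}" and ?U = "complex_of_real ` {0<..}"
  have hol: "f holomorphic_on ?S"
  proof -
    have 1: "(\<lambda>t. theta (exp (- t))) holomorphic_on ?S"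
      by (rule holomorphic_on_compose_gen[of "\<lambda>t. exp (- t)" _ theta "ball 0 1", unfolded o_def])
        (auto intro!: holomorphic_intros theta_holomorphic)
    have 2: "(\<lambda>t. psi (exp (- (of_real (2 * pi\<^sup>2) / t)))) holomorphic_on ?S"
    proof (rule holomorphic_on_compose_gen[of "\<lambda>t. exp (- (of_real (2 * pi\<^sup>2) / t))" _ psi "ball 0 1", unfolded o_def])
      show "(\<lambda>t. exp (- (of_real (2 * pi\<^sup>2) / t))) ` ?S \<subseteq> ball 0 1"
      proof (rule image_subsetI)
        fix t assume "t \<in> ?S"
        then have "norm (exp (- (complex_of_real (2 * pi\<^sup>2) / t))) < 1"
          by (intro norm_exp_lt_1 Re_divide_pos) auto
        then show "exp (- (complex_of_real (2 * pi\<^sup>2) / t)) \<in> ball 0 1" by simp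
      qed
    qed (auto intro!: holomorphic_intros psi_holomorphic)
    have 3: "csqrt holomorphic_on ?S"
      by (rule holomorphic_on_csqrt[THEN holomorphic_on_subset]) (auto elim!: nonpos_Reals_cases)
    show ?thesis unfolding f_def by (intro holomorphic_intros 1 2 3) auto
  qed
  have lim: "(1 :: complex) islimpt ?U"
    unfolding islimpt_approachable
  proof (intro allI impI)
    fix e :: real assume "e > 0"
    then have "complex_of_real (1 + e / 2) \<in> ?U" by (intro imageI) simp
    moreover have "complex_of_real (1 + e / 2) \<noteq> 1" "dist (complex_of_real (1 + e / 2)) 1 < e"
      using \<open>e > 0\<close> by (simp_all add: dist_norm)
    ultimately show "\<exists>x'\<in>?U. x' \<noteq> 1 \<and> dist x' 1 < e" by blast
  qed
  have "f t = 0"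
  proof (rule analytic_continuation[OF hol _ _ _ _ lim])
    show "open ?S" by (rule open_halfspace_Re_gt)
    show "connected ?S" by (intro convex_connected convex_halfspace_Re_gt)
    show "f z = 0" if "z \<in> ?U" for z using that theta_transform_real by (auto simp: f_def)
  qed (use t in auto)
  then show ?thesis by (simp add: f_def)
qed

section \<open>Bounds on the minor and the major arc\<close>

text \<open>The logarithm of \<open>(1 + w) / (1 - w)\<close> is \<open>2 w\<close> plus a power
  series with nonnegative coefficients. The real part of that series is largest at
  \<open>norm w\<close>, so what is gained is the deficit \<open>Re w - norm w\<close> of the linear
  term.\<close>

lemma cayley_norm_le:
  fixes w :: complex assumes w: "norm w < 1"
  shows "norm ((1 + w) / (1 - w)) \<le> (1 + norm w) / (1 - norm w) * exp (2 * Re w - 2 * norm w)"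
proof -
  define c where "c n = (if odd n \<and> n \<noteq> 1 then 2 / real n else 0)" for n
  define S where "S z = ln (1 + z) - ln (1 - z) - 2 * z" for z :: complex
  have S: "(\<lambda>n. of_real (c n) * z ^ n) sums S z" if z: "norm z < 1" for z
  proof -
    have "(\<lambda>n. - ((-z)^n) / of_nat n - - ((-(-z))^n) / of_nat n) sums (ln (1 + z) - ln (1 + (-z)))"
      by (intro sums_diff Ln_series') (use z in auto)
    from sums_diff[OF this sums_single[of 1 "\<lambda>_. 2 * z"]]
    have "(\<lambda>n. - ((-z)^n) / of_nat n - - ((-(-z))^n) / of_nat n - (if n = 1 then 2 * z else 0)) sums S z"
      by (simp add: S_def)
    also have "(\<lambda>n. - ((-z)^n) / of_nat n - - ((-(-z))^n) / of_nat n - (if n = 1 then 2 * z else 0))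
       = (\<lambda>n. of_real (c n) * z ^ n)"
      by (rule ext) (auto simp: c_def)
    finally show ?thesis .
  qed
  have norm_eq: "norm ((1 + z) / (1 - z)) = exp (Re (S z) + 2 * Re z)" if z: "norm z < 1" for z
  proof -
    have "1 + z \<noteq> 0" "1 - z \<noteq> 0" using one_plus_power_nz[OF z, of 1] by auto
    then have "exp (S z + 2 * z) = (1 + z) / (1 - z)" by (simp add: S_def exp_diff)
    then show ?thesis by (metis Re_complex_of_real norm_exp_eq_Re plus_complex.simps(1) mult_2)
  qed
  let ?r = "complex_of_real (norm w)"
  have r: "norm ?r < 1" using w by simp
  have "Re (S w) \<le> Re (S ?r)"
  proof (rule sums_le[OF _ sums_Re[OF S[OF w]] sums_Re[OF S[OF r]]])
    fix n
    have "Re (of_real (c n) * w ^ n) = c n * Re (w ^ n)" by simp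
    also have "\<dots> \<le> c n * norm (w ^ n)"
      by (intro mult_left_mono complex_Re_le_cmod) (simp add: c_def)
    also have "\<dots> = Re (of_real (c n) * ?r ^ n)"
      by (simp add: norm_power flip: of_real_power of_real_mult)
    finally show "Re (of_real (c n) * w ^ n) \<le> Re (of_real (c n) * ?r ^ n)" .
  qed
  then have "norm ((1 + w) / (1 - w)) \<le> exp (Re (S ?r) + 2 * Re ?r + (2 * Re w - 2 * norm w))"
    unfolding norm_eq[OF w] by simp
  also have "\<dots> = norm ((1 + ?r) / (1 - ?r)) * exp (2 * Re w - 2 * norm w)"
    unfolding exp_add norm_eq[OF r] ..
  also have "(1 + ?r) / (1 - ?r) = of_real ((1 + norm w) / (1 - norm w))" by simp
  also have "norm \<dots> = (1 + norm w) / (1 - norm w)" unfolding norm_of_real using w by simp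
  finally show ?thesis .
qed

text \<open>The linear gains of the factors with \<open>q ^ k\<close> add up to geometric
  series.\<close>

lemma inverse_theta_le:
  assumes q: "norm q < 1"
  shows "norm (1 / theta q) \<le> norm (1 / theta (of_real (norm q)))
    * exp (2 * Re (q / (1 - q)) - 2 * (norm q / (1 - norm q)))"
proof -
  let ?r = "norm q"
  have r: "norm (complex_of_real ?r) < 1" using q by simp
  have fin: "norm (1 / gauss_prod N q) \<le> norm (1 / gauss_prod N (of_real ?r))
      * exp (2 * Re (\<Sum>k<N. q ^ Suc k) - 2 * (\<Sum>k<N. ?r ^ Suc k))" for N
  proof -
    have inv: "1 / gauss_prod N z = (\<Prod>k=1..N. (1 + z ^ k) / (1 - z ^ k))" for z
      by (simp add: gauss_prod_def prod_dividef)
    have "norm (1 / gauss_prod N q) = (\<Prod>k=1..N. norm ((1 + q ^ k) / (1 - q ^ k)))"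
      unfolding inv by (simp flip: prod_norm)
    also have "\<dots> \<le> (\<Prod>k=1..N. (1 + norm (q ^ k)) / (1 - norm (q ^ k)) * exp (2 * Re (q ^ k) - 2 * norm (q ^ k)))"
      using q by (intro prod_mono conjI cayley_norm_le) (auto simp: norm_power power_less_one_iff)
    also have "\<dots> = (\<Prod>k=1..N. (1 + norm (q ^ k)) / (1 - norm (q ^ k))) * exp (\<Sum>k=1..N. 2 * Re (q ^ k) - 2 * norm (q ^ k))"
      by (simp only: prod.distrib exp_sum finite_atLeastAtMost)
    also have "(\<Prod>k=1..N. (1 + norm (q ^ k)) / (1 - norm (q ^ k))) = norm (1 / gauss_prod N (of_real ?r))"
    proof -
      have "1 / gauss_prod N (of_real ?r) = of_real (\<Prod>k=1..N. (1 + ?r ^ k) / (1 - ?r ^ k))"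
        unfolding inv by simp
      moreover have "(\<Prod>k=1..N. (1 + ?r ^ k) / (1 - ?r ^ k)) \<ge> 0"
        using q by (intro prod_nonneg ballI divide_nonneg_nonneg) (auto simp: power_le_one less_imp_le)
      ultimately show ?thesis by (simp only: norm_of_real abs_of_nonneg norm_power)
    qed
    also have "(\<Sum>k=1..N. 2 * Re (q ^ k) - 2 * norm (q ^ k)) = 2 * Re (\<Sum>k<N. q ^ Suc k) - 2 * (\<Sum>k<N. ?r ^ Suc k)"
      by (simp add: sum.atLeast1_atMost_eq sum_subtractf sum_distrib_left norm_power norm_mult Re_sum)
    finally show ?thesis .
  qed
  have geo: "(\<lambda>N. \<Sum>k<N. z ^ Suc k) \<longlonglongrightarrow> z / (1 - z)" if "norm z < 1" for z :: "'a::{real_normed_field,banach}"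
    using sums_mult[OF geometric_sums[OF that], of z] by (simp add: sums_def)
  have nr: "norm ?r < 1" using q by simp
  show ?thesis
  proof (rule LIMSEQ_le)
    show "(\<lambda>N. norm (1 / gauss_prod N q)) \<longlonglongrightarrow> norm (1 / theta q)"
      by (intro tendsto_intros gauss_prod_tendsto_theta theta_nz q)
    show "(\<lambda>N. norm (1 / gauss_prod N (of_real ?r)) * exp (2 * Re (\<Sum>k<N. q ^ Suc k) - 2 * (\<Sum>k<N. ?r ^ Suc k)))
      \<longlonglongrightarrow> norm (1 / theta (of_real (norm q))) * exp (2 * Re (q / (1 - q)) - 2 * (norm q / (1 - norm q)))"
      by (intro tendsto_intros gauss_prod_tendsto_theta theta_nz r geo[OF q] geo[OF nr])
  qed (use fin in blast)
qed

text \<open>The squared norm is \<open>(1 - r)^2 + 4 r sin^2 (y / 2)\<close> with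
  \<open>r = exp (- Re t)\<close> and \<open>y = Im t\<close>. Use
  \<open>1 - r \<ge> r * Re t\<close> and Jordan's inequality, for which
  \<open>\<bar>Im t\<bar> \<le> pi\<close> is assumed.\<close>

lemma norm_one_minus_exp_ge:
  assumes "Re t > 0" "\<bar>Im t\<bar> \<le> pi"
  shows "2 * exp (- Re t) / pi * norm t \<le> norm (1 - exp (- t))"
proof (rule power2_le_imp_le)
  let ?x = "Re t" and ?y = "Im t" and ?r = "exp (- Re t)"
  have "(norm (1 - exp (- t)))\<^sup>2 = (1 - ?r * cos ?y)\<^sup>2 + (?r * sin ?y)\<^sup>2"
    by (simp add: cmod_power2 Re_exp Im_exp)
  also have "\<dots> = (1 - ?r)\<^sup>2 + 4 * ?r * (sin (?y / 2))\<^sup>2"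
  proof -
    have c: "cos ?y = 1 - 2 * (sin (?y / 2))\<^sup>2" using cos_double_sin[of "?y / 2"] by simp
    have "(1 - ?r * cos ?y)\<^sup>2 + (?r * sin ?y)\<^sup>2 = 1 - 2 * ?r * cos ?y + ?r\<^sup>2 * ((sin ?y)\<^sup>2 + (cos ?y)\<^sup>2)"
      by (simp add: power2_eq_square algebra_simps del: sin_cos_squared_add sin_cos_squared_add3)
    also have "\<dots> = 1 - 2 * ?r * cos ?y + ?r\<^sup>2" by simp
    also have "\<dots> = (1 - ?r)\<^sup>2 + 4 * ?r * (sin (?y / 2))\<^sup>2"
      unfolding c by (simp add: power2_eq_square algebra_simps)
    finally show ?thesis .
  qed
  also have "\<dots> \<ge> ?r\<^sup>2 * ?x\<^sup>2 + 4 * ?r\<^sup>2 * (?y / pi)\<^sup>2"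
  proof (rule add_mono)
    have "?r * (1 + ?x) \<le> ?r * exp ?x" by (intro mult_left_mono exp_ge_add_one_self) auto
    then have "?r * ?x \<le> 1 - ?r" by (simp add: algebra_simps flip: exp_add)
    then have "(?r * ?x)\<^sup>2 \<le> (1 - ?r)\<^sup>2" using assms by (intro power_mono) auto
    then show "?r\<^sup>2 * ?x\<^sup>2 \<le> (1 - ?r)\<^sup>2" by (simp add: power_mult_distrib)
    have "2 * (\<bar>?y\<bar> / 2) / pi \<le> sin (\<bar>?y\<bar> / 2)" using assms by (intro jordan_sin) auto
    then have "(\<bar>?y\<bar> / pi)\<^sup>2 \<le> (sin (\<bar>?y\<bar> / 2))\<^sup>2" by (intro power_mono) auto
    also have "(sin (\<bar>?y\<bar> / 2))\<^sup>2 = (sin (?y / 2))\<^sup>2" by (simp add: abs_if)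
    finally have y: "(?y / pi)\<^sup>2 \<le> (sin (?y / 2))\<^sup>2" by (simp add: power_divide)
    have "?r\<^sup>2 \<le> ?r" using assms by (simp add: power2_eq_square mult_le_one)
    then show "4 * ?r\<^sup>2 * (?y / pi)\<^sup>2 \<le> 4 * ?r * (sin (?y / 2))\<^sup>2"
      using y by (intro mult_mono) auto
  qed
  finally have "?r\<^sup>2 * ?x\<^sup>2 + 4 * ?r\<^sup>2 * (?y / pi)\<^sup>2 \<le> (norm (1 - exp (- t)))\<^sup>2" .
  moreover have "(2 * ?r / pi * norm t)\<^sup>2 = (2 / pi)\<^sup>2 * (?r\<^sup>2 * ?x\<^sup>2) + 4 * ?r\<^sup>2 * (?y / pi)\<^sup>2"
    by (simp add: power_mult_distrib power_divide cmod_power2 distrib_left add_divide_distrib)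
  moreover have "(2 / pi)\<^sup>2 * (?r\<^sup>2 * ?x\<^sup>2) \<le> 1 * (?r\<^sup>2 * ?x\<^sup>2)"
    using pi_ge_two by (intro mult_right_mono) (auto simp: power_le_one)
  ultimately show "(2 * ?r / pi * norm t)\<^sup>2 \<le> (norm (1 - exp (- t)))\<^sup>2" by linarith
qed auto

text \<open>On the positive axis \<open>psi\<close> is at least its first term 1, so the
  transformation bounds \<open>theta\<close> from below.\<close>

lemma inverse_theta_real_le:
  assumes x: "x > 0"
  shows "norm (1 / theta (of_real (exp (- x)))) \<le> sqrt (x / pi) / 2 * exp (pi\<^sup>2 / (4 * x))"
proof -
  let ?p = "exp (- (2 * pi\<^sup>2 / x))" and ?e = "exp (- (pi\<^sup>2 / (4 * x)))"
  have p: "0 \<le> ?p" "?p < 1" using x by auto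
  have s: "summable (\<lambda>k. ?p ^ triangle k)"
    using summable_psi[of "of_real ?p"] p by (simp add: norm_power)
  have psi: "psi (of_real ?p) = of_real (\<Sum>k. ?p ^ triangle k)"
    unfolding psi_def using suminf_of_real[OF s, where ?'a = complex] by simp
  have "(\<Sum>k\<in>{0}. ?p ^ triangle k) \<le> (\<Sum>k. ?p ^ triangle k)"
    using p by (intro sum_le_suminf s) auto
  then have ge1: "1 \<le> (\<Sum>k. ?p ^ triangle k)" by simp
  have cexp: "exp (- complex_of_real v) = of_real (exp (- v))" for v :: real
    by (metis exp_of_real of_real_minus)
  have e2: "exp (- (of_real (2 * pi\<^sup>2) / complex_of_real x)) = of_real ?p"
    using cexp[of "2 * pi\<^sup>2 / x"] by simp
  have e3: "exp (- (of_real (pi\<^sup>2) / (4 * complex_of_real x))) = of_real ?e"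
    using cexp[of "pi\<^sup>2 / (4 * x)"] by simp
  have "theta (of_real (exp (- x))) * csqrt (of_real x) = 2 * of_real (sqrt pi) * of_real ?e * psi (of_real ?p)"
    using theta_transform[of "of_real x"] x unfolding cexp e2 e3 by simp
  from arg_cong[OF this, of norm]
  have "norm (theta (of_real (exp (- x)))) * sqrt x = 2 * sqrt pi * ?e * norm (psi (of_real ?p))"
    using x by (simp add: norm_mult del: csqrt_of_real csqrt_of_real_nonneg)
  also have "norm (psi (of_real ?p)) = (\<Sum>k. ?p ^ triangle k)" unfolding psi norm_of_real using ge1 by simp
  finally have "norm (theta (of_real (exp (- x)))) * sqrt x \<ge> 2 * sqrt pi * ?e"
    using ge1 by (simp add: mult_left_mono[of 1 _ "2 * sqrt pi * ?e", simplified])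
  then have "norm (theta (of_real (exp (- x)))) \<ge> 2 * sqrt pi * ?e / sqrt x"
    using x by (simp add: pos_divide_le_eq)
  moreover have "2 * sqrt pi * ?e / sqrt x > 0" using x by simp
  ultimately have "1 / norm (theta (of_real (exp (- x)))) \<le> 1 / (2 * sqrt pi * ?e / sqrt x)"
    by (intro divide_left_mono mult_pos_pos) auto
  also have "\<dots> = sqrt (x / pi) / 2 * exp (pi\<^sup>2 / (4 * x))"
    by (simp add: exp_minus real_sqrt_divide field_simps)
  finally show ?thesis by (simp add: norm_divide)
qed

text \<open>The gain is \<open>2 / Re t\<close>, lost in part to \<open>pi / norm t\<close>: it is
  effective once \<open>norm t\<close> is large compared with \<open>Re t\<close>. The summand 2
  pays for using \<open>r / (1 - r) \<ge> 1 / Re t - 1\<close> with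
  \<open>r = exp (- Re t)\<close>.\<close>

theorem minor_arc_bound:
  assumes t: "Re t > 0" "\<bar>Im t\<bar> \<le> pi"
  shows "norm (1 / theta (exp (- t)))
    \<le> sqrt (Re t / pi) / 2 * exp (pi\<^sup>2 / (4 * Re t) + pi / norm t - 2 / Re t + 2)"
proof -
  let ?x = "Re t" and ?q = "exp (- t)"
  let ?r = "exp (- Re t)"
  have q: "norm ?q = ?r" by simp
  have lt: "norm ?q < 1" using t by simp
  have t0: "norm t > 0" using t by auto
  have "1 - ?r \<le> ?x" using exp_ge_add_one_self[of "- ?x"] by simp
  then have "1 / ?x \<le> 1 / (1 - ?r)" using t by (intro divide_left_mono) auto
  also have "\<dots> = ?r / (1 - ?r) + 1" using t by (simp add: field_simps)
  finally have r: "?r / (1 - ?r) \<ge> 1 / ?x - 1" by simp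
  have "Re (?q / (1 - ?q)) \<le> norm (?q / (1 - ?q))" by (rule complex_Re_le_cmod)
  also have "\<dots> = ?r / norm (1 - ?q)" by (simp add: norm_divide)
  also have "\<dots> \<le> ?r / (2 * ?r / pi * norm t)"
  proof -
    have pos: "0 < 2 * ?r / pi * norm t" using t0 by simp
    then have "0 < norm (1 - ?q)" using norm_one_minus_exp_ge[OF t] by linarith
    then show ?thesis using norm_one_minus_exp_ge[OF t] pos by (intro divide_left_mono mult_pos_pos) auto
  qed
  also have "\<dots> = pi / norm t / 2" using t0 by (simp add: field_simps)
  finally have "2 * Re (?q / (1 - ?q)) \<le> pi / norm t" by simp
  with r have le: "2 * Re (?q / (1 - ?q)) - 2 * (norm ?q / (1 - norm ?q)) \<le> pi / norm t - 2 / ?x + 2"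
    unfolding q by simp
  have "norm (1 / theta ?q) \<le> norm (1 / theta (of_real ?r)) * exp (2 * Re (?q / (1 - ?q)) - 2 * (norm ?q / (1 - norm ?q)))"
    using inverse_theta_le[OF lt] unfolding q .
  also have "\<dots> \<le> (sqrt (?x / pi) / 2 * exp (pi\<^sup>2 / (4 * ?x))) * exp (pi / norm t - 2 / ?x + 2)"
    using t le by (intro mult_mono inverse_theta_real_le) auto
  also have "\<dots> = sqrt (?x / pi) / 2 * exp (pi\<^sup>2 / (4 * ?x) + pi / norm t - 2 / ?x + 2)"
    by (simp add: mult.assoc algebra_simps flip: exp_add)
  finally show ?thesis .
qed

lemma sums_even_odd:
  fixes a :: "nat \<Rightarrow> 'a::real_normed_vector"
  assumes "(\<lambda>j. a (2 * j)) sums A" "(\<lambda>j. a (2 * j + 1)) sums B"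
  shows "a sums (A + B)"
proof -
  let ?e = "\<lambda>n. if even n then a n else 0" and ?o = "\<lambda>n. if even n then 0 else a n"
  have "strict_mono (\<lambda>j::nat. 2 * j)" "strict_mono (\<lambda>j::nat. 2 * j + 1)"
    by (auto intro: strict_monoI)
  then have "?e sums A" "?o sums B"
    using sums_mono_reindex[of "\<lambda>j. 2 * j" ?e A] sums_mono_reindex[of "\<lambda>j. 2 * j + 1" ?o B] assms
    by (fastforce elim: evenE oddE)+
  from sums_add[OF this] have "(\<lambda>n. ?e n + ?o n) sums (A + B)" .
  also have "(\<lambda>n. ?e n + ?o n) = a" by auto
  finally show ?thesis .
qed

section \<open>Major arc: splitting off the complementary error function\<close>

definition gauss_moment :: "nat \<Rightarrow> real" where
  "gauss_moment k = (if even k then sqrt pi / 2 * (fact k / (2 ^ k * fact (k div 2))) else fact (k div 2) / 2)"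

lemma gauss_moment:
  "has_bochner_integral lborel (\<lambda>x. indicator {0..} x * (exp (- x\<^sup>2) * x ^ k)) (gauss_moment k)"
proof (cases "even k")
  case True
  then obtain j where "k = 2 * j" by blast
  then show ?thesis using gaussian_moment_even_pos[of j] by (simp add: gauss_moment_def)
next
  case False
  then obtain j where "k = 2 * j + 1" by (rule oddE)
  then show ?thesis using gaussian_moment_odd_pos[of j] by (simp add: gauss_moment_def)
qed

text \<open>\<open>w * odd_erf_sum (w^2)\<close> is \<open>exp (w^2)\<close> times the integral of
  \<open>exp (- s^2)\<close> from 0 to \<open>w\<close>. Up to the factor \<open>w\<close>, the
  error function part is thus entire in \<open>w^2\<close>, which removes the square root of
  \<open>t\<close>.\<close>

definition odd_erf_sum :: "complex \<Rightarrow> complex" where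
  "odd_erf_sum x = (\<Sum>j. fact j / fact (2 * j + 1) * (4 * x) ^ j)"

lemma fact_odd_ge: "4 ^ j * fact j * fact j \<le> (fact (2 * j + 1) :: real)"
proof (induction j)
  case (Suc j)
  have "4 ^ Suc j * fact (Suc j) * fact (Suc j) = (4 * (real j + 1)\<^sup>2) * (4 ^ j * fact j * fact j :: real)"
    by (simp add: power2_eq_square algebra_simps)
  also have "\<dots> \<le> ((2 * real j + 3) * (2 * real j + 2)) * fact (2 * j + 1)"
  proof (rule mult_mono[OF _ Suc])
    show "4 * (real j + 1)\<^sup>2 \<le> (2 * real j + 3) * (2 * real j + 2)"
      by (simp add: power2_eq_square algebra_simps)
  qed auto
  also have "\<dots> = fact (2 * Suc j + 1)" by (simp add: algebra_simps)
  finally show ?case .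
qed simp

lemma odd_erf_term_le: "norm (fact j / fact (2 * j + 1) * (4 * x) ^ j :: complex) \<le> norm x ^ j / fact j"
proof -
  have "fact j / fact (2 * j + 1) * 4 ^ j \<le> (1 / fact j :: real)"
    using fact_odd_ge[of j] by (simp add: field_simps del: fact_Suc)
  then have "(fact j / fact (2 * j + 1) * 4 ^ j) * norm x ^ j \<le> (1 / fact j) * norm x ^ j"
    by (intro mult_right_mono) auto
  then show ?thesis by (simp add: norm_mult norm_divide norm_power power_mult_distrib mult_ac del: fact_Suc)
qed

lemma exp_series_real: "(\<lambda>j. x ^ j / fact j) sums exp (x :: real)"
  using exp_converges[of x] by (simp add: field_simps scaleR_conv_of_real)

lemma summable_odd_erf: "summable (\<lambda>j. norm (fact j / fact (2 * j + 1) * (4 * x) ^ j :: complex))"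
  by (rule summable_comparison_test'[OF sums_summable[OF exp_series_real[of "norm x"]]])
    (use odd_erf_term_le in simp)

text \<open>This series arises when \<open>exp (- x^2 - 2 w x)\<close> is integrated termwise over
  \<open>x \<ge> 0\<close>: even moments sum to \<open>exp (w^2)\<close>, odd ones to the error
  function part.\<close>

lemma gauss_moment_series:
  fixes w :: complex
  shows "(\<lambda>k. (-2 * w) ^ k / fact k * of_real (gauss_moment k)) sums
    (of_real (sqrt pi / 2) * exp (w\<^sup>2) - w * odd_erf_sum (w\<^sup>2))" (is "?a sums _")
proof -
  have ev: "?a (2 * j) = of_real (sqrt pi / 2) * ((w\<^sup>2) ^ j /\<^sub>R fact j)" for j
  proof -
    have "(-2 * w) ^ (2 * j) = 4 ^ j * (w\<^sup>2) ^ j" unfolding power_mult by (simp add: power_mult_distrib)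
    moreover have "(2 :: complex) ^ (2 * j) = 4 ^ j" unfolding power_mult by simp
    ultimately show ?thesis by (simp add: gauss_moment_def scaleR_conv_of_real field_simps)
  qed
  have od: "?a (2 * j + 1) = (- w) * (fact j / fact (2 * j + 1) * (4 * w\<^sup>2) ^ j)" for j
  proof -
    have "(-2 * w) ^ (2 * j + 1) = -2 * w * (4 * w\<^sup>2) ^ j" unfolding power_add power_mult by (simp add: power_mult_distrib)
    then show ?thesis by (simp add: gauss_moment_def del: fact_Suc)
  qed
  have "?a sums (of_real (sqrt pi / 2) * exp (w\<^sup>2) + (- w) * odd_erf_sum (w\<^sup>2))"
  proof (rule sums_even_odd)
    show "(\<lambda>j. ?a (2 * j)) sums (of_real (sqrt pi / 2) * exp (w\<^sup>2))"
      unfolding ev by (intro sums_mult exp_converges)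
    show "(\<lambda>j. ?a (2 * j + 1)) sums ((- w) * odd_erf_sum (w\<^sup>2))"
      unfolding od odd_erf_sum_def using summable_odd_erf[of "w\<^sup>2"]
      by (intro sums_mult summable_sums) (rule summable_norm_cancel)
  qed
  then show ?thesis by simp
qed

lemma gauss_moment_nonneg: "gauss_moment k \<ge> 0"
  by (simp add: gauss_moment_def)

text \<open>The expression equals the integral of \<open>exp (- x^2 - 2 w x)\<close> over
  \<open>x \<ge> 0\<close>, a scaled \<open>erfc\<close>. For \<open>Re w \<ge> 0\<close> the
  integrand is dominated by \<open>exp (- x^2)\<close>. The series of absolute values justifies
  interchanging sum and integral.\<close>

lemma norm_erfc_le:
  fixes w :: complex assumes w: "Re w \<ge> 0"
  shows "norm (of_real (sqrt pi / 2) * exp (w\<^sup>2) - w * odd_erf_sum (w\<^sup>2)) \<le> sqrt pi / 2"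
proof -
  define f :: "nat \<Rightarrow> real \<Rightarrow> complex" where
    "f k x = of_real (indicator {0..} x * (exp (- x\<^sup>2) * x ^ k)) * ((-2 * w) ^ k / fact k)" for k x
  have hi: "has_bochner_integral lborel (f k) (of_real (gauss_moment k) * ((-2 * w) ^ k / fact k))" for k
    unfolding f_def by (intro has_bochner_integral_mult_left has_bochner_integral_of_real gauss_moment)
  have nf: "norm (f k x) = indicator {0..} x * (exp (- x\<^sup>2) * x ^ k) * ((2 * norm w) ^ k / fact k)" for k x
    by (auto simp: f_def norm_mult norm_divide norm_power indicator_def)
  have hn: "has_bochner_integral lborel (\<lambda>x. norm (f k x)) (gauss_moment k * ((2 * norm w) ^ k / fact k))" for k
    unfolding nf by (intro has_bochner_integral_mult_left gauss_moment)
  have sf: "(\<lambda>k. f k x) sums (of_real (indicator {0..} x * exp (- x\<^sup>2)) * exp (-2 * w * of_real x))" for x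
  proof -
    have "(\<lambda>k. of_real (indicator {0..} x * exp (- x\<^sup>2)) * ((-2 * w * of_real x) ^ k /\<^sub>R fact k))
      sums (of_real (indicator {0..} x * exp (- x\<^sup>2)) * exp (-2 * w * of_real x))"
      by (intro sums_mult exp_converges)
    also have "(\<lambda>k. of_real (indicator {0..} x * exp (- x\<^sup>2)) * ((-2 * w * of_real x) ^ k /\<^sub>R fact k)) = (\<lambda>k. f k x)"
      by (rule ext) (simp only: f_def scaleR_conv_of_real of_real_mult of_real_power power_mult_distrib divide_inverse of_real_inverse of_real_fact mult_ac)
    finally show ?thesis .
  qed
  have sn: "summable (\<lambda>k. norm (f k x))" for x
  proof -
    have "summable (\<lambda>k. (2 * norm w * \<bar>x\<bar>) ^ k / fact k)" using exp_series_real by (rule sums_summable)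
    then have "summable (\<lambda>k. indicator {0..} x * exp (- x\<^sup>2) * ((2 * norm w * \<bar>x\<bar>) ^ k / fact k))" by (rule summable_mult)
    also have "(\<lambda>k. indicator {0..} x * exp (- x\<^sup>2) * ((2 * norm w * \<bar>x\<bar>) ^ k / fact k)) = (\<lambda>k. norm (f k x))"
      unfolding nf by (rule ext) (auto simp: indicator_def power_mult_distrib)
    finally show ?thesis .
  qed
  have "(\<lambda>k. gauss_moment k * ((2 * norm w) ^ k / fact k)) = (\<lambda>k. norm ((-2 * (w :: complex)) ^ k / fact k * of_real (gauss_moment k)))"
    by (rule ext) (simp add: norm_mult norm_divide norm_power gauss_moment_nonneg)
  moreover have "summable (\<lambda>k. gauss_moment k * ((2 * norm w) ^ k / fact k))"
  proof -
    let ?b = "\<lambda>k. gauss_moment k * ((2 * norm w) ^ k / fact k)"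
    have ev: "?b (2 * j) = sqrt pi / 2 * ((norm w ^ 2) ^ j / fact j)" for j
    proof -
      have "(2 * norm w) ^ (2 * j) = 4 ^ j * (norm w ^ 2) ^ j" unfolding power_mult by (simp add: power_mult_distrib)
      moreover have "(2 :: real) ^ (2 * j) = 4 ^ j" unfolding power_mult by simp
      ultimately show ?thesis by (simp add: gauss_moment_def)
    qed
    have od: "?b (2 * j + 1) = norm w * norm (fact j / fact (2 * j + 1) * (4 * w\<^sup>2) ^ j :: complex)" for j
    proof -
      have "(2 * norm w) ^ (2 * j + 1) = 2 * norm w * (4 * norm w ^ 2) ^ j" unfolding power_add power_mult by (simp add: power_mult_distrib)
      then show ?thesis by (simp add: gauss_moment_def norm_mult norm_divide norm_power del: fact_Suc)
    qed
    have "(\<lambda>j. ?b (2 * j)) sums (sqrt pi / 2 * exp (norm w ^ 2))"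
      unfolding ev by (intro sums_mult exp_series_real)
    moreover have "(\<lambda>j. ?b (2 * j + 1)) sums (norm w * (\<Sum>j. norm (fact j / fact (2 * j + 1) * (4 * w\<^sup>2) ^ j :: complex)))"
      unfolding od by (intro sums_mult summable_sums summable_odd_erf)
    ultimately show ?thesis by (blast intro: sums_summable sums_even_odd)
  qed
  ultimately have sm: "summable (\<lambda>k. gauss_moment k * ((2 * norm w) ^ k / fact k))" by simp
  have sI: "summable (\<lambda>k. \<integral>x. norm (f k x) \<partial>lborel)"
    unfolding has_bochner_integral_integral_eq[OF hn] by (rule sm)
  have fi: "integrable lborel (f k)" for k using hi by (rule integrable.intros)
  have "(\<lambda>k. \<integral>x. f k x \<partial>lborel) sums (\<integral>x. (\<Sum>k. f k x) \<partial>lborel)"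
    by (rule sums_integral[OF fi _ sI]) (use sn in auto)
  then have "(\<lambda>k. (-2 * w) ^ k / fact k * of_real (gauss_moment k)) sums (\<integral>x. (\<Sum>k. f k x) \<partial>lborel)"
    unfolding has_bochner_integral_integral_eq[OF hi] by (simp only: mult.commute)
  then have eq: "of_real (sqrt pi / 2) * exp (w\<^sup>2) - w * odd_erf_sum (w\<^sup>2) = (\<integral>x. (\<Sum>k. f k x) \<partial>lborel)"
    using gauss_moment_series sums_unique2 by blast
  have "norm (\<integral>x. (\<Sum>k. f k x) \<partial>lborel) \<le> (\<integral>x. indicator {0..} x * (exp (- x\<^sup>2) * x ^ 0) \<partial>lborel)"
  proof (rule Bochner_Integration.integral_norm_bound_integral)
    show "integrable lborel (\<lambda>x. \<Sum>k. f k x)"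
      by (rule integrable_suminf[OF fi _ sI]) (use sn in auto)
    show "integrable lborel (\<lambda>x::real. indicator {0..} x * (exp (- x\<^sup>2) * x ^ 0) :: real)"
      using gauss_moment[of 0] by (rule integrable.intros)
    fix x :: real
    have "norm (\<Sum>k. f k x) = indicator {0..} x * exp (- x\<^sup>2) * exp (- (2 * Re w * x))"
      unfolding sums_unique[OF sf[of x], symmetric] by (simp add: norm_mult)
    also have "\<dots> \<le> indicator {0..} x * exp (- x\<^sup>2) * 1"
    proof (cases "x \<ge> 0")
      case True
      then show ?thesis using w by (intro mult_left_mono) auto
    qed simp
    finally show "norm (\<Sum>k. f k x) \<le> indicator {0..} x * (exp (- x\<^sup>2) * x ^ 0)" by simp
  qed
  also have "\<dots> = gauss_moment 0" using gauss_moment[of 0] by (rule has_bochner_integral_integral_eq)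
  also have "\<dots> = sqrt pi / 2" by (simp add: gauss_moment_def)
  finally show ?thesis unfolding eq .
qed

text \<open>What the transformation gives for \<open>1 / theta (exp (- t))\<close> when
  \<open>psi\<close> is replaced by 1.\<close>

definition theta_main :: "complex \<Rightarrow> complex" where
  "theta_main t = csqrt t / (2 * of_real (sqrt pi)) * exp (of_real (pi\<^sup>2) / (4 * t))"

text \<open>The error function part of \<open>theta_main\<close> without its constant
  \<open>1 / 2\<close>, so that only negative powers of \<open>t\<close> occur; see
  \<open>theta_laurent_eq\<close>.\<close>

definition theta_laurent :: "complex \<Rightarrow> complex" where
  "theta_laurent t = (\<Sum>j. of_real (fact (Suc j) / (2 * fact (2 * j + 3))) * (of_real (pi\<^sup>2) / t) ^ Suc j)"

lemma theta_laurent_term: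
  "of_real (fact (Suc j) / (2 * fact (2 * j + 3))) * (of_real (pi\<^sup>2) / t) ^ Suc j
   = (fact (Suc j) / fact (2 * Suc j + 1) * (4 * (of_real (pi\<^sup>2) / (4 * t))) ^ Suc j) / (2 :: complex)"
proof -
  have e: "2 * Suc j + 1 = 2 * j + 3" "4 * (complex_of_real (pi\<^sup>2) / (4 * t)) = of_real (pi\<^sup>2) / t" by simp_all
  show ?thesis unfolding e by (simp del: fact_Suc power_Suc)
qed

lemma summable_theta_laurent:
  "summable (\<lambda>j. norm (of_real (fact (Suc j) / (2 * fact (2 * j + 3))) * (of_real (pi\<^sup>2) / t) ^ Suc j :: complex))"
proof -
  have "summable (\<lambda>j. norm (fact (Suc j) / fact (2 * Suc j + 1) * (4 * (of_real (pi\<^sup>2) / (4 * t))) ^ Suc j :: complex))"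
    using summable_odd_erf[of "of_real (pi\<^sup>2) / (4 * t)", THEN summable_ignore_initial_segment, of 1]
    by (simp only: Suc_eq_plus1)
  then show ?thesis unfolding theta_laurent_term norm_divide by (rule summable_divide)
qed

lemma theta_laurent_eq: "theta_laurent t = (odd_erf_sum (of_real (pi\<^sup>2) / (4 * t)) - 1) / 2"
proof -
  let ?h = "\<lambda>j. fact j / fact (2 * j + 1) * (4 * (of_real (pi\<^sup>2) / (4 * t))) ^ j :: complex"
  have s: "summable ?h" using summable_odd_erf by (rule summable_norm_cancel)
  have "theta_laurent t = (\<Sum>j. ?h (Suc j) / 2)"
    unfolding theta_laurent_def theta_laurent_term ..
  also have "\<dots> = (\<Sum>j. ?h (Suc j)) / 2"
    using summable_ignore_initial_segment[OF s, of 1] by (intro suminf_divide) (simp only: Suc_eq_plus1)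
  also have "(\<Sum>j. ?h (Suc j)) = odd_erf_sum (of_real (pi\<^sup>2) / (4 * t)) - ?h 0"
    unfolding odd_erf_sum_def by (rule suminf_split_head[OF s])
  finally show ?thesis by simp
qed

lemma norm_theta_laurent_le:
  "norm (theta_laurent t) \<le> exp (pi\<^sup>2 / (4 * norm t)) / 2"
proof -
  let ?y = "complex_of_real (pi\<^sup>2) / (4 * t)"
  have ny: "norm ?y = pi\<^sup>2 / (4 * norm t)" by (simp add: norm_divide norm_mult norm_power)
  have "norm (theta_laurent t) \<le> (\<Sum>j. norm ?y ^ Suc j / fact (Suc j) / 2)"
    unfolding theta_laurent_def
  proof (rule norm_suminf_le)
    show "norm (of_real (fact (Suc j) / (2 * fact (2 * j + 3))) * (of_real (pi\<^sup>2) / t) ^ Suc j :: complex) \<le> norm ?y ^ Suc j / fact (Suc j) / 2" for j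
      unfolding theta_laurent_term norm_divide[of _ 2] using odd_erf_term_le[of "Suc j" ?y]
      by (simp only: norm_numeral divide_right_mono zero_le_numeral)
    have "summable (\<lambda>j. norm ?y ^ j / fact j)" using exp_series_real by (rule sums_summable)
    from summable_ignore_initial_segment[OF this, of 1]
    have "summable (\<lambda>j. norm ?y ^ Suc j / fact (Suc j))" by (simp only: Suc_eq_plus1)
    then show "summable (\<lambda>j. norm ?y ^ Suc j / fact (Suc j) / 2)" by (rule summable_divide)
  qed
  also have "\<dots> = (exp (norm ?y) - 1) / 2"
  proof -
    have "(\<lambda>j. norm ?y ^ Suc j / fact (Suc j)) sums (exp (norm ?y) - norm ?y ^ 0 / fact 0)"
      by (subst sums_Suc_iff) (use exp_series_real in simp)
    from sums_divide[OF this, of 2] show ?thesis by (simp add: sums_iff)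
  qed
  also have "\<dots> \<le> exp (norm ?y) / 2" by simp
  finally show ?thesis unfolding ny .
qed

text \<open>With \<open>w = pi / (2 sqrt t)\<close> the difference is
  \<open>J / (2 w) + 1 / 2\<close>, where \<open>J\<close> is the scaled \<open>erfc\<close> of
  \<open>norm_erfc_le\<close>; the principal root makes \<open>Re w \<ge> 0\<close>.\<close>

lemma theta_main_minus_laurent:
  assumes t: "Re t > 0"
  shows "norm (theta_main t - theta_laurent t) \<le> 1 / 2 + sqrt (norm t) / (2 * sqrt pi)"
proof -
  define w where "w = of_real (pi / 2) / csqrt t"
  have t0: "t \<noteq> 0" "csqrt t \<noteq> 0" using t by auto
  have w2: "w\<^sup>2 = of_real (pi\<^sup>2) / (4 * t)"
    by (simp add: w_def power_divide power_mult_distrib)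
  have "Re w \<ge> 0" unfolding w_def using csqrt_principal[of t]
    by (auto simp: Re_divide intro!: divide_nonneg_nonneg mult_nonneg_nonneg)
  have w0: "w \<noteq> 0" using t0 by (simp add: w_def)
  let ?J = "of_real (sqrt pi / 2) * exp (w\<^sup>2) - w * odd_erf_sum (w\<^sup>2)"
  have main: "theta_main t = of_real (sqrt pi / 2) * exp (w\<^sup>2) / (2 * w)"
  proof -
    have "csqrt t / (2 * of_real (sqrt pi)) = of_real (sqrt pi / 2) / (2 * w)"
    proof -
      have "complex_of_real (sqrt pi) * of_real (sqrt pi) = of_real pi"
        by (simp flip: of_real_mult)
      then show ?thesis using t0 by (simp add: w_def field_simps)
    qed
    then show ?thesis by (simp add: theta_main_def w2)
  qed
  have "theta_main t - theta_laurent t = ?J / (2 * w) + 1 / 2"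
    unfolding main theta_laurent_eq w2[symmetric] using w0 by (simp add: field_simps)
  also have "norm \<dots> \<le> norm (?J / (2 * w)) + norm (1 / 2 :: complex)" by (rule norm_triangle_ineq)
  also have "norm (?J / (2 * w)) \<le> sqrt pi / 2 / (2 * norm w)"
    unfolding norm_divide norm_mult[of 2] using norm_erfc_le[OF \<open>Re w \<ge> 0\<close>] w0
    by (intro divide_mono) auto
  also have "sqrt pi / 2 / (2 * norm w) = sqrt (norm t) / (2 * sqrt pi)"
    using t0 by (simp add: w_def norm_divide field_simps)
  finally show ?thesis by simp
qed

text \<open>The threshold 3/50 gives \<open>exp (- 2 pi^2 R) \<le> 2 / 5\<close> for
  \<open>R = Re (1 / t)\<close>, hence \<open>psi\<close> is at least 1/3 in norm. Replacing
  \<open>psi\<close> by 1 costs \<open>theta_main\<close> times that exponential; the joint exponent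
  \<open>(1/4 - 2) pi^2 R\<close> is negative, so the error stays bounded even where
  \<open>theta_main\<close> is huge.\<close>

theorem major_arc_bound:
  assumes t: "Re t > 0" and R: "Re (1 / t) \<ge> 3 / 50"
  shows "norm (1 / theta (exp (- t)) - theta_laurent t) \<le> 1 / 2 + 2 * sqrt (norm t)"
proof -
  let ?q = "exp (- (complex_of_real (2 * pi\<^sup>2) / t))" and ?R = "Re (1 / t)"
  have t0: "csqrt t \<noteq> 0" "t \<noteq> 0" using t by auto
  have reR: "Re (complex_of_real c / t) = c * ?R" for c
    by (simp add: Re_divide)
  have nq: "norm ?q = exp (- (2 * pi\<^sup>2 * ?R))" by (simp only: norm_exp_eq_Re uminus_complex.simps reR)
  have pi2: "pi\<^sup>2 \<ge> 9" using power_mono[of 3 pi 2] pi_gt3 by simp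
  have "18 * (3 / 50) \<le> 2 * pi\<^sup>2 * ?R" using pi2 R by (intro mult_mono) auto
  then have ge: "27 / 25 \<le> 2 * pi\<^sup>2 * ?R" by simp
  have "5 / 2 \<le> 1 + 27 / 25 + (27 / 25)\<^sup>2 / (2 :: real)" by (simp add: power2_eq_square)
  also have "\<dots> \<le> exp (27 / 25)" by (rule exp_lower_Taylor_quadratic) simp
  also have "\<dots> \<le> exp (2 * pi\<^sup>2 * ?R)" using ge by simp
  finally have "exp (- (2 * pi\<^sup>2 * ?R)) \<le> 2 / 5" by (simp add: exp_minus field_simps)
  then have q: "norm ?q \<le> 2 / 5" by (simp only: nq)
  have lt: "norm ?q < 1" using q by linarith
  have "a / (1 - a) \<le> 5 / 3 * a" if "0 \<le> a" "a \<le> 2 / 5" for a :: real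
  proof -
    have "a * (5 * a) \<le> a * 2" using that by (intro mult_left_mono) auto
    then show ?thesis using that by (simp add: divide_simps) (simp add: algebra_simps)
  qed
  from order_trans[OF norm_psi_minus_1[OF lt] this[OF norm_ge_zero q]]
  have p1: "norm (psi ?q - 1) \<le> 5 / 3 * norm ?q" .
  have "1 \<le> norm (psi ?q) + norm (psi ?q - 1)" using norm_triangle_ineq4[of "psi ?q" "psi ?q - 1"] by simp
  then have p2: "norm (psi ?q) \<ge> 1 / 3" using p1 q by linarith
  then have p0: "psi ?q \<noteq> 0" by auto
  have "theta (exp (- t)) * theta_main t = psi ?q"
  proof -
    have "theta (exp (- t)) * theta_main t
        = (theta (exp (- t)) * csqrt t) / (2 * of_real (sqrt pi)) * exp (of_real (pi\<^sup>2) / (4 * t))"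
      by (simp add: theta_main_def)
    also have "\<dots> = psi ?q" unfolding theta_transform[OF t] by (simp add: exp_minus)
    finally show ?thesis .
  qed
  note prod_eq = this
  then have "theta_main t \<noteq> 0" using p0 by auto
  then have inv: "1 / theta (exp (- t)) = theta_main t / psi ?q"
    unfolding prod_eq[symmetric] by simp
  have "1 / theta (exp (- t)) - theta_main t = theta_main t * (1 - psi ?q) / psi ?q"
    unfolding inv using p0 by (simp add: field_simps)
  then have "norm (1 / theta (exp (- t)) - theta_main t) = norm (theta_main t) * norm (psi ?q - 1) / norm (psi ?q)"
    by (simp add: norm_mult norm_divide norm_minus_commute)
  also have "\<dots> \<le> norm (theta_main t) * (5 / 3 * norm ?q) / (1 / 3)"
    using p1 p2 by (intro frac_le mult_left_mono mult_nonneg_nonneg) auto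
  also have "\<dots> = norm (theta_main t) * norm ?q * 5" by simp
  also have "norm (theta_main t) * norm ?q \<le> sqrt (norm t) / (2 * sqrt pi)"
  proof -
    have "norm (exp (of_real (pi\<^sup>2) / (4 * t))) = exp (pi\<^sup>2 / 4 * ?R)"
      using reR[of "pi\<^sup>2 / 4"] by (simp add: norm_exp_eq_Re)
    then have "norm (theta_main t) * norm ?q = sqrt (norm t) / (2 * sqrt pi) * (exp (pi\<^sup>2 / 4 * ?R) * exp (- (2 * pi\<^sup>2 * ?R)))"
      unfolding nq theta_main_def by (simp add: norm_mult norm_divide)
    also have "exp (pi\<^sup>2 / 4 * ?R) * exp (- (2 * pi\<^sup>2 * ?R)) = exp (- (7 / 4 * pi\<^sup>2 * ?R))"
      by (simp flip: exp_add)
    also have "sqrt (norm t) / (2 * sqrt pi) * \<dots> \<le> sqrt (norm t) / (2 * sqrt pi) * 1"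
      using R by (intro mult_left_mono) auto
    finally show ?thesis by (simp only: mult_1_right)
  qed
  finally have "norm (1 / theta (exp (- t)) - theta_main t) \<le> sqrt (norm t) / (2 * sqrt pi) * 5" by simp
  moreover have "norm (1 / theta (exp (- t)) - theta_laurent t)
      \<le> norm (1 / theta (exp (- t)) - theta_main t) + norm (theta_main t - theta_laurent t)"
    using norm_triangle_ineq[of "1 / theta (exp (- t)) - theta_main t" "theta_main t - theta_laurent t"] by simp
  ultimately have "norm (1 / theta (exp (- t)) - theta_laurent t) \<le> 1 / 2 + 6 * (sqrt (norm t) / (2 * sqrt pi))"
    using theta_main_minus_laurent[OF t] by linarith
  also have "6 * (sqrt (norm t) / (2 * sqrt pi)) \<le> 2 * sqrt (norm t)"
  proof -
    have "3 / 2 \<le> sqrt pi" using pi_gt3 by (intro real_le_rsqrt) (simp add: power2_eq_square)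
    then have "sqrt (norm t) / (2 * sqrt pi) \<le> sqrt (norm t) / 3" by (intro divide_left_mono) auto
    then show ?thesis by simp
  qed
  finally show ?thesis by simp
qed

section \<open>Contour integrals\<close>

lemma contour_integral_linepath_suminf:
  fixes f :: "nat \<Rightarrow> complex \<Rightarrow> complex"
  assumes int: "\<And>n. f n contour_integrable_on linepath a b"
    and bound: "\<And>n z. z \<in> closed_segment a b \<Longrightarrow> norm (f n z) \<le> M n" and M: "summable M"
  shows "(\<lambda>z. \<Sum>n. f n z) contour_integrable_on linepath a b"
    and "(\<lambda>n. contour_integral (linepath a b) (f n)) sums contour_integral (linepath a b) (\<lambda>z. \<Sum>n. f n z)"
proof -
  have ul: "uniform_limit (path_image (linepath a b)) (\<lambda>n x. \<Sum>i<n. f i x) (\<lambda>x. \<Sum>i. f i x) sequentially"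
    using bound M by (intro Weierstrass_m_test) auto
  have ev: "\<forall>\<^sub>F n in sequentially. (\<lambda>x. \<Sum>i<n. f i x) contour_integrable_on linepath a b"
    by (intro always_eventually allI contour_integrable_sum int) auto
  have B: "norm (vector_derivative (linepath a b) (at t)) \<le> norm (b - a)" for t by simp
  note lim = contour_integral_uniform_limit[OF ev ul B valid_path_linepath trivial_limit_sequentially]
  show "(\<lambda>z. \<Sum>n. f n z) contour_integrable_on linepath a b" by (rule lim(1))
  have "contour_integral (linepath a b) (\<lambda>x. \<Sum>i<n. f i x) = (\<Sum>i<n. contour_integral (linepath a b) (f i))" for n
    by (intro contour_integral_sum int) auto
  then show "(\<lambda>n. contour_integral (linepath a b) (f n)) sums contour_integral (linepath a b) (\<lambda>z. \<Sum>n. f n z)"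
    using lim(2) unfolding sums_def by simp
qed

lemma exp_has_contour_integral_period:
  fixes k :: int and x :: real
  defines "a \<equiv> Complex x (- pi)" and "b \<equiv> Complex x pi"
  shows "((\<lambda>t. exp (of_int k * t)) has_contour_integral (if k = 0 then 2 * pi * \<i> else 0)) (linepath a b)"
proof (cases "k = 0")
  case True
  have "b - a = 2 * of_real pi * \<i>" by (simp add: a_def b_def complex_eq_iff)
  with has_contour_integral_const_linepath[of 1 b a]
  have "((\<lambda>x. 1) has_contour_integral 1 * (2 * of_real pi * \<i>)) (linepath a b)" by (simp only:)
  then show ?thesis using True by simp
next
  case False
  have "((\<lambda>t. exp (of_int k * t)) has_contour_integral
      (exp (of_int k * pathfinish (linepath a b)) / of_int k - exp (of_int k * pathstart (linepath a b)) / of_int k)) (linepath a b)"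
    by (rule contour_integral_primitive[where S = UNIV])
      (use False in \<open>auto intro!: derivative_eq_intros\<close>)
  moreover have "exp (of_int k * b) = exp (of_int k * a)"
  proof -
    have "of_int k * b = of_int k * a + of_int (2 * k) * (of_real pi * \<i>)"
      by (simp add: a_def b_def complex_eq_iff)
    then show ?thesis by (metis exp_plus_2pin mult.assoc mult.commute of_int_mult of_int_numeral exp_eq)
  qed
  ultimately show ?thesis using False by simp
qed

lemma in_vertical_segment:
  "z \<in> closed_segment (Complex x c) (Complex x d) \<Longrightarrow> c \<le> d \<Longrightarrow> Re z = x \<and> c \<le> Im z \<and> Im z \<le> d"
proof -
  assume z: "z \<in> closed_segment (Complex x c) (Complex x d)" and cd: "c \<le> d"
  obtain v where v: "0 \<le> v" "v \<le> 1" "z = (1 - v) *\<^sub>R Complex x c + v *\<^sub>R Complex x d"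
    using z by (auto simp: closed_segment_def)
  have "Re z = x" unfolding v(3) by (simp add: algebra_simps)
  moreover have "Im z = c + v * (d - c)" unfolding v(3) by (simp add: algebra_simps)
  moreover have "Im z = d - (1 - v) * (d - c)" unfolding v(3) by (simp add: algebra_simps)
  moreover have "0 \<le> v * (d - c)" "0 \<le> (1 - v) * (d - c)" using v cd by (auto intro: mult_nonneg_nonneg)
  ultimately show ?thesis by linarith
qed

text \<open>Cauchy's coefficient formula under \<open>q = exp (- t)\<close>: a circle becomes one
  vertical period, and termwise integration keeps the index \<open>m = n\<close> only.\<close>

lemma overpart_contour:
  assumes x: "x > 0"
  defines "L \<equiv> linepath (Complex x (- pi)) (Complex x pi)"
  shows "(\<lambda>t. exp (of_nat n * t) / theta (exp (- t))) contour_integrable_on L"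
    and "contour_integral L (\<lambda>t. exp (of_nat n * t) / theta (exp (- t))) = 2 * pi * \<i> * of_nat (overpart n)"
proof -
  define f :: "nat \<Rightarrow> complex \<Rightarrow> complex" where "f m t = of_nat (overpart m) * exp (of_int (int n - int m) * t)" for m t
  let ?r = "exp (- x)"
  have has: "(f m has_contour_integral (if m = n then 2 * pi * \<i> * of_nat (overpart n) else 0)) L" for m
    using has_contour_integral_lmul[OF exp_has_contour_integral_period[of "int n - int m" x], of "of_nat (overpart m)"]
    unfolding f_def L_def by (cases "m = n") (auto simp: mult_ac)
  have int: "f m contour_integrable_on L" for m using has by (rule has_contour_integral_integrable)
  have split: "f m t = exp (of_nat n * t) * (of_nat (overpart m) * exp (- t) ^ m)" for m t
  proof -
    have "of_int (int n - int m) * t = of_nat n * t + of_nat m * (- t)" by (simp add: algebra_simps)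
    then have "exp (of_int (int n - int m) * t) = exp (of_nat n * t) * exp (- t) ^ m"
      by (simp only: exp_add exp_of_nat_mult)
    then show ?thesis by (simp add: f_def)
  qed
  have bnd: "norm (f m t) \<le> exp (real n * x) * (real (overpart m) * ?r ^ m)"
    if "t \<in> closed_segment (Complex x (- pi)) (Complex x pi)" for m t
  proof -
    have "Re t = x" using in_vertical_segment[OF that] by simp
    then show ?thesis unfolding split by (simp add: norm_mult norm_power)
  qed
  have sm: "summable (\<lambda>m. exp (real n * x) * (real (overpart m) * ?r ^ m))"
    using overpart_sums(1)[of "of_real ?r"] x by (intro summable_mult) (simp add: norm_mult norm_power)
  note res = contour_integral_linepath_suminf[OF int[unfolded L_def] bnd sm]
  have eq: "(\<Sum>m. f m t) = exp (of_nat n * t) / theta (exp (- t))" if "Re t > 0" for t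
  proof -
    have "(\<lambda>m. exp (of_nat n * t) * (of_nat (overpart m) * exp (- t) ^ m)) sums (exp (of_nat n * t) * (1 / theta (exp (- t))))"
      by (intro sums_mult overpart_sums(2)) (use that in simp)
    then show ?thesis unfolding split[symmetric] by (simp add: sums_iff)
  qed
  have eq': "(\<Sum>m. f m t) = exp (of_nat n * t) / theta (exp (- t))" if "t \<in> path_image L" for t
  proof (rule eq)
    show "Re t > 0" using that x in_vertical_segment[of t x "-pi" pi] by (auto simp: L_def)
  qed
  show "(\<lambda>t. exp (of_nat n * t) / theta (exp (- t))) contour_integrable_on L"
    by (rule contour_integrable_eq[OF res(1)[folded L_def] eq'])
  have "contour_integral L (\<lambda>t. exp (of_nat n * t) / theta (exp (- t))) = contour_integral L (\<lambda>z. \<Sum>m. f m z)"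
    by (rule contour_integral_cong[OF refl]) (use eq' in simp)
  also have "(\<lambda>m. contour_integral L (f m)) = (\<lambda>m. if m = n then 2 * pi * \<i> * of_nat (overpart n) else 0)"
    using has contour_integral_unique by blast
  then have "(\<lambda>m. if m = n then 2 * pi * \<i> * of_nat (overpart n) else 0) sums contour_integral L (\<lambda>z. \<Sum>m. f m z)"
    using res(2) unfolding L_def by simp
  then have "contour_integral L (\<lambda>z. \<Sum>m. f m z) = 2 * pi * \<i> * of_nat (overpart n)"
    using sums_single[of n "\<lambda>_. 2 * pi * \<i> * of_nat (overpart n)"] sums_unique2 by blast
  finally show "contour_integral L (\<lambda>t. exp (of_nat n * t) / theta (exp (- t))) = 2 * pi * \<i> * of_nat (overpart n)" .
qed

section \<open>The residue of the singular part\<close>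

definition laurent_coeff :: "nat \<Rightarrow> real" where
  "laurent_coeff j = fact (Suc j) / (2 * fact (2 * j + 3)) * (pi\<^sup>2) ^ Suc j"

text \<open>The residue at 0 of \<open>exp (n t) * theta_laurent t\<close>, summed term by
  term.\<close>

definition overpart_main :: "nat \<Rightarrow> real" where
  "overpart_main n = (\<Sum>j. laurent_coeff j * real n ^ j / fact j)"

lemma theta_laurent_sum: "theta_laurent t = (\<Sum>j. of_real (laurent_coeff j) / t ^ Suc j)"
  unfolding theta_laurent_def laurent_coeff_def
  by (simp only: power_divide of_real_mult of_real_power times_divide_eq_right)

lemma summable_laurent_coeff: "summable (\<lambda>j. \<bar>laurent_coeff j\<bar> / d ^ Suc j)" if "d > 0"
proof -
  have "norm (of_real (fact (Suc j) / (2 * fact (2 * j + 3))) * (of_real (pi\<^sup>2) / of_real d) ^ Suc j :: complex) = \<bar>laurent_coeff j\<bar> / d ^ Suc j" for j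
    using that by (simp add: laurent_coeff_def norm_mult norm_divide norm_power power_divide abs_mult del: fact_Suc power_Suc)
  then show ?thesis using summable_theta_laurent[of "of_real d"] by simp
qed

lemma higher_deriv_exp_linear: "(deriv ^^ j) (\<lambda>t. exp (c * t)) = (\<lambda>t. c ^ j * exp (c * t :: complex))"
proof (induction j)
  case (Suc j)
  have "deriv (\<lambda>t. c ^ j * exp (c * t)) t = c ^ Suc j * exp (c * t)" for t
    by (rule DERIV_imp_deriv) (auto intro!: derivative_eq_intros)
  then show ?case using Suc by auto
qed simp

lemma rectpath_power_integral:
  assumes a: "Re a < 0" "Im a < 0" and b: "Re b > 0" "Im b > 0"
  shows "contour_integral (rectpath a b) (\<lambda>t. exp (of_nat n * t) / t ^ Suc j) = 2 * pi * \<i> * (of_nat n ^ j / fact j)"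
proof -
  have box: "0 \<in> box a b" using a b by (simp add: in_box_complex_iff)
  have img: "path_image (rectpath a b) \<subseteq> UNIV - {0}"
    using path_image_rectpath_cbox_minus_box[of a b] a b box by auto
  have "contour_integral (rectpath a b) (\<lambda>t. exp (of_nat n * t) / t ^ Suc j)
      = 2 * pi * \<i> * (\<Sum>p\<in>{0}. winding_number (rectpath a b) p * residue (\<lambda>t. exp (of_nat n * t) / t ^ Suc j) p)"
    by (rule Residue_theorem[of UNIV "{0}"]) (use img in \<open>auto intro!: holomorphic_intros\<close>)
  moreover have "residue (\<lambda>t. exp (of_nat n * t) / t ^ Suc j) 0 = (deriv ^^ j) (\<lambda>t. exp (of_nat n * t)) 0 / fact j"
    by (rule residue_holomorphic_over_power'[of UNIV]) (auto intro!: holomorphic_intros)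
  ultimately show ?thesis using winding_number_rectpath[OF box]
    by (simp add: higher_deriv_exp_linear del: power_Suc)
qed

lemma in_horizontal_segment:
  "z \<in> closed_segment (Complex c y) (Complex d y) \<Longrightarrow> c \<le> d \<Longrightarrow> Im z = y \<and> c \<le> Re z \<and> Re z \<le> d"
proof -
  assume z: "z \<in> closed_segment (Complex c y) (Complex d y)" and "c \<le> d"
  then have "- (\<i> * z) \<in> closed_segment (Complex y (-d)) (Complex y (-c))"
  proof -
    obtain v where v: "0 \<le> v" "v \<le> 1" "z = (1 - v) *\<^sub>R Complex c y + v *\<^sub>R Complex d y"
      using z by (auto simp: closed_segment_def)
    then have "- (\<i> * z) = (1 - v) *\<^sub>R Complex y (-c) + v *\<^sub>R Complex y (-d)"
      by (simp add: complex_eq_iff algebra_simps)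
    then have "- (\<i> * z) \<in> closed_segment (Complex y (-c)) (Complex y (-d))"
      using v(1,2) by (auto simp: closed_segment_def)
    then show ?thesis by (simp add: closed_segment_commute)
  qed
  from in_vertical_segment[OF this] \<open>c \<le> d\<close> show ?thesis by simp
qed

text \<open>At 0 \<open>theta_laurent\<close> has an essential singularity, so the residue theorem
  is applied to single powers. On a segment at distance \<open>d\<close> from 0 the M-test lets sum
  and integral commute.\<close>

lemma overpart_main_segment:
  assumes S: "\<And>t. t \<in> closed_segment p q \<Longrightarrow> d \<le> norm t \<and> Re t \<le> x" and d: "d > 0"
  shows "(\<lambda>t. of_real (laurent_coeff j) * (exp (of_nat n * t) / t ^ Suc j)) contour_integrable_on linepath p q"
    and "(\<lambda>t. exp (of_nat n * t) * theta_laurent t) contour_integrable_on linepath p q"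
    and "(\<lambda>j. contour_integral (linepath p q) (\<lambda>t. of_real (laurent_coeff j) * (exp (of_nat n * t) / t ^ Suc j)))
      sums contour_integral (linepath p q) (\<lambda>t. exp (of_nat n * t) * theta_laurent t)"
proof -
  define f :: "nat \<Rightarrow> complex \<Rightarrow> complex" where
    "f j t = of_real (laurent_coeff j) * (exp (of_nat n * t) / t ^ Suc j)" for j t
  have int: "f j contour_integrable_on linepath p q" for j
    unfolding f_def using S d
    by (intro contour_integrable_continuous_linepath continuous_intros) fastforce+
  then show "(\<lambda>t. of_real (laurent_coeff j) * (exp (of_nat n * t) / t ^ Suc j)) contour_integrable_on linepath p q"
    unfolding f_def .
  have bnd: "norm (f j t) \<le> exp (real n * x) * (\<bar>laurent_coeff j\<bar> / d ^ Suc j)" if "t \<in> closed_segment p q" for j t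
  proof -
    have "exp (real n * Re t) \<le> exp (real n * x)" using S[OF that] by (simp add: mult_left_mono)
    moreover have "\<bar>laurent_coeff j\<bar> / norm t ^ Suc j \<le> \<bar>laurent_coeff j\<bar> / d ^ Suc j"
      using S[OF that] d by (intro divide_left_mono power_mono mult_pos_pos zero_less_power) auto
    ultimately have "exp (real n * Re t) * (\<bar>laurent_coeff j\<bar> / norm t ^ Suc j) \<le> exp (real n * x) * (\<bar>laurent_coeff j\<bar> / d ^ Suc j)"
      by (intro mult_mono) auto
    then show ?thesis by (simp add: f_def norm_mult norm_divide norm_power mult_ac)
  qed
  have sm: "summable (\<lambda>j. exp (real n * x) * (\<bar>laurent_coeff j\<bar> / d ^ Suc j))"
    using d by (intro summable_mult summable_laurent_coeff)
  note res = contour_integral_linepath_suminf[OF int bnd sm]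
  have "(\<Sum>j. f j t) = exp (of_nat n * t) * theta_laurent t" for t
  proof -
    have "summable (\<lambda>j. of_real (laurent_coeff j) / t ^ Suc j)"
      using summable_norm_cancel[OF summable_theta_laurent[of t]] unfolding laurent_coeff_def
      by (simp only: power_divide of_real_mult of_real_power times_divide_eq_right)
    from suminf_mult[OF this, of "exp (of_nat n * t)"] show ?thesis
      by (simp add: f_def theta_laurent_sum mult_ac)
  qed
  then have "(\<lambda>t. \<Sum>j. f j t) = (\<lambda>t. exp (of_nat n * t) * theta_laurent t)" by (rule ext)
  with res show "(\<lambda>t. exp (of_nat n * t) * theta_laurent t) contour_integrable_on linepath p q"
    "(\<lambda>j. contour_integral (linepath p q) (\<lambda>t. of_real (laurent_coeff j) * (exp (of_nat n * t) / t ^ Suc j)))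
      sums contour_integral (linepath p q) (\<lambda>t. exp (of_nat n * t) * theta_laurent t)"
    by (simp_all only: f_def)
qed

lemma exp_pi_sq_quarter_le: "exp (pi\<^sup>2 / 4) \<le> 16"
proof -
  have "pi\<^sup>2 \<le> (32 / 10)\<^sup>2" using pi_approx by (intro power_mono) auto
  then have "exp (pi\<^sup>2 / 4) \<le> exp (13 / 5)" by (simp add: power2_eq_square)
  also have "\<dots> \<le> 16"
  proof -
    have "exp (13 / 5) ^ 5 = exp (1 :: real) ^ 13" by (simp flip: exp_of_nat_mult)
    also have "\<dots> \<le> (272 / 100) ^ 13" using e_less_272 by (intro power_mono) auto
    also have "\<dots> \<le> 16 ^ 5" by (simp add: field_simps)
    finally show ?thesis by (rule power_le_imp_le_base[of _ 4, unfolded eval_nat_numeral One_nat_def, simplified]) auto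
  qed
  finally show ?thesis .
qed

text \<open>The segment is closed to a rectangle reaching \<open>Re t = -1\<close>. On the three
  added sides \<open>norm t \<ge> 1\<close>, hence \<open>theta_laurent\<close> is at most 8 there;
  their lengths give \<open>(16 (1 + x) + 16 pi) / (2 pi)\<close>, which is below 12.\<close>

theorem overpart_minus_main:
  assumes x: "0 < x" "x \<le> 1 / 10" and B: "B \<ge> 0"
    and bound: "\<And>t. Re t = x \<Longrightarrow> \<bar>Im t\<bar> \<le> pi \<Longrightarrow> norm (1 / theta (exp (- t)) - theta_laurent t) \<le> B"
  shows "\<bar>real (overpart n) - overpart_main n\<bar> \<le> exp (real n * x) * (B + 12)"
proof -
  let ?a1 = "Complex (-1) (- pi)" and ?a2 = "Complex x (- pi)" and ?a3 = "Complex x pi" and ?a4 = "Complex (-1) pi"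
  let ?f = "\<lambda>j t. of_real (laurent_coeff j) * (exp (of_nat n * t) / t ^ Suc j)"
  let ?H = "\<lambda>t. exp (of_nat n * t) * theta_laurent t"
  have xpi: "x \<le> pi" "1 \<le> pi" using x pi_gt3 by linarith+
  have s1: "1 \<le> norm t \<and> Re t \<le> x" if "t \<in> closed_segment ?a1 ?a2" for t
    using in_horizontal_segment[OF that] x abs_Im_le_cmod[of t] xpi by auto
  have s2: "x \<le> norm t \<and> Re t \<le> x" if "t \<in> closed_segment ?a2 ?a3" for t
    using in_vertical_segment[OF that] x abs_Re_le_cmod[of t] by auto
  have s3: "1 \<le> norm t \<and> Re t \<le> x" if "t \<in> closed_segment ?a3 ?a4" for t
    using in_horizontal_segment[OF that[unfolded closed_segment_commute[of ?a3]]] x abs_Im_le_cmod[of t] xpi by auto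
  have s4: "1 \<le> norm t \<and> Re t \<le> x" if "t \<in> closed_segment ?a4 ?a1" for t
    using in_vertical_segment[OF that[unfolded closed_segment_commute[of ?a4]]] x abs_Re_le_cmod[of t] by auto
  note r1 = overpart_main_segment[OF s1 zero_less_one, where n = n]
  note r2 = overpart_main_segment[OF s2 x(1), where n = n]
  note r3 = overpart_main_segment[OF s3 zero_less_one, where n = n]
  note r4 = overpart_main_segment[OF s4 zero_less_one, where n = n]
  let ?I1 = "contour_integral (linepath ?a1 ?a2)" and ?I2 = "contour_integral (linepath ?a2 ?a3)"
    and ?I3 = "contour_integral (linepath ?a3 ?a4)" and ?I4 = "contour_integral (linepath ?a4 ?a1)"
  have rect: "?I1 (?f j) + (?I2 (?f j) + (?I3 (?f j) + ?I4 (?f j))) = of_real (laurent_coeff j) * (2 * pi * \<i> * (of_nat n ^ j / fact j))" for j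
  proof -
    have "?I1 (?f j) + (?I2 (?f j) + (?I3 (?f j) + ?I4 (?f j))) = contour_integral (rectpath ?a1 ?a3) (?f j)"
      using r1(1)[where j = j] r2(1)[where j = j] r3(1)[where j = j] r4(1)[where j = j]
      by (simp add: rectpath_def Let_def contour_integrable_joinI valid_path_join del: power_Suc)
    also have "\<dots> = of_real (laurent_coeff j) * contour_integral (rectpath ?a1 ?a3) (\<lambda>t. exp (of_nat n * t) / t ^ Suc j)"
    proof (rule contour_integral_lmul)
      have box: "0 \<in> box ?a1 ?a3" using x pi_gt_zero by (simp add: in_box_complex_iff)
      have "path_image (rectpath ?a1 ?a3) \<subseteq> UNIV - {0}"
        using path_image_rectpath_cbox_minus_box[of ?a1 ?a3] x box by auto
      then show "(\<lambda>t. exp (of_nat n * t) / t ^ Suc j) contour_integrable_on rectpath ?a1 ?a3"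
        by (intro contour_integrable_holomorphic_simple[of _ "UNIV - {0}"] holomorphic_intros) auto
    qed
    also have "contour_integral (rectpath ?a1 ?a3) (\<lambda>t. exp (of_nat n * t) / t ^ Suc j) = 2 * pi * \<i> * (of_nat n ^ j / fact j)"
      using x by (intro rectpath_power_integral) auto
    finally show ?thesis .
  qed
  have "(\<lambda>j. ?I1 (?f j) + (?I2 (?f j) + (?I3 (?f j) + ?I4 (?f j)))) sums (?I1 ?H + (?I2 ?H + (?I3 ?H + ?I4 ?H)))"
    by (intro sums_add r1(3) r2(3) r3(3) r4(3))
  then have sm: "(\<lambda>j. 2 * pi * \<i> * of_real (laurent_coeff j * real n ^ j / fact j)) sums (?I1 ?H + (?I2 ?H + (?I3 ?H + ?I4 ?H)))"
    unfolding rect by (simp add: mult_ac)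
  from sums_mult[OF this, of "1 / (2 * pi * \<i>)"]
  have sm': "(\<lambda>j. of_real (laurent_coeff j * real n ^ j / fact j)) sums (1 / (2 * pi * \<i>) * (?I1 ?H + (?I2 ?H + (?I3 ?H + ?I4 ?H))))"
    by (simp add: field_simps)
  have re: "(\<lambda>j. laurent_coeff j * real n ^ j / fact j) sums Re (1 / (2 * pi * \<i>) * (?I1 ?H + (?I2 ?H + (?I3 ?H + ?I4 ?H))))"
    using sums_Re[OF sm'] by (simp only: Re_complex_of_real)
  have "complex_of_real (overpart_main n) = 1 / (2 * pi * \<i>) * (?I1 ?H + (?I2 ?H + (?I3 ?H + ?I4 ?H)))"
    unfolding overpart_main_def sums_unique[OF re, symmetric]
    using sums_of_real[OF re] sm' by (rule sums_unique2)
  then have main: "2 * pi * \<i> * complex_of_real (overpart_main n) = ?I1 ?H + (?I2 ?H + (?I3 ?H + ?I4 ?H))"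
    by simp
  let ?F = "\<lambda>t. exp (of_nat n * t) / theta (exp (- t))"
  note F = overpart_contour[OF x(1), of n]
  have "2 * pi * \<i> * complex_of_real (real (overpart n) - overpart_main n)
      = ?I2 (\<lambda>t. ?F t - ?H t) - (?I1 ?H + ?I3 ?H + ?I4 ?H)"
    using contour_integral_diff[OF F(1) r2(2)] F(2) main by (simp add: right_diff_distrib)
  then have tri: "norm (2 * pi * \<i> * complex_of_real (real (overpart n) - overpart_main n))
      \<le> norm (?I2 (\<lambda>t. ?F t - ?H t)) + (norm (?I1 ?H) + norm (?I3 ?H) + norm (?I4 ?H))"
    by (smt (verit) norm_triangle_ineq norm_triangle_ineq4)
  have lhs: "norm (2 * pi * \<i> * complex_of_real (real (overpart n) - overpart_main n)) = 2 * pi * \<bar>real (overpart n) - overpart_main n\<bar>"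
    unfolding norm_mult norm_of_real by simp
  have I2: "norm (?I2 (\<lambda>t. ?F t - ?H t)) \<le> exp (real n * x) * B * norm (?a3 - ?a2)"
  proof (rule contour_integral_bound_linepath)
    show "(\<lambda>t. ?F t - ?H t) contour_integrable_on linepath ?a2 ?a3"
      by (intro contour_integrable_diff F(1) r2(2))
    fix t assume t: "t \<in> closed_segment ?a2 ?a3"
    then have t': "Re t = x" "\<bar>Im t\<bar> \<le> pi" using in_vertical_segment[OF t] by auto
    have "?F t - ?H t = exp (of_nat n * t) * (1 / theta (exp (- t)) - theta_laurent t)"
      by (simp add: right_diff_distrib)
    then show "norm (?F t - ?H t) \<le> exp (real n * x) * B"
      using bound[OF t'] t' by (simp add: norm_mult)
  qed (use B in simp)
  have a32: "norm (?a3 - ?a2) = 2 * pi"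
  proof -
    have "?a3 - ?a2 = of_real (2 * pi) * \<i>" by (simp add: complex_eq_iff)
    then show ?thesis by (simp only: norm_mult norm_of_real norm_ii) simp
  qed
  have Hb: "norm (contour_integral (linepath p q) ?H) \<le> exp (real n * x) * 8 * norm (q - p)"
    if "\<And>t. t \<in> closed_segment p q \<Longrightarrow> 1 \<le> norm t \<and> Re t \<le> x" for p q
  proof (rule contour_integral_bound_linepath)
    show "?H contour_integrable_on linepath p q" using overpart_main_segment(2)[OF that zero_less_one] .
    fix t assume "t \<in> closed_segment p q"
    note t = that[OF this]
    have "pi\<^sup>2 / (4 * norm t) \<le> pi\<^sup>2 / 4" using t by (intro divide_left_mono mult_pos_pos) auto
    then have "exp (pi\<^sup>2 / (4 * norm t)) \<le> exp (pi\<^sup>2 / 4)" by simp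
    then have "norm (theta_laurent t) \<le> 8" using norm_theta_laurent_le[of t] exp_pi_sq_quarter_le by linarith
    moreover have "exp (real n * Re t) \<le> exp (real n * x)" using t by (simp add: mult_left_mono)
    ultimately show "norm (?H t) \<le> exp (real n * x) * 8" unfolding norm_mult by (intro mult_mono) auto
  qed simp
  have n1: "norm (?a2 - ?a1) = 1 + x" "norm (?a4 - ?a3) = 1 + x" "norm (?a1 - ?a4) = 2 * pi"
  proof -
    have "?a2 - ?a1 = of_real (1 + x)" "?a4 - ?a3 = of_real (- (1 + x))" "?a1 - ?a4 = of_real (- (2 * pi)) * \<i>"
      by (simp_all add: complex_eq_iff)
    then show "norm (?a2 - ?a1) = 1 + x" "norm (?a4 - ?a3) = 1 + x" "norm (?a1 - ?a4) = 2 * pi"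
      using x pi_gt_zero by (simp_all only: norm_mult norm_of_real norm_ii)
  qed
  have "norm (?I1 ?H) \<le> exp (real n * x) * 8 * norm (?a2 - ?a1)" by (rule Hb) (rule s1)
  moreover have "norm (?I3 ?H) \<le> exp (real n * x) * 8 * norm (?a4 - ?a3)" by (rule Hb) (rule s3)
  moreover have "norm (?I4 ?H) \<le> exp (real n * x) * 8 * norm (?a1 - ?a4)" by (rule Hb) (rule s4)
  ultimately have hs: "norm (?I1 ?H) \<le> exp (real n * x) * 8 * (1 + x)" "norm (?I3 ?H) \<le> exp (real n * x) * 8 * (1 + x)"
    "norm (?I4 ?H) \<le> exp (real n * x) * 8 * (2 * pi)"
    by (simp_all only: n1)
  have "2 * pi * \<bar>real (overpart n) - overpart_main n\<bar>
    \<le> exp (real n * x) * B * (2 * pi) + (exp (real n * x) * 8 * (1 + x) + exp (real n * x) * 8 * (1 + x) + exp (real n * x) * 8 * (2 * pi))"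
    using tri I2 hs unfolding lhs a32 by linarith
  also have "\<dots> = exp (real n * x) * (B * (2 * pi) + (16 * (1 + x) + 16 * pi))"
    by (simp add: algebra_simps)
  also have "\<dots> \<le> exp (real n * x) * ((B + 12) * (2 * pi))"
    using x pi_gt3 by (intro mult_left_mono) (auto simp: algebra_simps)
  finally have "2 * pi * \<bar>real (overpart n) - overpart_main n\<bar> \<le> 2 * pi * (exp (real n * x) * (B + 12))"
    by (simp only: mult_ac)
  then show ?thesis using pi_gt_zero by (subst (asm) mult_le_cancel_left_pos) auto
qed

text \<open>The series of \<open>cosh m - sinh m / m\<close> has no term at index 0, and its other
  terms match those of \<open>overpart_main\<close> after a shift. The result is the first term of
  Zuckerman's exact formula.\<close>

lemma overpart_main_eq:
  assumes n: "n > 0" defines "m \<equiv> pi * sqrt (real n)"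
  shows "overpart_main n = pi\<^sup>2 / (4 * m\<^sup>2) * (cosh m - sinh m / m)"
proof -
  have m: "m > 0" "m\<^sup>2 = pi\<^sup>2 * real n" using n by (simp_all add: m_def power_mult_distrib)
  have sm0: "strict_mono (\<lambda>k::nat. 2 * k)" "strict_mono (\<lambda>k::nat. 2 * k + 1)" by (auto intro: strict_monoI)
  have c: "(\<lambda>k. m ^ (2 * k) / fact (2 * k)) sums cosh m"
    using sums_mono_reindex[OF sm0(1), of "\<lambda>n. if even n then m ^ n /\<^sub>R fact n else 0" "cosh m"] cosh_converges[of m]
    by (force elim: evenE simp: field_simps)
  have s: "(\<lambda>k. m ^ (2 * k + 1) / fact (2 * k + 1)) sums sinh m"
    using sums_mono_reindex[OF sm0(2), of "\<lambda>n. if even n then 0 else m ^ n /\<^sub>R fact n" "sinh m"] sinh_converges[of m]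
    by (force elim: oddE simp: field_simps)
  have d: "(\<lambda>k. m ^ (2 * k) / fact (2 * k) - m ^ (2 * k + 1) / fact (2 * k + 1) / m) sums (cosh m - sinh m / m)"
    by (intro sums_diff sums_divide c s)
  then have "(\<lambda>j. m ^ (2 * Suc j) / fact (2 * Suc j) - m ^ (2 * Suc j + 1) / fact (2 * Suc j + 1) / m) sums (cosh m - sinh m / m)"
    by (subst sums_Suc_iff) (use m in simp)
  then have "(\<lambda>j. pi\<^sup>2 / (4 * m\<^sup>2) * (m ^ (2 * Suc j) / fact (2 * Suc j) - m ^ (2 * Suc j + 1) / fact (2 * Suc j + 1) / m))
      sums (pi\<^sup>2 / (4 * m\<^sup>2) * (cosh m - sinh m / m))"
    by (rule sums_mult)
  also have "(\<lambda>j. pi\<^sup>2 / (4 * m\<^sup>2) * (m ^ (2 * Suc j) / fact (2 * Suc j) - m ^ (2 * Suc j + 1) / fact (2 * Suc j + 1) / m))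
    = (\<lambda>j. laurent_coeff j * real n ^ j / fact j)"
  proof
    fix j
    define f where "f = (fact (2 * Suc j) :: real)"
    have f: "f > 0" by (simp add: f_def)
    have f3: "fact (2 * Suc j + 1) = (2 * real j + 3) * f" "fact (2 * j + 3) = (2 * real j + 3) * f"
      by (simp_all add: f_def algebra_simps numeral_3_eq_3)
    have pw1: "m ^ (2 * Suc j) = m\<^sup>2 * (pi\<^sup>2 * real n) ^ j"
      unfolding m(2)[symmetric] power_mult by (rule power_Suc)
    then have pw: "m ^ (2 * Suc j) = m\<^sup>2 * (pi\<^sup>2 * real n) ^ j" "m ^ (2 * Suc j + 1) / m = m\<^sup>2 * (pi\<^sup>2 * real n) ^ j"
      using m(1) by simp_all
    have "m ^ (2 * Suc j + 1) / fact (2 * Suc j + 1) / m = m ^ (2 * Suc j + 1) / m / fact (2 * Suc j + 1)" by simp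
    then have "pi\<^sup>2 / (4 * m\<^sup>2) * (m ^ (2 * Suc j) / fact (2 * Suc j) - m ^ (2 * Suc j + 1) / fact (2 * Suc j + 1) / m)
      = pi\<^sup>2 / (4 * m\<^sup>2) * (m\<^sup>2 * (pi\<^sup>2 * real n) ^ j / f - m\<^sup>2 * (pi\<^sup>2 * real n) ^ j / ((2 * real j + 3) * f))"
      unfolding pw f3(1) f_def[symmetric] by (simp only: pw)
    also have "\<dots> = pi\<^sup>2 / 4 * (pi\<^sup>2 * real n) ^ j * (1 / f - 1 / ((2 * real j + 3) * f))"
    proof -
      have "c / (4 * v) * (v * p / a - v * p / b) = c / 4 * p * (1 / a - 1 / b)" if "v \<noteq> 0" for a b c p v :: real
        using that by (simp add: right_diff_distrib)
      note gen = this
      show ?thesis by (rule gen) (use m(1) in simp)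
    qed
    also have "1 / f - 1 / ((2 * real j + 3) * f) = (2 * real j + 2) / ((2 * real j + 3) * f)"
      using f by (simp add: divide_simps)
    also have "pi\<^sup>2 / 4 * (pi\<^sup>2 * real n) ^ j * ((2 * real j + 2) / ((2 * real j + 3) * f)) = laurent_coeff j * real n ^ j / fact j"
    proof -
      have "p / 4 * (p * r) ^ j * ((2 * k + 2) / (d * f)) = (k + 1) * c / (2 * (d * f)) * p ^ Suc j * r ^ j / c"
        if "d > 0" "c > 0" for c d k p r :: real
        using that f by (simp add: power_mult_distrib divide_simps)
      note gen = this
      have fs: "fact (Suc j) = (real j + 1) * fact j" by simp
      show ?thesis unfolding laurent_coeff_def f3(2) fs by (rule gen) (auto intro: add_nonneg_pos)
    qed
    finally show "pi\<^sup>2 / (4 * m\<^sup>2) * (m ^ (2 * Suc j) / fact (2 * Suc j) - m ^ (2 * Suc j + 1) / fact (2 * Suc j + 1) / m) = laurent_coeff j * real n ^ j / fact j" .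
  qed
  finally show ?thesis unfolding overpart_main_def by (simp add: sums_iff)
qed

section \<open>The asymptotic formula\<close>

lemma pi_sq_bounds: "pi\<^sup>2 \<ge> (49 / 5)" "pi\<^sup>2 \<le> (987 / 100)"
proof -
  have "(157 / 50)\<^sup>2 \<le> pi\<^sup>2" "pi\<^sup>2 \<le> (3927 / 1250)\<^sup>2" using pi_approx by (intro power_mono; simp)+
  then show "pi\<^sup>2 \<ge> (49 / 5)" "pi\<^sup>2 \<le> (987 / 100)" by (simp_all add: power2_eq_square)
qed

text \<open>Keeps only \<open>exp m / 2\<close> of both hyperbolic functions in
  \<open>overpart_main\<close>, with \<open>m = pi sqrt n\<close>.\<close>

definition overpart_lead :: "nat \<Rightarrow> real" where
  "overpart_lead n = exp (pi * sqrt (real n)) * (1 - 1 / (pi * sqrt (real n))) / (8 * real n)"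

text \<open>Tangent of the exponential at \<open>m = 94\<close>, raised to the eighth power;
  \<open>8 / 94 < 77 / 200\<close> covers larger \<open>m\<close>. The exponent 8 stems from
  \<open>n * n^3 = n^4\<close> with \<open>m^2 = pi^2 n\<close>, and 77/200 is
  \<open>1 - 123/200\<close> for the exponent 123/200 in \<open>overpart_asymptotic\<close>.\<close>

lemma exp_dominates_power8:
  fixes m :: real assumes m: "m \<ge> 94"
  shows "m ^ 8 \<le> (57 / 10) * exp ((77 / 200) * m)"
proof -
  have "m / 94 \<le> exp (m / 94 - 1)" using exp_ge_add_one_self[of "m / 94 - 1"] by simp
  then have "(m / 94) ^ 8 \<le> exp (m / 94 - 1) ^ 8" using m by (intro power_mono) auto
  also have "\<dots> = exp (8 * (m / 94 - 1))" by (simp flip: exp_of_nat_mult)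
  also have "\<dots> \<le> exp ((77 / 200) * (m - 94))" using m by simp
  finally have 1: "m ^ 8 \<le> 94 ^ 8 * exp ((77 / 200) * (m - 94))" by (simp add: power_divide)
  have "((27 / 10) :: real) \<le> exp 1" using e_approx_32 by (simp add: abs_if split: if_splits)
  then have "((27 / 10) :: real) ^ 36 \<le> exp 1 ^ 36" by (intro power_mono) auto
  also have "\<dots> = exp (36 :: real)" by (simp flip: exp_of_nat_mult)
  also have "\<dots> \<le> exp ((77 / 200) * 94)" by simp
  finally have e: "((27 / 10) :: real) ^ 36 \<le> exp ((77 / 200) * 94)" .
  have "(94 :: real) ^ 8 \<le> (57 / 10) * (27 / 10) ^ 36" by (simp add: power_divide)
  also have "\<dots> \<le> (57 / 10) * exp ((77 / 200) * 94)" using e by (intro mult_left_mono) auto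
  finally have "94 ^ 8 \<le> (57 / 10) * exp ((77 / 200) * 94 :: real)" .
  then have "94 ^ 8 * exp ((77 / 200) * (m - 94)) \<le> (57 / 10) * exp ((77 / 200) * 94) * exp ((77 / 200) * (m - 94))"
    by (intro mult_right_mono) auto
  also have "\<dots> = (57 / 10) * exp ((77 / 200) * 94 + (77 / 200) * (m - 94))" by (simp only: mult.assoc exp_add)
  also have "(77 / 200) * 94 + (77 / 200) * (m - 94) = (77 / 200) * m" by (simp add: right_diff_distrib)
  finally show ?thesis using 1 by linarith
qed

text \<open>The arcs are separated by \<open>Re (1 / t) \<ge> 3 / 50\<close>. If this fails,
  \<open>Re (1 / t) = x / (norm t)^2\<close> makes \<open>pi / norm t \<le> w\<close>, which
  controls both the minor-arc exponent and \<open>theta_laurent\<close>.\<close>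

lemma arc_bound:
  assumes x: "0 < x" "x \<le> (21 / 400)" and t: "Re t = x" "\<bar>Im t\<bar> \<le> pi"
  defines "w \<equiv> sqrt (3 / 50 * (pi\<^sup>2 / x))"
  shows "norm (1 / theta (exp (- t)) - theta_laurent t)
    \<le> 5 + (7 / 100) * exp (pi\<^sup>2 / (4 * x) - 2 / x + w + 2) + exp w / 2"
proof (cases "Re (1 / t) \<ge> 3 / 50")
  case True
  have "norm t \<le> \<bar>Re t\<bar> + \<bar>Im t\<bar>" by (rule cmod_le)
  also have "\<dots> \<le> 4" using t x pi_less_4 pi_approx by simp
  finally have "sqrt (norm t) \<le> sqrt 4" by (rule real_sqrt_le_mono)
  then have "norm (1 / theta (exp (- t)) - theta_laurent t) \<le> 5"
    using major_arc_bound[of t] True t x by simp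
  moreover have "0 \<le> (7 / 100) * exp (pi\<^sup>2 / (4 * x) - 2 / x + w + 2)" "0 \<le> exp w / 2" by simp_all
  ultimately show ?thesis by linarith
next
  case False
  have t0: "t \<noteq> 0" using t x by auto
  have "Re (1 / t) = x / (norm t)\<^sup>2" using t t0 by (simp add: Re_divide cmod_power2)
  then have "x / (norm t)\<^sup>2 \<le> 3 / 50" using False by simp
  then have "x \<le> 3 / 50 * (norm t)\<^sup>2" using t0 by (simp add: divide_simps)
  then have "pi\<^sup>2 * x \<le> pi\<^sup>2 * (3 / 50 * (norm t)\<^sup>2)" by (intro mult_left_mono) auto
  then have "(pi / norm t)\<^sup>2 \<le> 3 / 50 * (pi\<^sup>2 / x)"
    using t0 x by (simp add: power_divide divide_simps mult_ac)
  then have pt: "pi / norm t \<le> w" unfolding w_def by (rule real_le_rsqrt)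
  have "pi\<^sup>2 / (4 * norm t) = pi / 4 * (pi / norm t)" by (simp add: power2_eq_square)
  also have "\<dots> \<le> 1 * (pi / norm t)" using pi_less_4 by (intro mult_right_mono) auto
  also have "\<dots> \<le> w" using pt by simp
  finally have "exp (pi\<^sup>2 / (4 * norm t)) \<le> exp w" by simp
  then have H: "norm (theta_laurent t) \<le> exp w / 2" using norm_theta_laurent_le[of t] by linarith
  have "x / pi \<le> (21 / 400) / 3" using x pi_gt3 by (intro frac_le) auto
  also have "\<dots> \<le> (7 / 50)\<^sup>2" by (simp add: power2_eq_square)
  finally have "sqrt (x / pi) \<le> (7 / 50)" by (intro real_le_lsqrt) auto
  then have s: "sqrt (x / pi) / 2 \<le> (7 / 100)" by simp
  have "norm (1 / theta (exp (- t))) \<le> sqrt (x / pi) / 2 * exp (pi\<^sup>2 / (4 * x) + pi / norm t - 2 / x + 2)"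
    using minor_arc_bound[of t] t x by simp
  also have "\<dots> \<le> (7 / 100) * exp (pi\<^sup>2 / (4 * x) - 2 / x + w + 2)"
    using s pt by (intro mult_mono) auto
  finally have "norm (1 / theta (exp (- t))) \<le> (7 / 100) * exp (pi\<^sup>2 / (4 * x) - 2 / x + w + 2)" .
  moreover have "norm (1 / theta (exp (- t)) - theta_laurent t) \<le> norm (1 / theta (exp (- t))) + norm (theta_laurent t)"
    by (rule norm_triangle_ineq4)
  ultimately show ?thesis using H by linarith
qed

lemma pi_sqrt_ge: "n \<ge> 898 \<Longrightarrow> pi * sqrt (real n) \<ge> 94"
proof -
  assume n: "n \<ge> 898"
  have "((749 / 25) :: real) \<le> sqrt (real n)" using n by (intro real_le_rsqrt) (simp add: power2_eq_square)
  then have "(157 / 50) * (749 / 25) \<le> pi * sqrt (real n)" using pi_approx by (intro mult_mono) auto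
  then show ?thesis by simp
qed

theorem overpart_asymptotic:
  assumes n: "n \<ge> 898"
  shows "\<bar>real (overpart n) - overpart_lead n\<bar> \<le> overpart_lead n / (50 * real n ^ 3)"
proof -
  define m where "m = pi * sqrt (real n)"
  \<comment> \<open>This is \<open>pi / (2 sqrt n)\<close>, the saddle point of
    \<open>n t + pi^2 / (4 t)\<close>; both summands equal \<open>m / 2\<close> there.\<close>
  define x where "x = pi\<^sup>2 / (2 * m)"
  have m: "m \<ge> 94" unfolding m_def by (rule pi_sqrt_ge[OF n])
  have m2: "m\<^sup>2 = pi\<^sup>2 * real n" unfolding m_def by (simp add: power_mult_distrib)
  have x: "x > 0" using m by (simp add: x_def)
  have xle: "x \<le> (21 / 400)"
  proof -
    have "x \<le> (987 / 100) / (2 * 94)" unfolding x_def using m pi_sq_bounds by (intro frac_le) auto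
    then show ?thesis by simp
  qed
  have nx: "real n * x = m / 2"
  proof -
    have "real n * x = (pi\<^sup>2 * real n) / (2 * m)" by (simp add: x_def)
    also have "\<dots> = m\<^sup>2 / (2 * m)" unfolding m2 ..
    also have "\<dots> = m / 2" using m by (simp add: power2_eq_square)
    finally show ?thesis .
  qed
  have px: "pi\<^sup>2 / x = 2 * m" "pi\<^sup>2 / (4 * x) = m / 2" using m by (simp_all add: x_def)
  have two_x: "2 / x = 4 / pi\<^sup>2 * m" using m by (simp add: x_def)
  have "((81 / 200) :: real) \<le> 4 / (987 / 100)" by simp
  also have "(4 :: real) / (987 / 100) \<le> 4 / pi\<^sup>2" using pi_sq_bounds by (intro divide_left_mono) auto
  finally have two_x': "2 / x \<ge> (81 / 200) * m" unfolding two_x using m by (intro mult_right_mono) auto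
  define w where "w = sqrt (3 / 50 * (pi\<^sup>2 / x))"
  \<comment> \<open>AM-GM linearises the square root; 1/50 is the share of the exponent spent on
    it.\<close>
  have w: "w \<le> m / 50 + (3 / 2)"
  proof -
    have "0 \<le> (m / 50 - (3 / 2))\<^sup>2" by simp
    then have "3 / 50 * (2 * m) \<le> (m / 50 + (3 / 2))\<^sup>2" by (simp add: power2_eq_square algebra_simps)
    then show ?thesis unfolding w_def px using m by (intro real_le_lsqrt) auto
  qed
  let ?B = "5 + (7 / 100) * exp (pi\<^sup>2 / (4 * x) - 2 / x + w + 2) + exp w / 2"
  have "\<bar>real (overpart n) - overpart_main n\<bar> \<le> exp (real n * x) * (?B + 12)"
  proof (rule overpart_minus_main)
    show "?B \<ge> 0" by (intro add_nonneg_nonneg mult_nonneg_nonneg) auto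
    show "norm (1 / theta (exp (- t)) - theta_laurent t) \<le> ?B" if "Re t = x" "\<bar>Im t\<bar> \<le> pi" for t
      unfolding w_def using x xle that by (rule arc_bound)
  qed (use x xle in auto)
  also have "\<dots> = 17 * exp (m / 2) + (7 / 100) * exp (m / 2 + (m / 2 - 2 / x + w + 2)) + exp (m / 2 + w) / 2"
    unfolding nx px(2) exp_add[of "m / 2"] by (simp add: algebra_simps)
  \<comment> \<open>The minor arc has the exponent \<open>1 - 81/200 + 1/50 = 123/200\<close> in
    \<open>m\<close>, with the constant \<open>3/2 + 2 = 7/2\<close>. The other two terms grow more
    slowly, and \<open>m \<ge> 94\<close> yields the shifts -10 and -5.\<close>
  also have "\<dots> \<le> 17 * exp ((123 / 200) * m - 10) + (7 / 100) * exp ((123 / 200) * m + (7 / 2)) + exp ((123 / 200) * m - 5) / 2"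
    using w two_x' m by (intro add_mono mult_left_mono divide_right_mono) auto
  also have "\<dots> = exp ((123 / 200) * m) * (17 * exp (- 10) + (7 / 100) * exp (7 / 2) + exp (- 5) / 2)"
    by (simp add: distrib_left mult_ac flip: exp_add)
  also have "\<dots> \<le> exp ((123 / 200) * m) * 3"
  proof (intro mult_left_mono)
    have e10: "exp (10 :: real) \<ge> 61" using exp_lower_Taylor_quadratic[of 10] by simp
    have e5: "exp (5 :: real) \<ge> 18" using exp_lower_Taylor_quadratic[of 5] by simp
    have "exp (7 / 2) ^ 2 = exp (1 :: real) ^ 7" by (simp flip: exp_of_nat_mult)
    also have "\<dots> \<le> (272 / 100) ^ 7" using e_less_272 by (intro power_mono) auto
    also have "\<dots> \<le> 34\<^sup>2" by (simp add: field_simps)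
    finally have "exp ((7 / 2) :: real) \<le> 34" by (rule power2_le_imp_le) simp
    moreover have "exp (- 10 :: real) \<le> 1 / 61" "exp (- 5 :: real) \<le> 1 / 18"
      unfolding exp_minus using e10 e5 by (simp_all add: field_simps)
    moreover have "17 * v + (7 / 100) * y + z / 2 \<le> 3" if "y \<le> 34" "v \<le> 1 / 61" "z \<le> 1 / 18" for v y z :: real
      using that by linarith
    ultimately show "17 * exp (- 10) + (7 / 100) * exp (7 / 2) + exp (- 5) / 2 \<le> (3 :: real)" by blast
  qed simp
  finally have 1: "\<bar>real (overpart n) - overpart_main n\<bar> \<le> 3 * exp ((123 / 200) * m)" by simp
  have n0: "real n > 0" using n by simp
  have pin: "pi\<^sup>2 / (4 * m\<^sup>2) = 1 / (4 * real n)" unfolding m2 by simp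
  have "n > 0" using n by simp
  from overpart_main_eq[OF this, folded m_def]
  have "overpart_main n = 1 / (4 * real n) * (cosh m - sinh m / m)" unfolding pin .
  also have "cosh m - sinh m / m = (exp m * (1 - 1 / m) + exp (- m) * (1 + 1 / m)) / 2"
    by (simp add: cosh_field_def sinh_field_def algebra_simps add_divide_distrib diff_divide_distrib)
  finally have "overpart_main n - overpart_lead n = exp (- m) * (1 + 1 / m) / (8 * real n)"
    using n0 by (simp add: overpart_lead_def m_def[symmetric] field_simps)
  moreover have "exp (- m) * (1 + 1 / m) / (8 * real n) \<le> 1 * 2 / 8"
    using m n by (intro frac_le mult_mono) auto
  moreover have "exp (- m) * (1 + 1 / m) / (8 * real n) \<ge> 0" using m by simp
  ultimately have "\<bar>overpart_main n - overpart_lead n\<bar> \<le> 1" by linarith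
  moreover have "1 \<le> exp ((123 / 200) * m)" using m by simp
  ultimately have "\<bar>real (overpart n) - overpart_lead n\<bar> \<le> 4 * exp ((123 / 200) * m)"
    using 1 by linarith
  also have "\<dots> \<le> overpart_lead n / (50 * real n ^ 3)"
  proof -
    have "50 * 8 * real n ^ 4 * 4 * (pi\<^sup>2) ^ 4 = 1600 * m ^ 8"
    proof -
      have "m ^ 8 = (m\<^sup>2) ^ 4" by simp
      then show ?thesis unfolding m2 by (simp add: power_mult_distrib)
    qed
    also have "\<dots> \<le> 1600 * ((57 / 10) * exp ((77 / 200) * m))" by (intro mult_left_mono exp_dominates_power8 m) auto
    also have "\<dots> \<le> ((49 / 5) ^ 4 * (1 - 1 / 94)) * exp ((77 / 200) * m)" by (simp add: field_simps)
    also have "\<dots> \<le> ((pi\<^sup>2) ^ 4 * (1 - 1 / m)) * exp ((77 / 200) * m)"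
      using m pi_sq_bounds by (intro mult_right_mono mult_mono power_mono) (auto simp: field_simps)
    finally have "(50 * 8 * real n ^ 4 * 4) * (pi\<^sup>2) ^ 4 \<le> ((1 - 1 / m) * exp ((77 / 200) * m)) * (pi\<^sup>2) ^ 4"
      by (simp only: mult_ac)
    then have "50 * 8 * real n ^ 4 * 4 \<le> (1 - 1 / m) * exp ((77 / 200) * m)"
      by (rule mult_right_le_imp_le) simp
    then have "50 * 8 * real n ^ 4 * 4 * exp ((123 / 200) * m) \<le> (1 - 1 / m) * exp ((77 / 200) * m) * exp ((123 / 200) * m)"
      by (intro mult_right_mono) auto
    also have "\<dots> = exp m * (1 - 1 / m)" by (simp add: mult_ac flip: exp_add)
    finally have "4 * exp ((123 / 200) * m) * (8 * real n * (50 * real n ^ 3)) \<le> exp m * (1 - 1 / m)"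
      by (simp add: power_numeral_reduce mult_ac)
    then have "4 * exp ((123 / 200) * m) \<le> exp m * (1 - 1 / m) / (8 * real n * (50 * real n ^ 3))"
      using n0 by (subst pos_le_divide_eq) auto
    then show ?thesis unfolding overpart_lead_def m_def[symmetric] by simp
  qed
  finally show ?thesis .
qed

section \<open>Taylor bounds for square roots at adjacent integers\<close>

text \<open>By \<open>S^2 = 2 + 2 c\<close> the bounds of \<open>S\<close> reduce to those of
  \<open>c\<close>. The Taylor expansions are \<open>c = 1 - h/2 - h^2/8 - h^3/16 - ...\<close> and
  \<open>S = 2 - h/4 - 5 h^2/64 - ...\<close>; in the lower bounds the last coefficient is enlarged
  to 1/8 and 1/10 to swallow the tails.\<close>

lemma sqrt_pair_bounds:
  fixes t :: real assumes t: "0 \<le> t" "t \<le> 1 / 30"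
  defines "h \<equiv> t\<^sup>2" and "c \<equiv> sqrt (1 - t\<^sup>2)" and "S \<equiv> sqrt (1 + t) + sqrt (1 - t)"
  shows "1 - h / 2 - h\<^sup>2 / 8 - h ^ 3 / 8 \<le> c" "c \<le> 1 - h / 2 - h\<^sup>2 / 8"
    and "2 - h / 4 - h\<^sup>2 / 10 \<le> S" "S \<le> 2 - h / 4 - 5 * h\<^sup>2 / 64" and "h \<le> 1 / 900"
proof -
  have h0: "0 \<le> h" by (simp add: h_def)
  have "t\<^sup>2 \<le> (1 / 30)\<^sup>2" using t by (intro power_mono) auto
  then show h1: "h \<le> 1 / 900" by (simp add: h_def power2_eq_square)
  have hk: "h ^ Suc k \<le> h ^ k / 900" for k
    using mult_left_mono[OF h1, of "h ^ k"] h0 by (simp add: mult.commute)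
  have hs: "h\<^sup>2 \<le> h / 900" "h ^ 3 \<le> h\<^sup>2 / 900" "h ^ 4 \<le> h ^ 3 / 900" "h ^ 5 \<le> h ^ 4 / 900" "h ^ 6 \<le> h ^ 5 / 900"
    using hk[of 1] hk[of 2] hk[of 3] hk[of 4] hk[of 5] by (simp_all add: numeral_eq_Suc)
  have hp: "0 \<le> h\<^sup>2" "0 \<le> h ^ 3" "0 \<le> h ^ 4" "0 \<le> h ^ 5" "0 \<le> h ^ 6" using h0 by simp_all
  have c2: "c = sqrt (1 - h)" by (simp add: c_def h_def)
  show cl: "1 - h / 2 - h\<^sup>2 / 8 - h ^ 3 / 8 \<le> c"
    unfolding c2
  proof (rule real_le_rsqrt)
    have "(1 - h / 2 - h\<^sup>2 / 8 - h ^ 3 / 8)\<^sup>2 = 1 - h - h ^ 3 / 8 + 9 * h ^ 4 / 64 + h ^ 5 / 32 + h ^ 6 / 64"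
      by (simp add: power2_eq_square algebra_simps power_numeral_reduce)
    also have "\<dots> \<le> 1 - h" using hs hp by argo
    finally show "(1 - h / 2 - h\<^sup>2 / 8 - h ^ 3 / 8)\<^sup>2 \<le> 1 - h" .
  qed
  show cu: "c \<le> 1 - h / 2 - h\<^sup>2 / 8"
    unfolding c2
  proof (rule real_le_lsqrt)
    have "(1 - h / 2 - h\<^sup>2 / 8)\<^sup>2 = 1 - h + h ^ 3 / 8 + h ^ 4 / 64"
      by (simp add: power2_eq_square algebra_simps power_numeral_reduce)
    then show "1 - h \<le> (1 - h / 2 - h\<^sup>2 / 8)\<^sup>2" using hp by argo
    show "0 \<le> 1 - h / 2 - h\<^sup>2 / 8" using hs h1 by linarith
  qed
  have S2: "S\<^sup>2 = 2 + 2 * c"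
  proof -
    have "sqrt (1 + t) * sqrt (1 - t) = c"
      by (simp add: c_def power2_eq_square algebra_simps flip: real_sqrt_mult)
    then show ?thesis using t by (simp add: S_def power2_sum)
  qed
  have S0: "S \<ge> 0" using t by (simp add: S_def)
  show "2 - h / 4 - h\<^sup>2 / 10 \<le> S"
  proof (rule power2_le_imp_le[OF _ S0])
    have "(2 - h / 4 - h\<^sup>2 / 10)\<^sup>2 = 4 - h - 27 / 80 * h\<^sup>2 + h ^ 3 / 20 + h ^ 4 / 100"
      by (simp add: power2_eq_square algebra_simps power_numeral_reduce)
    also have "\<dots> \<le> 2 + 2 * (1 - h / 2 - h\<^sup>2 / 8 - h ^ 3 / 8)" using hs(2,3) hp(1) by argo
    also have "\<dots> \<le> S\<^sup>2" unfolding S2 using cl by argo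
    finally show "(2 - h / 4 - h\<^sup>2 / 10)\<^sup>2 \<le> S\<^sup>2" .
  qed
  show "S \<le> 2 - h / 4 - 5 * h\<^sup>2 / 64"
  proof (rule power2_le_imp_le)
    have "(2 - h / 4 - 5 * h\<^sup>2 / 64)\<^sup>2 = 4 - h - h\<^sup>2 / 4 + 5 * h ^ 3 / 128 + 25 * h ^ 4 / 4096"
      by (simp add: power2_eq_square algebra_simps power_numeral_reduce)
    moreover have "S\<^sup>2 \<le> 2 + 2 * (1 - h / 2 - h\<^sup>2 / 8)" unfolding S2 using cu by argo
    ultimately show "S\<^sup>2 \<le> (2 - h / 4 - 5 * h\<^sup>2 / 64)\<^sup>2" using hp by argo
    show "0 \<le> 2 - h / 4 - 5 * h\<^sup>2 / 64" using hs h1 by linarith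
  qed
qed

text \<open>Here \<open>A = S / c\<close> and \<open>P = 1 / c\<close> in the notation of
  \<open>sqrt_pair_bounds\<close>, so multiplying by \<open>c\<close> leaves polynomial
  inequalities.\<close>

lemma rsqrt_pair_bounds:
  fixes t :: real assumes t: "0 \<le> t" "t \<le> 1 / 30"
  defines "h \<equiv> t\<^sup>2" and "A \<equiv> 1 / sqrt (1 - t) + 1 / sqrt (1 + t)" and "P \<equiv> 1 / (sqrt (1 - t) * sqrt (1 + t))"
  shows "2 + 3 / 4 * h \<le> A" "A \<le> 2 + 3 / 4 * h + h\<^sup>2"
    and "1 + h / 2 \<le> P" "P \<le> 1 + 501 / 1000 * h"
proof -
  define c where "c = sqrt (1 - t\<^sup>2)"
  define S where "S = sqrt (1 + t) + sqrt (1 - t)"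
  note b = sqrt_pair_bounds[OF t, folded c_def S_def h_def]
  have h0: "0 \<le> h" by (simp add: h_def)
  note h1 = b(5)
  have hk: "h ^ Suc k \<le> h ^ k / 900" for k
    using mult_left_mono[OF h1, of "h ^ k"] h0 by (simp add: mult.commute)
  have hs: "h\<^sup>2 \<le> h / 900" "h ^ 3 \<le> h\<^sup>2 / 900" "h ^ 4 \<le> h ^ 3 / 900" "h ^ 5 \<le> h ^ 4 / 900"
    using hk[of 1] hk[of 2] hk[of 3] hk[of 4] by (simp_all add: numeral_eq_Suc)
  have hp: "0 \<le> h\<^sup>2" "0 \<le> h ^ 3" "0 \<le> h ^ 4" "0 \<le> h ^ 5" using h0 by simp_all
  have cs: "sqrt (1 - t) * sqrt (1 + t) = c"
    by (simp add: c_def power2_eq_square algebra_simps flip: real_sqrt_mult)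
  have c0: "c > 0" using b(1) hs h1 by linarith
  have "sqrt (1 - t) > 0" "sqrt (1 + t) > 0" using t by auto
  then have A: "A = S / c" unfolding A_def S_def cs[symmetric] by (simp add: field_simps)
  have P: "P = 1 / c" by (simp add: P_def cs)
  show "2 + 3 / 4 * h \<le> A" unfolding A
  proof (subst pos_le_divide_eq[OF c0])
    have "(2 + 3 / 4 * h) * c \<le> (2 + 3 / 4 * h) * (1 - h / 2 - h\<^sup>2 / 8)"
      using b(2) h0 by (intro mult_left_mono) auto
    also have "\<dots> = 2 - h / 4 - 5 / 8 * h\<^sup>2 - 3 / 32 * h ^ 3"
      by (simp add: power2_eq_square algebra_simps power_numeral_reduce)
    also have "\<dots> \<le> S" using b(3) hp by argo
    finally show "(2 + 3 / 4 * h) * c \<le> S" .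
  qed
  show "A \<le> 2 + 3 / 4 * h + h\<^sup>2" unfolding A
  proof (subst pos_divide_le_eq[OF c0])
    have "S \<le> 2 - h / 4 + 3 / 8 * h\<^sup>2 - 27 / 32 * h ^ 3 - 7 / 32 * h ^ 4 - h ^ 5 / 8"
      using b(4) hp hs by argo
    also have "\<dots> = (2 + 3 / 4 * h + h\<^sup>2) * (1 - h / 2 - h\<^sup>2 / 8 - h ^ 3 / 8)"
      by (simp add: power2_eq_square algebra_simps power_numeral_reduce)
    also have "\<dots> \<le> (2 + 3 / 4 * h + h\<^sup>2) * c"
      using b(1) h0 by (intro mult_left_mono) auto
    finally show "S \<le> (2 + 3 / 4 * h + h\<^sup>2) * c" .
  qed
  show "1 + h / 2 \<le> P" unfolding P
  proof (subst pos_le_divide_eq[OF c0])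
    have "(1 + h / 2) * c \<le> (1 + h / 2) * (1 - h / 2 - h\<^sup>2 / 8)" using b(2) h0 by (intro mult_left_mono) auto
    also have "\<dots> = 1 - 3 / 8 * h\<^sup>2 - h ^ 3 / 16" by (simp add: power2_eq_square algebra_simps power_numeral_reduce)
    also have "\<dots> \<le> 1" using hp by argo
    finally show "(1 + h / 2) * c \<le> 1" .
  qed
  show "P \<le> 1 + 501 / 1000 * h" unfolding P
  proof (subst pos_divide_le_eq[OF c0])
    have "1 \<le> 1 + h / 1000 - 751 / 2000 * h\<^sup>2 - 1501 / 8000 * h ^ 3 - 501 / 8000 * h ^ 4"
      using hp hs h0 by argo
    also have "\<dots> = (1 + 501 / 1000 * h) * (1 - h / 2 - h\<^sup>2 / 8 - h ^ 3 / 8)"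
      by (simp add: power2_eq_square algebra_simps power_numeral_reduce)
    also have "\<dots> \<le> (1 + 501 / 1000 * h) * c" using b(1) h0 by (intro mult_left_mono) auto
    finally show "1 \<le> (1 + 501 / 1000 * h) * c" .
  qed
qed

section \<open>Bounds for g and for the ratios u\<close>

text \<open>Expansion of \<open>1 / g - 1\<close> in powers of \<open>m^(-1/2)\<close>:
  \<open>pi/4\<close>, \<open>-1\<close> and \<open>3/(4 pi)\<close> are exact, 402/1000 is just
  below \<open>pi^2/32 + 1/pi^2 - 4/pi^6\<close>, and -51/100 is rounded down too. The rounding pays
  for all higher terms from \<open>m = 30\<close> on.\<close>

definition ell :: "real \<Rightarrow> real" where
  "ell m = (let t = 1 / m; r = 1 / sqrt m in
     r * (pi / 4 * t + 3 / (4 * pi) * t\<^sup>2 - 51 / 100 * t ^ 3) - t\<^sup>2 + 402 / 1000 * t ^ 3)"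

lemma sqrt_succ_pred:
  assumes m: "m \<ge> (30 :: real)"
  shows "sqrt (m + 1) = sqrt m * sqrt (1 + 1 / m)" "sqrt (m - 1) = sqrt m * sqrt (1 - 1 / m)"
  using m by (simp_all add: field_simps flip: real_sqrt_mult)

text \<open>\<open>e\<close> is minus the second difference of \<open>pi sqrt\<close>, that is
  \<open>pi sqrt m (2 - S)\<close> with \<open>S\<close> as in \<open>sqrt_pair_bounds\<close>;
  moreover \<open>sqrt m * t^2 = r t\<close>.\<close>

lemma exponent_bounds:
  assumes m: "m \<ge> (30 :: real)"
  defines "t \<equiv> 1 / m" and "r \<equiv> 1 / sqrt m"
    and "e \<equiv> 2 * (pi * sqrt m) - pi * sqrt (m - 1) - pi * sqrt (m + 1)"
  shows "pi / 4 * (r * t) + 5 * pi / 64 * (r * t ^ 3) \<le> e" "e \<le> pi / 4 * (r * t) + pi / 10 * (r * t ^ 3)"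
proof -
  have t: "0 \<le> t" "t \<le> 1 / 30" using m by (auto simp: t_def intro!: divide_left_mono)
  let ?S = "sqrt (1 + t) + sqrt (1 - t)"
  have sm: "sqrt m * t\<^sup>2 = r * t"
    using m by (simp add: r_def t_def power2_eq_square field_simps)
  have e: "e = pi * (sqrt m * (2 - ?S))"
    unfolding e_def sqrt_succ_pred[OF m] t_def by (simp add: algebra_simps)
  have "pi * (sqrt m * (t\<^sup>2 / 4 + 5 * (t\<^sup>2)\<^sup>2 / 64)) \<le> e"
    unfolding e using sqrt_pair_bounds(4)[OF t] m by (intro mult_left_mono) auto
  also have "pi * (sqrt m * (t\<^sup>2 / 4 + 5 * (t\<^sup>2)\<^sup>2 / 64)) = pi / 4 * (sqrt m * t\<^sup>2) + 5 * pi / 64 * (sqrt m * t\<^sup>2 * t\<^sup>2)"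
    by (simp add: power2_eq_square algebra_simps)
  finally show "pi / 4 * (r * t) + 5 * pi / 64 * (r * t ^ 3) \<le> e"
    unfolding sm by (simp add: power_numeral_reduce power2_eq_square mult_ac)
  have "e \<le> pi * (sqrt m * (t\<^sup>2 / 4 + (t\<^sup>2)\<^sup>2 / 10))"
    unfolding e using sqrt_pair_bounds(3)[OF t] m by (intro mult_left_mono) auto
  also have "pi * (sqrt m * (t\<^sup>2 / 4 + (t\<^sup>2)\<^sup>2 / 10)) = pi / 4 * (sqrt m * t\<^sup>2) + pi / 10 * (sqrt m * t\<^sup>2 * t\<^sup>2)"
    by (simp add: power2_eq_square algebra_simps)
  finally show "e \<le> pi / 4 * (r * t) + pi / 10 * (r * t ^ 3)"
    unfolding sm by (simp add: power_numeral_reduce power2_eq_square mult_ac)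
qed

text \<open>The polynomial inequality behind the lower bound of the rational factor of \<open>1 / g\<close>;
  here \<open>w = 1 / y\<close>, \<open>h = 1 / n\<^sup>2\<close> and \<open>e = w\<^sup>6\<close>.\<close>
lemma rational_factor_poly:
  fixes w h e :: real
  assumes w: "0 \<le> w" "w \<le> 59 / 1000" and h: "0 \<le> h" "h \<le> 1 / 900" and e: "0 \<le> e" "e \<le> 1 / 10 ^ 6"
  defines "Y \<equiv> h * (3 / 4 * w + 999 / 1000 * w\<^sup>2 + 116 / 100 * w ^ 3) - 46 / 10 * e"
  shows "((1 - w)\<^sup>2 - h * (3 / 4 * w - 501 / 1000 * w\<^sup>2) + 202 / 100 * e) * (1 + Y) \<le> (1 - w)\<^sup>2 - 2 * e"
proof -
  define V where "V = h * (3 / 4 * w + 999 / 1000 * w\<^sup>2 + 116 / 100 * w ^ 3)"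
  define X where "X = h * (3 / 4 * w - 501 / 1000 * w\<^sup>2)"
  define d where "d = (1 - w)\<^sup>2"
  have w2: "0 \<le> w\<^sup>2" "w\<^sup>2 \<le> w * (59 / 1000)" using mult_left_mono[OF w(2) w(1)] by (simp_all add: power2_eq_square)
  have w3: "0 \<le> w ^ 3" "w ^ 3 \<le> w\<^sup>2 * (59 / 1000)" using w mult_left_mono[OF w(2) w2(1)] by (simp_all add: power_numeral_reduce power2_eq_square mult_ac)
  have w4: "0 \<le> w ^ 4" "w ^ 5 \<le> w ^ 4 * (59 / 1000)" using w mult_left_mono[OF w(2), of "w ^ 4"] by (simp_all add: power_numeral_reduce mult_ac)
  \<comment> \<open>The coefficients are tuned to each other:
    \<open>999/1000 - 3/2 + 501/1000 = 0\<close> removes the \<open>w^2\<close> term, and the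
    negative cubic term decides.\<close>
  have "V * d - X = h * (- (88 / 1000) * w ^ 3 - 1321 / 1000 * w ^ 4 + 116 / 100 * w ^ 5)"
    unfolding V_def d_def X_def by (simp add: power2_eq_square power_numeral_reduce field_simps)
  also have "\<dots> \<le> h * 0" using h w3 w4 by (intro mult_left_mono) linarith+
  finally have vd: "V * d \<le> X" by simp
  have "h * (3 / 4 * w - 501 / 1000 * w\<^sup>2) \<le> 1 / 900 * (45 / 1000)"
    using h w w2 by (intro mult_mono) linarith+
  then have X: "X \<le> 1 / 20000" unfolding X_def by simp
  have X0: "0 \<le> X" unfolding X_def using h w w2 by (intro mult_nonneg_nonneg) linarith+
  have "h * (3 / 4 * w + 999 / 1000 * w\<^sup>2 + 116 / 100 * w ^ 3) \<le> 1 / 900 * (48 / 1000 + 1 / 1000)"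
    using h w w2 w3 by (intro mult_mono add_nonneg_nonneg) linarith+
  then have V: "V \<le> 1 / 10000" unfolding V_def by simp
  have V0: "0 \<le> V" unfolding V_def using h w w2 w3 by (intro mult_nonneg_nonneg add_nonneg_nonneg) linarith+
  have d: "d \<ge> 1 - 2 * (59 / 1000)"
  proof -
    have "d = 1 - 2 * w + w\<^sup>2" unfolding d_def by (simp add: power2_eq_square algebra_simps)
    then show ?thesis using w w2 by argo
  qed
  have "(d - X + 202 / 100 * e) * (1 + (V - 46 / 10 * e))
    = d + (V * d - X) + (202 / 100 - 46 / 10 * d) * e + 46 / 10 * (e * X) - V * X + 202 / 100 * (e * V) - 202 / 100 * (46 / 10) * (e * e)"
    by (simp add: field_simps)
  also have "\<dots> \<le> d + 0 + (202 / 100 - 46 / 10 * (1 - 2 * (59 / 1000))) * e + 46 / 10 * (e * (1 / 20000)) - 0 + 202 / 100 * (e * (1 / 10000)) - 0"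
    using vd d X V e V0 X0 by (intro diff_mono add_mono mult_left_mono mult_right_mono) auto
  also have "\<dots> \<le> d - 2 * e" using e by simp
  finally show ?thesis unfolding Y_def V_def d_def X_def by simp
qed

lemma w_bounds:
  assumes m: "m \<ge> (30 :: real)"
  shows "0 < 1 / (pi * sqrt m)" "1 / (pi * sqrt m) \<le> 59 / 1000"
proof -
  show "0 < 1 / (pi * sqrt m)" using m by simp
  have "(547 / 100 :: real) \<le> sqrt m" using m by (intro real_le_rsqrt) (simp add: power2_eq_square)
  then have "157 / 50 * (547 / 100) \<le> pi * sqrt m" using pi_approx by (intro mult_mono) auto
  then show "1 / (pi * sqrt m) \<le> 59 / 1000" using m by (simp add: field_simps)
qed

text \<open>Taking out \<open>x^6\<close>, \<open>y^6\<close> and \<open>z^6\<close> leaves factors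
  close to 1; the remaining powers combine to \<open>x^2 z^2 / y^4 = 1 - 1 / m^2\<close>.\<close>

lemma g_alt:
  assumes n: "n \<ge> 30"
  defines "m \<equiv> real n"
  defines "w \<equiv> 1 / (pi * sqrt m)" and "a \<equiv> 1 / (pi * sqrt (m - 1))" and "b \<equiv> 1 / (pi * sqrt (m + 1))"
  defines "Q \<equiv> (1 - a + a ^ 6) * (1 - b + b ^ 6)"
  shows "g n = Q / (exp (2 * (pi * sqrt m) - pi * sqrt (m - 1) - pi * sqrt (m + 1)) * (1 - (1 / m)\<^sup>2) * (1 - w - w ^ 6)\<^sup>2)"
proof -
  define x y z where "x = pi * sqrt (m - 1)" and "y = pi * sqrt m" and "z = pi * sqrt (m + 1)"
  have m: "m \<ge> 30" using n by (simp add: m_def)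
  have pos: "x > 0" "y > 0" "z > 0" using m by (auto simp: x_def y_def z_def)
  have abc: "a = 1 / x" "w = 1 / y" "b = 1 / z" by (simp_all add: a_def w_def b_def x_def y_def z_def)
  have sq: "x\<^sup>2 = pi\<^sup>2 * (m - 1)" "y\<^sup>2 = pi\<^sup>2 * m" "z\<^sup>2 = pi\<^sup>2 * (m + 1)"
    using m by (simp_all add: x_def y_def z_def power_mult_distrib)
  have x6: "x ^ 6 - x ^ 5 + 1 = x ^ 6 * (1 - a + a ^ 6)" and z6: "z ^ 6 - z ^ 5 + 1 = z ^ 6 * (1 - b + b ^ 6)"
    and y6: "y ^ 6 - y ^ 5 - 1 = y ^ 6 * (1 - w - w ^ 6)"
    unfolding abc using pos by (simp_all add: power_divide right_diff_distrib distrib_left power_numeral_reduce)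
  have h: "1 - (1 / m)\<^sup>2 = x\<^sup>2 * z\<^sup>2 / (y\<^sup>2 * y\<^sup>2)"
    unfolding sq using m by (simp add: power2_eq_square field_simps)
  have ex: "exp (x - 2 * y + z) = 1 / exp (2 * y - x - z)"
    by (simp add: exp_diff exp_add)
  have "g n = exp (x - 2 * y + z) * ((x ^ 6 - x ^ 5 + 1) * y ^ 16 * (z ^ 6 - z ^ 5 + 1)) / (x ^ 8 * (y ^ 6 - y ^ 5 - 1)\<^sup>2 * z ^ 8)"
    by (simp add: g_def Let_def x_def y_def z_def m_def)
  also have "\<dots> = 1 / exp (2 * y - x - z) * ((x ^ 6 * (1 - a + a ^ 6)) * y ^ 16 * (z ^ 6 * (1 - b + b ^ 6))) / (x ^ 8 * (y ^ 6 * (1 - w - w ^ 6))\<^sup>2 * z ^ 8)"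
    unfolding ex x6 y6 z6 ..
  also have "\<dots> = ((1 - a + a ^ 6) * (1 - b + b ^ 6)) / (exp (2 * y - x - z) * (x\<^sup>2 * z\<^sup>2 / (y\<^sup>2 * y\<^sup>2)) * (1 - w - w ^ 6)\<^sup>2)"
  proof -
    have p: "x ^ 8 = x ^ 6 * x\<^sup>2" "z ^ 8 = z ^ 6 * z\<^sup>2" "y ^ 16 = (y ^ 6 * y ^ 6) * (y\<^sup>2 * y\<^sup>2)"
      by (simp_all flip: power_add)
    have "1 / E * (X * A * (Y * Y * YY) * (Z * B)) / (X * X2 * (Y * W)\<^sup>2 * (Z * Z2)) = (A * B) / (E * (X2 * Z2 / YY) * W\<^sup>2)"
      if "E \<noteq> 0" "X \<noteq> 0" "Y \<noteq> 0" "Z \<noteq> 0" "YY \<noteq> 0" "X2 \<noteq> 0" "Z2 \<noteq> 0" for E X A Y YY Z B X2 Z2 W :: real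
      using that by (simp add: power2_eq_square divide_simps)
    from this[of "exp (2 * y - x - z)" "x ^ 6" "y ^ 6" "z ^ 6" "y\<^sup>2 * y\<^sup>2" "x\<^sup>2" "z\<^sup>2"] show ?thesis
      unfolding p using pos by simp
  qed
  also have "x\<^sup>2 * z\<^sup>2 / (y\<^sup>2 * y\<^sup>2) = 1 - (1 / m)\<^sup>2" by (rule h[symmetric])
  finally show ?thesis by (simp only: x_def y_def z_def Q_def)
qed

lemma reciprocal_pair:
  assumes m: "m \<ge> (30 :: real)"
  defines "t \<equiv> 1 / m" and "w \<equiv> 1 / (pi * sqrt m)"
    and "a \<equiv> 1 / (pi * sqrt (m - 1))" and "b \<equiv> 1 / (pi * sqrt (m + 1))"
  shows "a + b = w * (1 / sqrt (1 - t) + 1 / sqrt (1 + t))"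
    and "a * b = w\<^sup>2 * (1 / (sqrt (1 - t) * sqrt (1 + t)))"
    and "a ^ 6 = w ^ 6 / (1 - t) ^ 3" and "b ^ 6 = w ^ 6 / (1 + t) ^ 3"
    and "0 < a" "a < 1" "0 < b" "b < 1"
proof -
  have t: "0 \<le> t" "t \<le> 1 / 30" using m by (auto simp: t_def intro!: divide_left_mono)
  have a: "a = w / sqrt (1 - t)" and b: "b = w / sqrt (1 + t)"
    unfolding a_def b_def w_def sqrt_succ_pred[OF m] t_def by simp_all
  show "a + b = w * (1 / sqrt (1 - t) + 1 / sqrt (1 + t))" unfolding a b by (simp add: distrib_left)
  show "a * b = w\<^sup>2 * (1 / (sqrt (1 - t) * sqrt (1 + t)))" unfolding a b by (simp add: power2_eq_square)
  have s6: "sqrt x ^ 6 = x ^ 3" if "x \<ge> 0" for x :: real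
  proof -
    have "sqrt x ^ 6 = (sqrt x ^ 2) ^ 3" by (simp flip: power_mult)
    then show ?thesis using that by simp
  qed
  show "a ^ 6 = w ^ 6 / (1 - t) ^ 3" "b ^ 6 = w ^ 6 / (1 + t) ^ 3"
    unfolding a b power_divide using t by (simp_all add: s6)
  have "1 < pi * sqrt (m - 1)" "1 < pi * sqrt (m + 1)"
    by (rule less_1_mult; use pi_gt3 m in simp)+
  then show "0 < a" "a < 1" "0 < b" "b < 1" unfolding a_def b_def by simp_all
qed

lemma cube_pair_le:
  fixes t :: real assumes t: "0 \<le> t" "t \<le> 1 / 30"
  shows "1 / (1 - t) ^ 3 + 1 / (1 + t) ^ 3 \<le> 202 / 100"
proof -
  define h where "h = t\<^sup>2"
  have h: "0 \<le> h" "h \<le> 1 / 900" using sqrt_pair_bounds(5)[OF t] by (simp_all add: h_def)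
  have h3: "1 - 3 * h \<le> (1 - h) ^ 3"
  proof -
    have "(1 - h) ^ 3 = 1 - 3 * h + h\<^sup>2 * (3 - h)" by (simp add: power2_eq_square power_numeral_reduce algebra_simps)
    moreover have "0 \<le> h\<^sup>2 * (3 - h)" using h by simp
    ultimately show ?thesis by simp
  qed
  have pos: "(1 - t) ^ 3 > 0" "(1 + t) ^ 3 > 0" using t by simp_all
  have "1 / (1 - t) ^ 3 + 1 / (1 + t) ^ 3 = ((1 + t) ^ 3 + (1 - t) ^ 3) / ((1 - t) ^ 3 * (1 + t) ^ 3)"
    using pos by (simp add: add_frac_eq)
  also have "(1 - t) ^ 3 * (1 + t) ^ 3 = (1 - h) ^ 3"
    by (simp add: h_def power2_eq_square algebra_simps flip: power_mult_distrib)
  also have "(1 + t) ^ 3 + (1 - t) ^ 3 = 2 + 6 * h"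
    by (simp add: h_def power2_eq_square power_numeral_reduce algebra_simps)
  also have "(2 + 6 * h) / (1 - h) ^ 3 \<le> 202 / 100"
  proof (subst pos_divide_le_eq)
    show "0 < (1 - h) ^ 3" using h by simp
    have "2 + 6 * h \<le> 202 / 100 * (1 - 3 * h)" using h by (simp add: field_simps)
    also have "\<dots> \<le> 202 / 100 * (1 - h) ^ 3" using h3 by (intro mult_left_mono) auto
    finally show "2 + 6 * h \<le> 202 / 100 * (1 - h) ^ 3" .
  qed
  finally show ?thesis .
qed

text \<open>Compares the coefficients of \<open>t^3\<close> and \<open>r t^3\<close>; here numerical
  bounds for pi certify the roundings 402/1000 and -51/100.\<close>

lemma ell_le_poly:
  fixes r t :: real
  assumes r: "0 < r" and t: "0 < t" "t \<le> 1 / 30"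
  shows "r * (pi / 4 * t + 3 / (4 * pi) * t\<^sup>2 - 51 / 100 * t ^ 3) - t\<^sup>2 + 402 / 1000 * t ^ 3
    \<le> (pi / 4 * (r * t) + 5 * pi / 64 * (r * t ^ 3) + pi\<^sup>2 / 32 * t ^ 3 - t\<^sup>2 - 79 / 100 * (r * t ^ 3))
      + (3 / 4 / pi * (r * t\<^sup>2) + 999 / 1000 / pi\<^sup>2 * t ^ 3 + 116 / 100 / pi ^ 3 * (r * t ^ 3) - 46 / 10 / pi ^ 6 * t ^ 3)"
proof -
  have p2: "98 / 10 \<le> pi\<^sup>2" "pi\<^sup>2 \<le> 987 / 100" using pi_sq_bounds by simp_all
  have p3: "pi ^ 3 \<le> 32"
  proof -
    have "pi ^ 3 \<le> (22 / 7) ^ 3" using pi_approx by (intro power_mono) auto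
    then show ?thesis by (simp add: power_divide)
  qed
  have p6: "941 \<le> pi ^ 6"
  proof -
    have "(98 / 10) ^ 3 \<le> (pi\<^sup>2) ^ 3" using p2 by (intro power_mono) auto
    then show ?thesis by (simp add: power_divide flip: power_mult)
  qed
  have "999 / 1000 / (987 / 100) \<le> 999 / 1000 / pi\<^sup>2" using p2 by (intro divide_left_mono) auto
  moreover have "46 / 10 / pi ^ 6 \<le> 46 / 10 / 941" using p6 by (intro divide_left_mono) auto
  moreover have "98 / 10 / 32 \<le> pi\<^sup>2 / 32" using p2 by simp
  ultimately have c3: "402 / 1000 \<le> pi\<^sup>2 / 32 + 999 / 1000 / pi\<^sup>2 - 46 / 10 / pi ^ 6" by argo
  have "116 / 100 / 32 \<le> 116 / 100 / pi ^ 3" using p3 by (intro divide_left_mono) auto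
  moreover have "245 / 1000 \<le> 5 * pi / 64" using pi_approx by simp
  ultimately have c4: "- (51 / 100) \<le> 5 * pi / 64 - 79 / 100 + 116 / 100 / pi ^ 3" by argo
  have "402 / 1000 * t ^ 3 \<le> (pi\<^sup>2 / 32 + 999 / 1000 / pi\<^sup>2 - 46 / 10 / pi ^ 6) * t ^ 3"
    using c3 t by (intro mult_right_mono) auto
  moreover have "- (51 / 100) * (r * t ^ 3) \<le> (5 * pi / 64 - 79 / 100 + 116 / 100 / pi ^ 3) * (r * t ^ 3)"
    using c4 r t by (intro mult_right_mono) auto
  moreover have "r * (pi / 4 * t + 3 / (4 * pi) * t\<^sup>2 - 51 / 100 * t ^ 3)
    = pi / 4 * (r * t) + 3 / 4 / pi * (r * t\<^sup>2) + - (51 / 100) * (r * t ^ 3)"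
    by (simp add: algebra_simps)
  moreover have "(pi\<^sup>2 / 32 + 999 / 1000 / pi\<^sup>2 - 46 / 10 / pi ^ 6) * t ^ 3
    = pi\<^sup>2 / 32 * t ^ 3 + 999 / 1000 / pi\<^sup>2 * t ^ 3 - 46 / 10 / pi ^ 6 * t ^ 3"
    by (simp only: distrib_right left_diff_distrib)
  moreover have "(5 * pi / 64 - 79 / 100 + 116 / 100 / pi ^ 3) * (r * t ^ 3)
    = 5 * pi / 64 * (r * t ^ 3) - 79 / 100 * (r * t ^ 3) + 116 / 100 / pi ^ 3 * (r * t ^ 3)"
    by (simp only: distrib_right left_diff_distrib)
  ultimately show ?thesis by argo
qed

lemma rsqrt_facts:
  assumes m: "m \<ge> (30 :: real)"
  defines "t \<equiv> 1 / m" and "r \<equiv> 1 / sqrt m"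
  shows "r\<^sup>2 = t" "0 < r" "0 < t" "t \<le> 1 / 30" "r \<le> 1" "5 * t \<le> r"
proof -
  show "r\<^sup>2 = t" "0 < r" "0 < t" using m by (simp_all add: r_def t_def power_divide)
  show "t \<le> 1 / 30" using m by (auto simp: t_def intro!: divide_left_mono)
  show "r \<le> 1" using m by (simp add: r_def)
  have "5 \<le> sqrt m" using m by (intro real_le_rsqrt) simp
  then have "5 * (1 / m) \<le> sqrt m * (1 / m)" using m by (intro mult_right_mono) auto
  also have "\<dots> = r" using m by (simp add: r_def real_div_sqrt field_simps)
  finally show "5 * t \<le> r" by (simp add: t_def)
qed

text \<open>The factors of \<open>1 / g\<close> are bounded separately. The exponential is needed to
  second order, since \<open>e^2 / 2\<close> contributes \<open>pi^2/32 t^3\<close>, which is of the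
  order of the decisive gap. \<open>1 + Y\<close> stands for the rational part. The cross term
  \<open>J * Y\<close> is dropped, hence the proof of \<open>0 \<le> J\<close>.\<close>

lemma one_plus_ell_le:
  assumes m: "m \<ge> (30 :: real)"
  defines "w \<equiv> 1 / (pi * sqrt m)" and "h \<equiv> (1 / m)\<^sup>2"
    and "e \<equiv> 2 * (pi * sqrt m) - pi * sqrt (m - 1) - pi * sqrt (m + 1)"
  defines "Y \<equiv> h * (3 / 4 * w + 999 / 1000 * w\<^sup>2 + 116 / 100 * w ^ 3) - 46 / 10 * w ^ 6"
  shows "0 \<le> Y" "1 + ell m \<le> exp e * (1 - h) * (1 + Y)"
proof -
  define t r where "t = 1 / m" and "r = 1 / sqrt m"
  note rt = rsqrt_facts[OF m, folded t_def r_def]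
  have w: "w = r / pi" by (simp add: w_def r_def)
  have h: "h = t\<^sup>2" by (simp add: h_def t_def)
  have r6: "r ^ 6 = t ^ 3" unfolding rt(1)[symmetric] by simp
  have r3: "r ^ 3 = r * t" unfolding rt(1)[symmetric] by (simp add: power_numeral_reduce)
  have Y: "Y = 3 / 4 / pi * (r * t\<^sup>2) + 999 / 1000 / pi\<^sup>2 * t ^ 3 + 116 / 100 / pi ^ 3 * (r * t ^ 3) - 46 / 10 / pi ^ 6 * t ^ 3"
    unfolding Y_def w h power_divide r6 r3 rt(1) by (simp add: field_simps power_numeral_reduce power2_eq_square)
  have "46 / 10 / pi ^ 6 \<le> 999 / 1000 / pi\<^sup>2"
  proof -
    have "9 ^ 2 \<le> (pi\<^sup>2) ^ 2" using pi_sq_bounds by (intro power_mono) auto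
    then have "46 / 10 / pi ^ 4 \<le> 46 / 10 / 81" by (intro divide_left_mono) (auto simp flip: power_mult)
    then have "46 / 10 / pi ^ 4 / pi\<^sup>2 \<le> 999 / 1000 / pi\<^sup>2" by (intro divide_right_mono) auto
    moreover have "46 / 10 / pi ^ 4 / pi\<^sup>2 = 46 / 10 / pi ^ 6"
      unfolding divide_divide_eq_left[of _ "pi ^ 4"] by (simp flip: power_add)
    ultimately show ?thesis by (simp only:)
  qed
  then have "46 / 10 / pi ^ 6 * t ^ 3 \<le> 999 / 1000 / pi\<^sup>2 * t ^ 3" using rt by (intro mult_right_mono) auto
  moreover have "0 \<le> 3 / 4 / pi * (r * t\<^sup>2)" "0 \<le> 116 / 100 / pi ^ 3 * (r * t ^ 3)" using rt by simp_all
  ultimately show Y0: "0 \<le> Y" unfolding Y by linarith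
  define e0 where "e0 = pi / 4 * (r * t) + 5 * pi / 64 * (r * t ^ 3)"
  have e0: "e0 \<le> e" unfolding e0_def e_def r_def t_def by (rule exponent_bounds(1)[OF m])
  have e0_ge: "pi / 4 * (r * t) \<le> e0" unfolding e0_def using rt by simp
  have rt0: "0 \<le> r * t" using rt by simp
  have e0_le: "e0 \<le> 786 / 1000 * (r * t)"
  proof -
    have "t\<^sup>2 \<le> (1 / 30)\<^sup>2" using rt by (intro power_mono) auto
    then have "r * t * t\<^sup>2 \<le> r * t * (1 / 900)" using rt0 by (intro mult_left_mono) (simp_all add: power2_eq_square)
    moreover have "r * t ^ 3 = r * t * t\<^sup>2" by (simp add: power_numeral_reduce power2_eq_square)
    ultimately have "r * t ^ 3 \<le> (r * t) / 900" by (simp only: mult_1_right times_divide_eq_right)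
    then have "5 * pi / 64 * (r * t ^ 3) \<le> 5 * (22 / 7) / 64 * ((r * t) / 900)"
      using pi_approx rt by (intro mult_mono) auto
    moreover have "pi / 4 * (r * t) \<le> (31416 / 10000 / 4) * (r * t)" using pi_approx rt0 by (intro mult_right_mono) auto
    ultimately show ?thesis unfolding e0_def using rt0 by argo
  qed
  define G where "G = e0 + e0\<^sup>2 / 2"
  have e0_pos: "0 \<le> e0" using e0_ge rt0 by (meson order_trans mult_nonneg_nonneg pi_ge_zero divide_nonneg_nonneg zero_le_numeral)
  have "5 * r\<^sup>2 \<le> r" using rt by simp
  then have r5: "r \<le> 1 / 5" using rt(2) by (simp add: power2_eq_square)
  have "r * t \<le> 1 / 5 * (1 / 30)" using rt r5 by (intro mult_mono) auto
  then have e0_small: "e0 \<le> 1 / 150" using e0_le by argo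
  have G_le: "G \<le> 79 / 100 * (r * t)"
  proof -
    have "e0\<^sup>2 \<le> 1 / 150 * e0" using mult_right_mono[OF e0_small e0_pos] by (simp add: power2_eq_square)
    then show ?thesis unfolding G_def using e0_le rt0 by argo
  qed
  have G_ge: "pi / 4 * (r * t) + 5 * pi / 64 * (r * t ^ 3) + pi\<^sup>2 / 32 * t ^ 3 \<le> G"
  proof -
    have "(pi / 4 * (r * t))\<^sup>2 \<le> e0\<^sup>2" using e0_ge rt0 by (intro power_mono) auto
    moreover have "(pi / 4 * (r * t))\<^sup>2 = pi\<^sup>2 / 16 * t ^ 3"
      unfolding power_mult_distrib rt(1) by (simp add: power_divide power_numeral_reduce power2_eq_square)
    ultimately show ?thesis unfolding G_def e0_def[symmetric] by argo
  qed
  have "1 + G \<le> exp e0" unfolding G_def using exp_lower_Taylor_quadratic[OF e0_pos] by simp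
  also have "\<dots> \<le> exp e" using e0 by simp
  finally have expG: "1 + G \<le> exp e" .
  define J where "J = pi / 4 * (r * t) + 5 * pi / 64 * (r * t ^ 3) + pi\<^sup>2 / 32 * t ^ 3 - t\<^sup>2 - 79 / 100 * (r * t ^ 3)"
  have h1: "0 \<le> h" "h \<le> 1 / 900"
    unfolding h using power_mono[OF rt(4), of 2] rt(3) by (simp_all add: power2_eq_square)
  have rt3: "r * t ^ 3 = r * t * h" unfolding h by (simp add: power_numeral_reduce power2_eq_square)
  have "1 + J \<le> (1 + G) * (1 - h)"
  proof -
    have "G * h \<le> 79 / 100 * (r * t) * h" using G_le h1 by (intro mult_right_mono) auto
    then have Gh: "G * h \<le> 79 / 100 * (r * t ^ 3)" unfolding rt3 by simp
    have "(1 + G) * (1 - h) = 1 + G - h - G * h" by (simp add: algebra_simps)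
    then show ?thesis unfolding J_def using G_ge Gh h by argo
  qed
  also have "\<dots> \<le> exp e * (1 - h)" using expG h1 by (intro mult_right_mono) auto
  finally have J_le: "1 + J \<le> exp e * (1 - h)" .
  have J0: "0 \<le> J"
  proof -
    have "5 * t * t \<le> r * t" using rt by (intro mult_right_mono) auto
    then have "5 * t\<^sup>2 \<le> r * t" by (simp add: power2_eq_square)
    moreover have "r * t * h \<le> r * t * (1 / 900)" using h1 rt0 by (intro mult_left_mono) auto
    moreover have "3 / 4 * (r * t) \<le> pi / 4 * (r * t)" using pi_gt3 rt0 by (intro mult_right_mono) auto
    moreover have "0 \<le> 5 * pi / 64 * (r * t ^ 3)" "0 \<le> pi\<^sup>2 / 32 * t ^ 3" using rt by simp_all
    ultimately show ?thesis unfolding J_def rt3 using rt0 by argo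
  qed
  have "ell m \<le> J + Y"
    unfolding ell_def Let_def t_def[symmetric] r_def[symmetric] J_def Y by (rule ell_le_poly[OF rt(2-4)])
  then have "1 + ell m \<le> 1 + J + Y + J * Y" using J0 Y0 by (simp add: add_increasing2)
  also have "\<dots> = (1 + J) * (1 + Y)" by (simp add: algebra_simps)
  also have "\<dots> \<le> exp e * (1 - h) * (1 + Y)" using J_le Y0 by (intro mult_right_mono) auto
  finally show "1 + ell m \<le> exp e * (1 - h) * (1 + Y)" .
qed

text \<open>With \<open>Q\<close> the numerator from \<open>g_alt\<close>, the polynomial inequality
  yields \<open>Q (1 + Y) \<le> (1 - w - w^6)^2\<close>; this is combined with
  \<open>one_plus_ell_le\<close>.\<close>

theorem g_upper:
  assumes n: "n \<ge> 30"
  shows "g n * (1 + ell (real n)) \<le> 1"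
proof -
  define m where "m = real n"
  have m: "m \<ge> 30" using n by (simp add: m_def)
  define t w a b h where "t = 1 / m" and "w = 1 / (pi * sqrt m)" and "a = 1 / (pi * sqrt (m - 1))"
    and "b = 1 / (pi * sqrt (m + 1))" and "h = (1 / m)\<^sup>2"
  define E where "E = 2 * (pi * sqrt m) - pi * sqrt (m - 1) - pi * sqrt (m + 1)"
  define Q where "Q = (1 - a + a ^ 6) * (1 - b + b ^ 6)"
  define Y where "Y = h * (3 / 4 * w + 999 / 1000 * w\<^sup>2 + 116 / 100 * w ^ 3) - 46 / 10 * w ^ 6"
  have t: "0 \<le> t" "t \<le> 1 / 30" using rsqrt_facts[OF m] by (simp_all add: t_def)
  have ht: "h = t\<^sup>2" by (simp add: h_def t_def)
  have h1: "0 \<le> h" "h \<le> 1 / 900" unfolding ht using sqrt_pair_bounds(5)[OF t] by simp_all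
  have w: "0 < w" "w \<le> 59 / 1000" unfolding w_def by (rule w_bounds[OF m])+
  have w6: "w ^ 6 \<le> 1 / 10 ^ 6"
  proof -
    have "w ^ 6 \<le> (59 / 1000) ^ 6" using w by (intro power_mono) auto
    then show ?thesis by (simp add: power_divide)
  qed
  note ab = reciprocal_pair[OF m, folded w_def a_def b_def t_def]
  note rb = rsqrt_pair_bounds[OF t, folded ht]
  have "Q = 1 - (a + b) + a * b + a ^ 6 + b ^ 6 - (a ^ 6 * b + b ^ 6 * a - a ^ 6 * b ^ 6)"
    unfolding Q_def by (simp add: algebra_simps)
  also have "\<dots> \<le> 1 - (a + b) + a * b + (a ^ 6 + b ^ 6)"
  proof -
    have "b ^ 6 \<le> b ^ 1" using ab(7,8) by (intro power_decreasing) auto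
    then have "a ^ 6 * b ^ 6 \<le> a ^ 6 * b" using ab(5) by (intro mult_left_mono) auto
    moreover have "0 \<le> b ^ 6 * a" using ab(5,7) by simp
    ultimately show ?thesis by linarith
  qed
  also have "a ^ 6 + b ^ 6 = w ^ 6 * (1 / (1 - t) ^ 3 + 1 / (1 + t) ^ 3)"
    unfolding ab(3,4) by (simp add: algebra_simps)
  also have "\<dots> \<le> w ^ 6 * (202 / 100)" using cube_pair_le[OF t] w by (intro mult_left_mono) auto
  also have "1 - (a + b) + a * b \<le> (1 - w)\<^sup>2 - h * (3 / 4 * w - 501 / 1000 * w\<^sup>2)"
  proof -
    have "w * (2 + 3 / 4 * h) \<le> a + b" unfolding ab(1) using rb(1) w by (intro mult_left_mono) auto
    moreover have "a * b \<le> w\<^sup>2 * (1 + 501 / 1000 * h)" unfolding ab(2) using rb(4) by (intro mult_left_mono) auto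
    moreover have "(1 - w)\<^sup>2 - h * (3 / 4 * w - 501 / 1000 * w\<^sup>2) = 1 - w * (2 + 3 / 4 * h) + w\<^sup>2 * (1 + 501 / 1000 * h)"
      by (simp add: power2_eq_square algebra_simps)
    ultimately show ?thesis by argo
  qed
  finally have Q: "Q \<le> (1 - w)\<^sup>2 - h * (3 / 4 * w - 501 / 1000 * w\<^sup>2) + 202 / 100 * w ^ 6" by simp
  have Q0: "0 \<le> Q" unfolding Q_def using ab(5-8) by (intro mult_nonneg_nonneg add_nonneg_nonneg) auto
  have Y0: "0 \<le> Y" and ell: "1 + ell m \<le> exp E * (1 - h) * (1 + Y)"
    unfolding Y_def E_def w_def h_def by (rule one_plus_ell_le[OF m])+
  have "Q * (1 + Y) \<le> ((1 - w)\<^sup>2 - h * (3 / 4 * w - 501 / 1000 * w\<^sup>2) + 202 / 100 * w ^ 6) * (1 + Y)"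
    using Q Y0 by (intro mult_right_mono) auto
  also have "\<dots> \<le> (1 - w)\<^sup>2 - 2 * w ^ 6"
    unfolding Y_def by (rule rational_factor_poly) (use w w6 h1 in auto)
  also have "\<dots> \<le> (1 - w - w ^ 6)\<^sup>2"
  proof -
    have "(1 - w - w ^ 6)\<^sup>2 = (1 - w)\<^sup>2 - 2 * w ^ 6 + 2 * (w * w ^ 6) + (w ^ 6)\<^sup>2"
      by (simp add: power2_eq_square algebra_simps)
    moreover have "0 \<le> w * w ^ 6" "0 \<le> (w ^ 6)\<^sup>2" using w by simp_all
    ultimately show ?thesis by linarith
  qed
  finally have QY: "Q * (1 + Y) \<le> (1 - w - w ^ 6)\<^sup>2" .
  define D where "D = exp E * (1 - h) * (1 - w - w ^ 6)\<^sup>2"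
  have Eh: "0 < exp E * (1 - h)" using h1 by simp
  have "w ^ 6 < 1 - w" using w w6 by simp
  then have D0: "0 < D" unfolding D_def by (intro mult_pos_pos[OF Eh] zero_less_power) simp
  have "Q * (1 + ell m) \<le> Q * (exp E * (1 - h) * (1 + Y))" using ell Q0 by (intro mult_left_mono)
  also have "\<dots> = exp E * (1 - h) * (Q * (1 + Y))" by (simp only: mult_ac)
  also have "\<dots> \<le> D" unfolding D_def using QY Eh by (intro mult_left_mono) auto
  finally have "Q / D * (1 + ell m) \<le> 1" using D0 by (simp add: pos_divide_le_eq)
  moreover have "g n = Q / D"
    unfolding D_def Q_def E_def h_def w_def a_def b_def m_def by (rule g_alt[OF n])
  ultimately show ?thesis by (simp add: m_def)
qed

lemma g_less_phi:
  assumes n: "n \<ge> 30" and b: "0 \<le> 1 - u (n - 1)" "0 \<le> 1 - u (n + 1)"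
    and l: "0 < ell (real n)" and lt: "(1 - u (n - 1)) * (1 - u (n + 1)) < (ell (real n))\<^sup>2"
    and le: "(1 - u (n - 1)) * (1 - u (n + 1)) < 1"
  shows "g n < phi (s n)"
proof -
  define q where "q = (1 - u (n - 1)) * (1 - u (n + 1))"
  have s: "s n = 1 - q" by (simp add: s_def q_def algebra_simps)
  have q: "0 \<le> q" "q < 1" using b le by (simp_all add: q_def)
  have sq: "sqrt q < ell (real n)" using lt l q by (intro real_less_lsqrt) (simp_all add: q_def)
  have "(1 - sqrt q) * (1 + sqrt q) = 1 - q" using q by (simp add: algebra_simps)
  then have "phi (s n) = 1 / (1 + sqrt q)"
    unfolding phi_def s using q by (simp add: divide_simps add_pos_nonneg) (metis add_pos_nonneg less_irrefl real_sqrt_ge_zero zero_less_one)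
  moreover have "g n \<le> 1 / (1 + ell (real n))" using g_upper[OF n] l by (simp add: pos_le_divide_eq)
  moreover have "1 / (1 + ell (real n)) < 1 / (1 + sqrt q)"
    using sq q l by (intro divide_strict_left_mono mult_pos_pos add_pos_nonneg) auto
  ultimately show ?thesis by linarith
qed

section \<open>Upper bounds for 1 - u and their average over two neighbours\<close>

text \<open>Shares the three leading terms with \<open>ell\<close>; the parameter \<open>c\<close>
  is to cover everything from \<open>t^3\<close> on. The true coefficient is about -0.2, which
  leaves room: \<open>c = 9/40\<close> is what the asymptotic formula delivers,
  \<open>c = 1/10\<close> what the computation verifies.\<close>

definition beta_bound :: "real \<Rightarrow> real \<Rightarrow> real" where
  "beta_bound c m = (let t = 1 / m; r = 1 / sqrt m in
     r * (pi / 4 * t + 3 / (4 * pi) * t\<^sup>2) - t\<^sup>2 + c * t ^ 3)"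

lemma overpart_lead_ratio:
  assumes k: "k \<ge> 30"
  defines "m \<equiv> real k"
  defines "w \<equiv> 1 / (pi * sqrt m)" and "a \<equiv> 1 / (pi * sqrt (m - 1))" and "b \<equiv> 1 / (pi * sqrt (m + 1))"
  shows "overpart_lead (k - 1) * overpart_lead (k + 1) / (overpart_lead k)\<^sup>2
    = (1 - a) * (1 - b) / (1 - w)\<^sup>2 / (exp (2 * (pi * sqrt m) - pi * sqrt (m - 1) - pi * sqrt (m + 1)) * (1 - (1 / m)\<^sup>2))"
proof -
  have m: "m \<ge> 30" using k by (simp add: m_def)
  have km: "real (k - 1) = m - 1" "real (k + 1) = m + 1" "real k = m" using k by (simp_all add: m_def of_nat_diff)
  have e: "exp (2 * (pi * sqrt m) - pi * sqrt (m - 1) - pi * sqrt (m + 1))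
      = exp (pi * sqrt m) * exp (pi * sqrt m) / (exp (pi * sqrt (m - 1)) * exp (pi * sqrt (m + 1)))"
    by (simp only: exp_diff exp_add mult_2 divide_divide_eq_left)
  have h: "1 - (1 / m)\<^sup>2 = (m - 1) * (m + 1) / (m * m)"
    using m by (simp add: power2_eq_square field_simps)
  have "w < 1" using w_bounds(2)[OF m, folded w_def] by linarith
  have "E1 * A / (8 * x) * (E2 * B / (8 * y)) / (E * W / (8 * z))\<^sup>2 = A * B / W\<^sup>2 / (E * E / (E1 * E2) * (x * y / (z * z)))"
    if "E1 \<noteq> 0" "E2 \<noteq> 0" "E \<noteq> 0" "x \<noteq> 0" "y \<noteq> 0" "z \<noteq> 0" "W \<noteq> 0" for E1 E2 E A B W x y z :: real
    using that by (simp add: power2_eq_square divide_simps)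
  note gen = this
  show ?thesis
    unfolding overpart_lead_def km e h w_def[symmetric] a_def[symmetric] b_def[symmetric]
    by (rule gen) (use m \<open>w < 1\<close> in auto)
qed

lemma overpart_lead_pos: "k \<ge> 30 \<Longrightarrow> overpart_lead k > 0"
proof -
  assume k: "k \<ge> 30"
  then have "30 \<le> real k" by simp
  from w_bounds(2)[OF this] have "0 < 1 - 1 / (pi * sqrt (real k))" by linarith
  then show ?thesis unfolding overpart_lead_def using k by (intro divide_pos_pos mult_pos_pos) auto
qed

text \<open>The lower bound uses \<open>exp (- E) \<ge> 1 - E\<close>: neglecting
  \<open>E^2 / 2\<close> raises the \<open>t^3\<close> coefficient of \<open>1 - R\<close> from
  about -0.2 to 0.1, which is affordable. The upper bound is crude and serves to show
  \<open>u k \<le> 1\<close>.\<close>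

lemma lead_ratio_bounds:
  assumes k: "k \<ge> 899"
  defines "m \<equiv> real k"
  defines "t \<equiv> 1 / m" and "r \<equiv> 1 / sqrt m"
  defines "R \<equiv> overpart_lead (k - 1) * overpart_lead (k + 1) / (overpart_lead k)\<^sup>2"
  shows "R \<ge> (1 - pi / 4 * (r * t) - pi / 10 * (r * t ^ 3)) * (1 + t\<^sup>2)
      * (1 - t\<^sup>2 * (3 / 4 * (r / pi) + 102 / 100 * (r / pi)\<^sup>2 + 11 / 10 * (t\<^sup>2 * (r / pi))))"
    and "R \<le> (1 + 2 * t\<^sup>2) / (1 + 20 * t\<^sup>2)"
proof -
  have m: "m \<ge> 899" "m \<ge> 30" using k by (simp_all add: m_def)
  define w a b h where "w = 1 / (pi * sqrt m)" and "a = 1 / (pi * sqrt (m - 1))"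
    and "b = 1 / (pi * sqrt (m + 1))" and "h = t\<^sup>2"
  define E where "E = 2 * (pi * sqrt m) - pi * sqrt (m - 1) - pi * sqrt (m + 1)"
  note rt = rsqrt_facts[OF m(2), folded t_def r_def]
  have t: "0 \<le> t" "t \<le> 1 / 30" using rt by simp_all
  note h1 = sqrt_pair_bounds(5)[OF t, folded h_def]
  have h0: "0 \<le> h" by (simp add: h_def)
  note ab = reciprocal_pair[OF m(2), folded w_def a_def b_def t_def]
  note rb = rsqrt_pair_bounds[OF t, folded h_def]
  have wr: "w = r / pi" by (simp add: w_def r_def)
  have sm: "(299 / 10 :: real) \<le> sqrt m" using m by (intro real_le_rsqrt) (simp add: power2_eq_square)
  have w: "0 < w" "w \<le> 11 / 1000"
  proof -
    show "0 < w" using m by (simp add: w_def)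
    have "157 / 50 * (299 / 10) \<le> pi * sqrt m" using pi_approx sm by (intro mult_mono) auto
    then show "w \<le> 11 / 1000" unfolding w_def using m by (simp add: field_simps)
  qed
  have R: "R = (1 - a) * (1 - b) / (1 - w)\<^sup>2 / (exp E * (1 - h))"
    unfolding R_def E_def h_def t_def w_def a_def b_def m_def using k by (intro overpart_lead_ratio) simp
  have K: "(1 - a) * (1 - b) = 1 - (a + b) + a * b" by (simp add: algebra_simps)
  have D0: "0 < (1 - w)\<^sup>2" using w by simp
  note Eb = exponent_bounds[OF m(2), folded E_def t_def r_def]
  have rt0: "0 \<le> r * t" "0 \<le> r * t ^ 3" using rt by simp_all
  have E0: "0 \<le> E"
  proof -
    have "0 \<le> pi / 4 * (r * t) + 5 * pi / 64 * (r * t ^ 3)"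
      by (rule add_nonneg_nonneg[OF mult_nonneg_nonneg[OF _ rt0(1)] mult_nonneg_nonneg[OF _ rt0(2)]]) simp_all
    then show ?thesis using Eb(1) by linarith
  qed
  have w2: "0 \<le> w\<^sup>2" "w\<^sup>2 \<le> w * (11 / 1000)" using mult_left_mono[OF w(2), of w] w by (simp_all add: power2_eq_square)
  have w3: "0 \<le> w ^ 3" "w ^ 3 \<le> w\<^sup>2 * (11 / 1000)" using w mult_left_mono[OF w(2) w2(1)] by (simp_all add: power_numeral_reduce power2_eq_square mult_ac)
  have w4: "0 \<le> w ^ 4" "w ^ 4 \<le> w ^ 3 * (11 / 1000)" using w mult_left_mono[OF w(2) w3(1)] by (simp_all add: power_numeral_reduce mult_ac)
  \<comment> \<open>After division by \<open>(1 - w)^2\<close> the exact coefficient of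
    \<open>w^2\<close> is \<open>3/2 - 1/2 = 1\<close>; the surplus 2/100 absorbs the cubic
    term.\<close>
  define Z where "Z = h * (3 / 4 * w + 102 / 100 * w\<^sup>2 + 11 / 10 * (h * w))"
  have KZ: "(1 - w)\<^sup>2 * (1 - Z) \<le> (1 - a) * (1 - b)"
  proof -
    have "a + b \<le> w * (2 + 3 / 4 * h + h\<^sup>2)" unfolding ab(1) using rb(2) w by (intro mult_left_mono) auto
    moreover have "w\<^sup>2 * (1 + h / 2) \<le> a * b" unfolding ab(2) using rb(3) by (intro mult_left_mono) auto
    moreover have "(1 - w)\<^sup>2 - h * (3 / 4 * w + h * w - w\<^sup>2 / 2) = 1 - w * (2 + 3 / 4 * h + h\<^sup>2) + w\<^sup>2 * (1 + h / 2)"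
      by (simp add: power2_eq_square field_simps)
    ultimately have K1: "(1 - w)\<^sup>2 - h * (3 / 4 * w + h * w - w\<^sup>2 / 2) \<le> (1 - a) * (1 - b)" unfolding K by argo
    have "3 / 4 * w + h * w - w\<^sup>2 / 2 \<le> (1 - w)\<^sup>2 * (3 / 4 * w + 102 / 100 * w\<^sup>2 + 11 / 10 * (h * w))"
    proof -
      have "(1 - w)\<^sup>2 * (3 / 4 * w + 102 / 100 * w\<^sup>2 + 11 / 10 * (h * w)) - (3 / 4 * w + h * w - w\<^sup>2 / 2)
        = (2 / 100 * w\<^sup>2 - 129 / 100 * w ^ 3 + 102 / 100 * w ^ 4) + h * (1 / 10 * w - 22 / 10 * w\<^sup>2 + 11 / 10 * w ^ 3)"
        by (simp add: power2_eq_square power_numeral_reduce field_simps)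
      moreover have "0 \<le> 2 / 100 * w\<^sup>2 - 129 / 100 * w ^ 3 + 102 / 100 * w ^ 4" using w2 w3 w4 by argo
      moreover have "0 \<le> h * (1 / 10 * w - 22 / 10 * w\<^sup>2 + 11 / 10 * w ^ 3)"
        using w w2 w3 h0 by (intro mult_nonneg_nonneg) argo+
      ultimately show ?thesis by argo
    qed
    then have "h * (3 / 4 * w + h * w - w\<^sup>2 / 2) \<le> h * ((1 - w)\<^sup>2 * (3 / 4 * w + 102 / 100 * w\<^sup>2 + 11 / 10 * (h * w)))"
      using h0 by (intro mult_left_mono)
    also have "\<dots> = (1 - w)\<^sup>2 * Z" unfolding Z_def by (simp only: mult_ac)
    finally have "(1 - w)\<^sup>2 - (1 - w)\<^sup>2 * Z \<le> (1 - a) * (1 - b)" using K1 by linarith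
    then show ?thesis by (simp add: right_diff_distrib)
  qed
  have Z0: "0 \<le> Z" unfolding Z_def using h0 w by simp
  have "3 / 4 * w + 102 / 100 * w\<^sup>2 + 11 / 10 * (h * w) \<le> 1"
  proof -
    have "h * w \<le> 1 / 900 * w" using h1 w by (intro mult_right_mono) auto
    then show ?thesis using w w2 by argo
  qed
  then have "Z \<le> h * 1" unfolding Z_def using h0 by (intro mult_left_mono)
  then have Z1: "Z \<le> 1 / 900" using h1 by simp
  have "1 - Z \<le> (1 - a) * (1 - b) / (1 - w)\<^sup>2" using KZ D0 by (simp add: pos_le_divide_eq mult.commute)
  moreover have "1 - E \<le> 1 / exp E" using exp_ge_add_one_self[of "- E"] by (simp add: exp_minus field_simps)
  moreover have "1 + h \<le> 1 / (1 - h)"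
  proof (subst pos_le_divide_eq)
    show "0 < 1 - h" using h1 by simp
    show "(1 + h) * (1 - h) \<le> 1" by (simp add: algebra_simps flip: power2_eq_square)
  qed
  ultimately have step: "(1 - E) * (1 + h) * (1 - Z) \<le> 1 / exp E * (1 / (1 - h)) * ((1 - a) * (1 - b) / (1 - w)\<^sup>2)"
    if "0 \<le> 1 - E" using that h0 h1 Z1 by (intro mult_mono mult_nonneg_nonneg) auto
  let ?e = "pi / 4 * (r * t) + pi / 10 * (r * t ^ 3)"
  have e1: "?e \<le> 1"
  proof -
    have "r * t \<le> 1 * (1 / 30)" using rt by (intro mult_mono) auto
    moreover have "t ^ 3 \<le> 1" using rt by (intro power_le_one) auto
    then have "r * t ^ 3 \<le> 1 * 1" using rt by (intro mult_mono) auto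
    ultimately have "pi / 4 * (r * t) \<le> 1 * (1 / 30)" "pi / 10 * (r * t ^ 3) \<le> 4 / 10 * 1"
      using rt0 pi_less_4 by (intro mult_mono; simp)+
    then show ?thesis by linarith
  qed
  have "(1 - ?e) * (1 + h) * (1 - Z) \<le> (1 - E) * (1 + h) * (1 - Z)"
    using Eb(2) h0 Z1 by (intro mult_right_mono) auto
  also have "\<dots> \<le> R" unfolding R using step Eb(2) e1 by (simp add: mult_ac)
  finally show "R \<ge> (1 - pi / 4 * (r * t) - pi / 10 * (r * t ^ 3)) * (1 + t\<^sup>2)
      * (1 - t\<^sup>2 * (3 / 4 * (r / pi) + 102 / 100 * (r / pi)\<^sup>2 + 11 / 10 * (t\<^sup>2 * (r / pi))))"
    unfolding Z_def h_def wr by (simp add: diff_diff_eq)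
  have "(1 - a) * (1 - b) \<le> (1 - w)\<^sup>2"
  proof -
    have "w * (2 + 3 / 4 * h) \<le> a + b" unfolding ab(1) using rb(1) w by (intro mult_left_mono) auto
    moreover have "a * b \<le> w\<^sup>2 * (1 + 501 / 1000 * h)" unfolding ab(2) using rb(4) by (intro mult_left_mono) auto
    moreover have "1 - w * (2 + 3 / 4 * h) + w\<^sup>2 * (1 + 501 / 1000 * h) = (1 - w)\<^sup>2 - h * (3 / 4 * w - 501 / 1000 * w\<^sup>2)"
      by (simp add: power2_eq_square algebra_simps)
    moreover have "0 \<le> h * (3 / 4 * w - 501 / 1000 * w\<^sup>2)" using w w2 h0 by (intro mult_nonneg_nonneg) argo+
    ultimately show ?thesis unfolding K by argo
  qed
  then have q1: "(1 - a) * (1 - b) / (1 - w)\<^sup>2 \<le> 1" using D0 by simp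
  have q0: "0 \<le> (1 - a) * (1 - b) / (1 - w)\<^sup>2" using ab(5-8) by simp
  \<comment> \<open>Follows from \<open>E \<ge> 3/4 r t\<close> and
    \<open>r \<ge> 299/10 t\<close>.\<close>
  have E20: "20 * h \<le> E"
  proof -
    have "299 / 10 * (1 / m) \<le> sqrt m * (1 / m)" using sm m by (intro mult_right_mono) auto
    also have "\<dots> = r" using m by (simp add: r_def real_div_sqrt field_simps)
    finally have "299 / 10 * t * t \<le> r * t" using rt by (intro mult_right_mono) (auto simp: t_def)
    then have "299 / 10 * h \<le> r * t" by (simp add: h_def power2_eq_square)
    moreover have "3 / 4 * (r * t) \<le> pi / 4 * (r * t)" using pi_gt3 rt0 by (intro mult_right_mono) auto
    moreover have "0 \<le> 5 * pi / 64 * (r * t ^ 3)" by (rule mult_nonneg_nonneg[OF _ rt0(2)]) simp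
    ultimately show ?thesis using Eb(1) h0 by argo
  qed
  then have "1 + 20 * h \<le> exp E" using exp_ge_add_one_self[of E] by linarith
  then have "1 / exp E \<le> 1 / (1 + 20 * h)" using h0 by (intro divide_left_mono) auto
  moreover have "1 / (1 - h) \<le> 1 + 2 * h"
  proof (subst pos_divide_le_eq)
    show "0 < 1 - h" using h1 by simp
    have "h * h \<le> h * (1 / 900)" using h1 h0 by (intro mult_left_mono) auto
    then show "1 \<le> (1 + 2 * h) * (1 - h)" using h0 by (simp add: algebra_simps)
  qed
  ultimately have "1 / exp E * (1 / (1 - h)) * ((1 - a) * (1 - b) / (1 - w)\<^sup>2) \<le> 1 / (1 + 20 * h) * (1 + 2 * h) * 1"
    using q1 q0 h0 h1 by (intro mult_mono mult_nonneg_nonneg) auto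
  then show "R \<le> (1 + 2 * t\<^sup>2) / (1 + 20 * t\<^sup>2)" unfolding R h_def by (simp add: mult_ac)
qed

text \<open>Relative errors \<open>d\<close> at \<open>k - 1\<close>, \<open>k\<close> and
  \<open>k + 1\<close> lower the ratio of the leading terms by a factor of at least
  \<open>1 - 4 d\<close> and raise it by at most \<open>1 + 5 d\<close>.\<close>

lemma u_bounds_large:
  assumes k: "k \<ge> 899"
  shows "0 \<le> 1 - u k" "1 - u k \<le> beta_bound (9 / 40) (real k)"
proof -
  define m t r where "m = real k" and "t = 1 / m" and "r = 1 / sqrt m"
  \<comment> \<open>The factor 1/50 of the asymptotic formula, times 101/100 for passing from
    \<open>k - 1\<close> to \<open>k\<close>.\<close>
  define d where "d = 202 / 10000 * t ^ 3"
  have m: "m \<ge> 899" "m \<ge> 30" using k by (simp_all add: m_def)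
  note rt = rsqrt_facts[OF m(2), folded t_def r_def]
  have t1: "t \<le> 1 / 899" unfolding t_def using m by (intro divide_left_mono) auto
  have r1: "r \<le> 10 / 299"
  proof -
    have "(299 / 10 :: real) \<le> sqrt m" using m by (intro real_le_rsqrt) (simp add: power2_eq_square)
    then have "1 / sqrt m \<le> 1 / (299 / 10)" using m by (intro divide_left_mono) auto
    then show ?thesis by (simp add: r_def)
  qed
  let ?L = overpart_lead
  define R where "R = ?L (k - 1) * ?L (k + 1) / (?L k)\<^sup>2"
  have near: "?L j * (1 - d) \<le> real (overpart j)" "real (overpart j) \<le> ?L j * (1 + d)" "0 < ?L j"
    if "k - 1 \<le> j" for j
  proof -
    have j: "j \<ge> 898" using that k by simp
    show pos: "0 < ?L j" using j by (intro overpart_lead_pos) simp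
    have "1 / (50 * real j ^ 3) \<le> d"
    proof -
      have jm: "m * (1 - 1 / 899) \<le> real j"
      proof -
        have "m - 1 \<le> real j" using that by (simp add: m_def)
        moreover have "m * (1 - 1 / 899) \<le> m - 1" using m by (simp add: field_simps)
        ultimately show ?thesis by linarith
      qed
      have "(m * (1 - 1 / 899)) ^ 3 \<le> real j ^ 3" using jm m by (intro power_mono) auto
      moreover have "m ^ 3 * (100 / 101) \<le> m ^ 3 * (1 - 1 / 899) ^ 3"
        using m by (intro mult_left_mono) (auto simp: power_divide)
      ultimately have "m ^ 3 * (100 / 101) \<le> real j ^ 3" by (simp only: power_mult_distrib)
      then have "1 / (50 * real j ^ 3) \<le> 1 / (50 * (m ^ 3 * (100 / 101)))"
        using m j by (intro divide_left_mono mult_left_mono mult_pos_pos) auto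
      also have "\<dots> = d" unfolding d_def t_def by (simp add: power_divide)
      finally show ?thesis .
    qed
    then have "?L j * (1 / (50 * real j ^ 3)) \<le> ?L j * d" using pos by (intro mult_left_mono) auto
    then have "\<bar>real (overpart j) - ?L j\<bar> \<le> ?L j * d"
      using overpart_asymptotic[OF j] by simp
    then show "?L j * (1 - d) \<le> real (overpart j)" "real (overpart j) \<le> ?L j * (1 + d)"
      by (simp_all add: right_diff_distrib distrib_left abs_le_iff)
  qed
  have t3: "0 < t ^ 3" using rt by simp
  have h1: "0 < t\<^sup>2" using rt by simp
  have t32: "t ^ 3 \<le> t\<^sup>2 / 899"
  proof -
    have "t ^ 3 = t\<^sup>2 * t" by (simp add: power_numeral_reduce power2_eq_square)
    also have "\<dots> \<le> t\<^sup>2 * (1 / 899)" using t1 by (intro mult_left_mono) auto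
    finally show ?thesis by simp
  qed
  have h2: "t\<^sup>2 \<le> 1 / 800000"
  proof -
    have "t\<^sup>2 \<le> (1 / 899)\<^sup>2" using t1 rt by (intro power_mono) auto
    then show ?thesis by (simp add: power2_eq_square)
  qed
  have d: "0 < d" "d \<le> t\<^sup>2 / 1000" using t3 t32 h1 unfolding d_def by (simp, argo)
  have d1: "d \<le> 1 / 100" using d h2 by argo
  have um: "u k = real (overpart (k - 1)) * real (overpart (k + 1)) / (real (overpart k))\<^sup>2" by (simp add: u_def)
  have ge: "k - 1 \<le> k + 1" "k - 1 \<le> k" by simp_all
  note n1 = near[OF order_refl] and n2 = near[OF ge(1)] and n3 = near[OF ge(2)]
  have p3: "0 < real (overpart k)"
  proof -
    have "0 < ?L k * (1 - d)" using n3(3) d1 by simp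
    then show ?thesis using n3(1) by simp
  qed
  have R0: "0 < R" unfolding R_def using n1(3) n2(3) n3(3) by simp
  have low: "R * (1 - 4 * d) \<le> u k"
  proof -
    have "(1 - 4 * d) * (1 + d)\<^sup>2 \<le> (1 - d)\<^sup>2"
    proof -
      have "(1 - d)\<^sup>2 - (1 - 4 * d) * (1 + d)\<^sup>2 = d\<^sup>2 * (8 + 4 * d)" by (simp add: power2_eq_square algebra_simps)
      moreover have "0 \<le> d\<^sup>2 * (8 + 4 * d)" using d by simp
      ultimately show ?thesis by linarith
    qed
    have "R * (1 - 4 * d) * (real (overpart k))\<^sup>2 \<le> R * (1 - 4 * d) * (?L k * (1 + d))\<^sup>2"
      using R0 d1 n3 p3 by (intro mult_left_mono power_mono) auto
    also have "\<dots> = ?L (k - 1) * ?L (k + 1) * ((1 - 4 * d) * (1 + d)\<^sup>2)"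
      unfolding R_def using n3(3) by (simp add: power_mult_distrib)
    also have "\<dots> \<le> ?L (k - 1) * ?L (k + 1) * (1 - d)\<^sup>2"
      using \<open>(1 - 4 * d) * (1 + d)\<^sup>2 \<le> (1 - d)\<^sup>2\<close> n1(3) n2(3) by (intro mult_left_mono) auto
    also have "\<dots> = (?L (k - 1) * (1 - d)) * (?L (k + 1) * (1 - d))" by (simp add: power2_eq_square)
    also have "\<dots> \<le> real (overpart (k - 1)) * real (overpart (k + 1))"
      using n1 n2 d1 by (intro mult_mono) auto
    finally show ?thesis unfolding um using p3 by (simp add: pos_le_divide_eq)
  qed
  have up: "u k \<le> R * (1 + 5 * d)"
  proof -
    have dd: "(1 + d)\<^sup>2 \<le> (1 + 5 * d) * (1 - d)\<^sup>2"
    proof -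
      have "(1 + 5 * d) * (1 - d)\<^sup>2 - (1 + d)\<^sup>2 = d * (1 - 10 * d) + 5 * d ^ 3" by (simp add: power2_eq_square power_numeral_reduce algebra_simps)
      moreover have "0 \<le> d * (1 - 10 * d)" "0 \<le> 5 * d ^ 3" using d d1 by simp_all
      ultimately show ?thesis by linarith
    qed
    have "real (overpart (k - 1)) * real (overpart (k + 1)) \<le> (?L (k - 1) * (1 + d)) * (?L (k + 1) * (1 + d))"
      using n1 n2 d1 d by (intro mult_mono) auto
    also have "\<dots> = ?L (k - 1) * ?L (k + 1) * (1 + d)\<^sup>2" by (simp add: power2_eq_square)
    also have "\<dots> \<le> ?L (k - 1) * ?L (k + 1) * ((1 + 5 * d) * (1 - d)\<^sup>2)"
      using dd n1(3) n2(3) by (intro mult_left_mono) auto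
    also have "\<dots> = R * (1 + 5 * d) * (?L k * (1 - d))\<^sup>2"
      unfolding R_def using n3(3) by (simp add: power_mult_distrib)
    also have "\<dots> \<le> R * (1 + 5 * d) * (real (overpart k))\<^sup>2"
      using R0 d d1 n3 by (intro mult_left_mono power_mono) auto
    finally show ?thesis unfolding um using p3 by (simp add: pos_divide_le_eq)
  qed
  note Rb = lead_ratio_bounds[OF k, folded m_def, folded t_def r_def, folded R_def]
  have "R * (1 + 5 * d) \<le> (1 + 2 * t\<^sup>2) / (1 + 20 * t\<^sup>2) * (1 + t\<^sup>2)"
    using Rb(2) R0 d h1 by (intro mult_mono) auto
  also have "\<dots> \<le> 1"
  proof -
    have "(1 + 2 * y) * (1 + y) \<le> 1 + 20 * y" if "0 \<le> y" "y \<le> 1" for y :: real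
      using that mult_left_mono[OF that(2,1)] by (simp add: algebra_simps)
    from this[of "t\<^sup>2"] have "(1 + 2 * t\<^sup>2) * (1 + t\<^sup>2) \<le> 1 + 20 * t\<^sup>2" using h1 h2 by simp
    then have "(1 + 2 * t\<^sup>2) * (1 + t\<^sup>2) / (1 + 20 * t\<^sup>2) \<le> 1"
      using h1 by (subst divide_le_eq_1_pos) (auto intro: add_pos_nonneg)
    then show ?thesis by simp
  qed
  finally show "0 \<le> 1 - u k" using up by simp
  define e where "e = pi / 4 * (r * t) + pi / 10 * (r * t ^ 3)"
  define Z where "Z = t\<^sup>2 * (3 / 4 * (r / pi) + 102 / 100 * (r / pi)\<^sup>2 + 11 / 10 * (t\<^sup>2 * (r / pi)))"
  have rt3: "r * t ^ 3 \<le> 10 / 299 * t ^ 3" using r1 t3 by (intro mult_right_mono) auto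
  have rt3': "0 \<le> r * t ^ 3" using rt by simp
  have tt: "t * t ^ 3 \<le> 1 / 899 * t ^ 3" "t\<^sup>2 * t ^ 3 \<le> 1 / 800000 * t ^ 3"
    using t1 h2 t3 by (intro mult_right_mono; simp)+
  have rt4: "r * t ^ 4 \<le> 1 / 20000 * t ^ 3"
  proof -
    have "r * t \<le> 10 / 299 * (1 / 899)" using r1 t1 rt by (intro mult_mono) auto
    then have "r * t * t ^ 3 \<le> 1 / 20000 * t ^ 3" using t3 by (intro mult_right_mono) auto
    then show ?thesis by (simp add: power_numeral_reduce mult_ac)
  qed
  have e1: "e \<le> 1"
  proof -
    have "r * t \<le> 10 / 299 * (1 / 899)" using r1 t1 rt by (intro mult_mono) auto
    moreover have "t ^ 3 \<le> 1" using rt by (intro power_le_one) auto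
    ultimately have c: "r * t \<le> 1 / 100" "r * t ^ 3 \<le> 1" using rt3 by linarith+
    have "pi / 4 * (r * t) \<le> 1 * (1 / 100)"
      by (rule mult_mono) (use c rt pi_less_4 in auto)
    moreover have "pi / 10 * (r * t ^ 3) \<le> 4 / 10 * 1"
      by (rule mult_mono) (use c rt3' pi_less_4 in auto)
    ultimately show ?thesis unfolding e_def by argo
  qed
  have Zeq: "Z = 3 / (4 * pi) * (r * t\<^sup>2) + 102 / 100 / pi\<^sup>2 * t ^ 3 + 11 / 10 / pi * (r * t ^ 4)"
    unfolding Z_def power_divide rt(1) by (simp add: power_numeral_reduce power2_eq_square field_simps)
  have Z0: "0 \<le> Z" unfolding Zeq using rt by simp
  have c1: "102 / 100 / pi\<^sup>2 \<le> 1041 / 10000"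
  proof -
    have "102 / 100 / pi\<^sup>2 \<le> 102 / 100 / (98 / 10)" using pi_sq_bounds by (intro divide_left_mono) auto
    then show ?thesis by simp
  qed
  have c2: "11 / 10 / pi \<le> 1" "3 / (4 * pi) \<le> 1" using pi_gt3 by (simp_all add: field_simps)
  have Zle: "Z \<le> 3 / (4 * pi) * (r * t\<^sup>2) + 1041 / 10000 * t ^ 3 + 1 / 20000 * t ^ 3"
  proof -
    have "102 / 100 / pi\<^sup>2 * t ^ 3 \<le> 1041 / 10000 * t ^ 3" using c1 t3 by (intro mult_right_mono) auto
    moreover have "11 / 10 / pi * (r * t ^ 4) \<le> 1 * (1 / 20000 * t ^ 3)" by (rule mult_mono) (use c2 rt4 rt in auto)
    ultimately show ?thesis unfolding Zeq by argo
  qed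
  have Zt: "t\<^sup>2 * (Z + 4 * d) \<le> 1 / 400 * t ^ 3"
  proof -
    have "r * t\<^sup>2 \<le> 1 * t\<^sup>2" using rt by (intro mult_right_mono) auto
    moreover have "3 / (4 * pi) * (r * t\<^sup>2) \<le> 1 * (r * t\<^sup>2)" using c2 rt by (intro mult_right_mono) auto
    ultimately have "Z + 4 * d \<le> 2 * t\<^sup>2" using Zle d t32 h1 by argo
    then have "t\<^sup>2 * (Z + 4 * d) \<le> t\<^sup>2 * (2 * t\<^sup>2)" by (intro mult_left_mono) auto
    also have "\<dots> = 2 * (t * t ^ 3)" by (simp add: power_numeral_reduce power2_eq_square)
    finally show ?thesis using tt(1) t3 by argo
  qed
  have R1: "(1 - e) * (1 + t\<^sup>2) * (1 - Z) \<le> R"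
    using Rb(1) unfolding e_def Z_def by (simp add: diff_diff_eq)
  have A0: "0 \<le> (1 - e) * (1 + t\<^sup>2)" using e1 by simp
  have e0: "0 \<le> e" unfolding e_def using rt by simp
  have "(1 - e) * (1 + t\<^sup>2) * (1 - Z - 4 * d) \<le> (1 - e) * (1 + t\<^sup>2) * ((1 - Z) * (1 - 4 * d))"
  proof (rule mult_left_mono[OF _ A0])
    have "0 \<le> Z * d" using Z0 d by simp
    then show "1 - Z - 4 * d \<le> (1 - Z) * (1 - 4 * d)" by (simp add: algebra_simps)
  qed
  also have "\<dots> = (1 - e) * (1 + t\<^sup>2) * (1 - Z) * (1 - 4 * d)" by simp
  also have "\<dots> \<le> R * (1 - 4 * d)" using R1 d1 by (intro mult_right_mono) auto
  finally have u1: "(1 - e) * (1 + t\<^sup>2) * (1 - Z - 4 * d) \<le> u k" using low by simp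
  have "(1 - e) * (1 + t\<^sup>2) * (Z + 4 * d) \<le> 1 * (1 + t\<^sup>2) * (Z + 4 * d)"
    using e0 Z0 d by (intro mult_right_mono) auto
  moreover have "(1 - e) * (1 + t\<^sup>2) * (1 - Z - 4 * d) = 1 - e + t\<^sup>2 - t\<^sup>2 * e - (1 - e) * (1 + t\<^sup>2) * (Z + 4 * d)"
    by (simp add: algebra_simps)
  moreover have "1 * (1 + t\<^sup>2) * (Z + 4 * d) = Z + 4 * d + t\<^sup>2 * (Z + 4 * d)" by (simp add: algebra_simps)
  ultimately have u2: "1 - u k \<le> e - t\<^sup>2 + t\<^sup>2 * e + (Z + 4 * d) + t\<^sup>2 * (Z + 4 * d)" using u1 by argo
  have E1: "pi / 10 * (r * t ^ 3) \<le> 315 / 1000 * (10 / 299 * t ^ 3)"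
    and E2: "pi / 4 * (r * t ^ 3) \<le> 786 / 1000 * (10 / 299 * t ^ 3)"
    by (rule mult_mono; use pi_approx rt3 rt3' in simp)+
  have E3: "t\<^sup>2 * e \<le> 786 / 1000 * (10 / 299 * t ^ 3) + 1 / 10000 * t ^ 3"
  proof -
    have "t\<^sup>2 * e = pi / 4 * (r * t ^ 3) + t\<^sup>2 * (pi / 10 * (r * t ^ 3))"
      unfolding e_def by (simp add: algebra_simps power_numeral_reduce power2_eq_square)
    moreover have "t\<^sup>2 * (pi / 10 * (r * t ^ 3)) \<le> 1 / 800000 * (315 / 1000 * (10 / 299 * t ^ 3))"
      by (rule mult_mono) (use E1 h2 rt3' in auto)
    ultimately show ?thesis using E2 t3 by argo
  qed
  have "beta_bound (9 / 40) (real k) = pi / 4 * (r * t) + 3 / (4 * pi) * (r * t\<^sup>2) - t\<^sup>2 + 9 / 40 * t ^ 3"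
    unfolding beta_bound_def Let_def m_def[symmetric] t_def[symmetric] r_def[symmetric]
    by (simp add: distrib_left mult_ac)
  \<comment> \<open>Budget at \<open>t^3\<close>: 1041/10000 from \<open>1/pi^2\<close>, 808/10000
    from \<open>4 d\<close>, about 37/1000 from the terms in \<open>r t^3\<close>, and under 3/1000
    from the rest; the total is just below 9/40.\<close>
  then show "1 - u k \<le> beta_bound (9 / 40) (real k)"
    using u2 E1 E3 Zle Zt t3 unfolding e_def d_def by argo
qed

text \<open>The coefficient 4/10 exceeds the Taylor value 3/8; the surplus leaves
  \<open>t^2 / 20\<close> after squaring, enough against the cubic term for
  \<open>\<bar>t\<bar> \<le> 1 / 30\<close>.\<close>

lemma rsqrt_taylor:
  fixes t :: real assumes t: "\<bar>t\<bar> \<le> 1 / 30"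
  shows "1 / sqrt (1 + t) \<le> 1 - t / 2 + 4 / 10 * t\<^sup>2"
proof -
  let ?p = "1 - t / 2 + 4 / 10 * t\<^sup>2"
  have t2: "0 \<le> t\<^sup>2" by simp
  have p0: "0 \<le> ?p" using t t2 by argo
  have "1 \<le> ?p\<^sup>2 * (1 + t)"
  proof -
    have "?p\<^sup>2 * (1 + t) - 1 = t\<^sup>2 * (1 / 20 + 13 / 20 * t - 24 / 100 * t\<^sup>2 + 16 / 100 * t ^ 3)"
      by (simp add: power2_eq_square power_numeral_reduce field_simps)
    moreover have "0 \<le> 1 / 20 + 13 / 20 * t - 24 / 100 * t\<^sup>2 + 16 / 100 * t ^ 3"
    proof -
      have "t\<^sup>2 \<le> (1 / 30)\<^sup>2" using t by (subst abs_le_square_iff[symmetric]) auto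
      then have a: "t\<^sup>2 \<le> 1 / 900" by (simp add: power2_eq_square)
      have "\<bar>t ^ 3\<bar> \<le> (1 / 30) ^ 3" unfolding power_abs using t by (intro power_mono) auto
      then have "- (1 / 27000) \<le> t ^ 3" by (simp add: power_divide abs_le_iff)
      then show ?thesis using a t by (simp add: abs_le_iff)
    qed
    ultimately have "0 \<le> ?p\<^sup>2 * (1 + t) - 1" by simp
    then show ?thesis by simp
  qed
  then have "sqrt 1 \<le> sqrt (?p\<^sup>2 * (1 + t))" by (rule real_sqrt_le_mono)
  then have "1 \<le> ?p * sqrt (1 + t)" using p0 by (simp add: real_sqrt_mult)
  moreover have "0 < sqrt (1 + t)" using t by (simp add: abs_le_iff)
  ultimately show ?thesis by (simp add: pos_divide_le_eq)
qed

text \<open>Passing to \<open>m - 1\<close> and \<open>m + 1\<close> adds second differences, which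
  cost at most \<open>319/100 * r t^3\<close> in the sum. Half of this plus the 51/100 in
  \<open>ell\<close> stays below 211/100, and 101/100 is half of the 202/100 from
  \<open>cube_pair_le\<close>.\<close>

lemma beta_average_less_ell:
  fixes m c :: real
  assumes m: "m \<ge> 60" and c: "0 \<le> c" "101 / 100 * c + 211 / 100 * (1 / sqrt m) < 402 / 1000"
  shows "(beta_bound c (m - 1) + beta_bound c (m + 1)) / 2 < ell m"
proof -
  define t r h where "t = 1 / m" and "r = 1 / sqrt m" and "h = t\<^sup>2"
  have m30: "m \<ge> 30" using m by simp
  note rt = rsqrt_facts[OF m30, folded t_def r_def]
  have t: "0 \<le> t" "t \<le> 1 / 30" "\<bar>t\<bar> \<le> 1 / 30" "\<bar>-t\<bar> \<le> 1 / 30" using rt by simp_all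
  have t60: "t \<le> 1 / 60" unfolding t_def using m by (intro divide_left_mono) auto
  have h1: "0 \<le> h" "h \<le> 1 / 3600"
    unfolding h_def using power_mono[OF t60, of 2] rt by (simp_all add: power2_eq_square)
  define a b where "a = 1 / sqrt (1 - t)" and "b = 1 / sqrt (1 + t)"
  have a: "a \<le> 1 + t / 2 + 4 / 10 * h" and b: "b \<le> 1 - t / 2 + 4 / 10 * h"
    using rsqrt_taylor[OF t(3)] rsqrt_taylor[OF t(4)] by (simp_all add: a_def b_def h_def)
  have "1 / (m - 1) = t / (1 - t)" "1 / (m + 1) = t / (1 + t)"
    using m by (simp_all add: t_def field_simps)
  moreover have "1 / sqrt (m - 1) = r * a" "1 / sqrt (m + 1) = r * b"
    unfolding sqrt_succ_pred[OF m30] r_def a_def b_def t_def by simp_all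
  ultimately have sum: "beta_bound c (m - 1) + beta_bound c (m + 1)
     = pi / 4 * (r * t) * (a / (1 - t) + b / (1 + t)) + 3 / (4 * pi) * (r * h) * (a / (1 - t)\<^sup>2 + b / (1 + t)\<^sup>2)
       - h * (1 / (1 - t)\<^sup>2 + 1 / (1 + t)\<^sup>2) + c * t ^ 3 * (1 / (1 - t) ^ 3 + 1 / (1 + t) ^ 3)"
    unfolding beta_bound_def Let_def h_def by (simp add: power_divide algebra_simps add_divide_distrib)
  have prod: "(1 - t) * (1 + t) = 1 - h" by (simp add: h_def power2_eq_square algebra_simps)
  have pos: "0 < 1 - t" "0 < 1 + t" using t by auto
  have s1: "a / (1 - t) + b / (1 + t) \<le> 2 + 4 * h"
  proof -
    have "a / (1 - t) + b / (1 + t) \<le> (1 + t / 2 + 4 / 10 * h) / (1 - t) + (1 - t / 2 + 4 / 10 * h) / (1 + t)"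
      using a b pos by (intro add_mono divide_right_mono) auto
    also have "\<dots> = ((1 + t / 2 + 4 / 10 * h) * (1 + t) + (1 - t / 2 + 4 / 10 * h) * (1 - t)) / (1 - h)"
      unfolding prod[symmetric] using pos by (simp add: add_frac_eq)
    also have "(1 + t / 2 + 4 / 10 * h) * (1 + t) + (1 - t / 2 + 4 / 10 * h) * (1 - t) = 2 + 18 / 10 * h"
      by (simp add: h_def power2_eq_square field_simps)
    also have "(2 + 18 / 10 * h) / (1 - h) \<le> 2 + 4 * h"
    proof (subst pos_divide_le_eq)
      have "h * h \<le> h * (1 / 3600)" using h1 by (intro mult_left_mono) auto
      moreover have "(2 + 4 * h) * (1 - h) = 2 + 2 * h - 4 * (h * h)" by (simp add: algebra_simps)
      ultimately show "2 + 18 / 10 * h \<le> (2 + 4 * h) * (1 - h)" using h1 by argo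
    qed (use h1 in simp)
    finally show ?thesis .
  qed
  have s2: "a / (1 - t)\<^sup>2 + b / (1 + t)\<^sup>2 \<le> 2 + 10 * h"
  proof -
    have "a / (1 - t)\<^sup>2 + b / (1 + t)\<^sup>2 \<le> (1 + t / 2 + 4 / 10 * h) / (1 - t)\<^sup>2 + (1 - t / 2 + 4 / 10 * h) / (1 + t)\<^sup>2"
      using a b pos by (intro add_mono divide_right_mono) auto
    also have "\<dots> = ((1 + t / 2 + 4 / 10 * h) * (1 + t)\<^sup>2 + (1 - t / 2 + 4 / 10 * h) * (1 - t)\<^sup>2) / (1 - h)\<^sup>2"
      unfolding prod[symmetric] power_mult_distrib using pos by (simp add: add_frac_eq)
    also have "(1 + t / 2 + 4 / 10 * h) * (1 + t)\<^sup>2 + (1 - t / 2 + 4 / 10 * h) * (1 - t)\<^sup>2 = 2 + 48 / 10 * h + 8 / 10 * (h * h)"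
      by (simp add: h_def power2_eq_square field_simps)
    also have "(2 + 48 / 10 * h + 8 / 10 * (h * h)) / (1 - h)\<^sup>2 \<le> 2 + 10 * h"
    proof (subst pos_divide_le_eq)
      have hh: "0 \<le> h * h" "h * h \<le> h * (1 / 3600)" using h1 mult_left_mono[OF h1(2) h1(1)] by simp_all
      moreover have "(2 + 10 * h) * (1 - h)\<^sup>2 = 2 + 6 * h - 18 * (h * h) + 10 * (h * (h * h))"
        by (simp add: power2_eq_square algebra_simps)
      moreover have "0 \<le> h * (h * h)" using h1 by simp
      ultimately show "2 + 48 / 10 * h + 8 / 10 * (h * h) \<le> (2 + 10 * h) * (1 - h)\<^sup>2" using h1 by argo
    qed (use h1 in simp)
    finally show ?thesis .
  qed
  have s3: "2 \<le> 1 / (1 - t)\<^sup>2 + 1 / (1 + t)\<^sup>2"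
  proof -
    have "1 / (1 - t)\<^sup>2 + 1 / (1 + t)\<^sup>2 = ((1 + t)\<^sup>2 + (1 - t)\<^sup>2) / (1 - h)\<^sup>2"
      unfolding prod[symmetric] power_mult_distrib using pos by (simp add: add_frac_eq)
    also have "(1 + t)\<^sup>2 + (1 - t)\<^sup>2 = 2 + 2 * h" by (simp add: h_def power2_eq_square algebra_simps)
    also have "(2 + 2 * h) / (1 - h)\<^sup>2 \<ge> 2"
    proof (subst pos_le_divide_eq)
      have "h * h \<le> h * 1" using h1 by (intro mult_left_mono) auto
      then show "2 * (1 - h)\<^sup>2 \<le> 2 + 2 * h" using h1 by (simp add: power2_eq_square algebra_simps)
    qed (use h1 in simp)
    finally show ?thesis .
  qed
  have rt0: "0 \<le> r * t" "0 \<le> r * h" "0 < t ^ 3" using rt h1 by simp_all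
  have "pi / 4 * (r * t) * (a / (1 - t) + b / (1 + t)) \<le> pi / 4 * (r * t) * (2 + 4 * h)"
    by (rule mult_left_mono[OF s1 mult_nonneg_nonneg[OF _ rt0(1)]]) simp
  moreover have "3 / (4 * pi) * (r * h) * (a / (1 - t)\<^sup>2 + b / (1 + t)\<^sup>2) \<le> 3 / (4 * pi) * (r * h) * (2 + 10 * h)"
    by (rule mult_left_mono[OF s2 mult_nonneg_nonneg[OF _ rt0(2)]]) simp
  moreover have "h * 2 \<le> h * (1 / (1 - t)\<^sup>2 + 1 / (1 + t)\<^sup>2)" using s3 h1 by (intro mult_left_mono) auto
  moreover have "c * t ^ 3 * (1 / (1 - t) ^ 3 + 1 / (1 + t) ^ 3) \<le> c * t ^ 3 * (202 / 100)"
    using cube_pair_le[OF t(1,2)] c rt0 by (intro mult_left_mono) auto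
  ultimately have le: "beta_bound c (m - 1) + beta_bound c (m + 1)
     \<le> pi / 4 * (r * t) * (2 + 4 * h) + 3 / (4 * pi) * (r * h) * (2 + 10 * h) - h * 2 + c * t ^ 3 * (202 / 100)"
    unfolding sum by linarith
  define X where "X = r * t ^ 3"
  have X: "0 < X" using rt rt0 by (simp add: X_def)
  have X1: "pi / 4 * (r * t) * (2 + 4 * h) = 2 * (pi / 4 * (r * t)) + pi * X"
    by (simp add: X_def h_def power2_eq_square power_numeral_reduce algebra_simps)
  have X2: "3 / (4 * pi) * (r * h) * (2 + 10 * h) = 2 * (3 / (4 * pi) * (r * h)) + 30 / (4 * pi) * (t * X)"
    by (simp add: X_def h_def power2_eq_square power_numeral_reduce field_simps)
  have "30 / (4 * pi) \<le> 24 / 10" using pi_approx by (simp add: field_simps)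
  then have "30 / (4 * pi) * (t * X) \<le> 24 / 10 * (1 / 60 * X)" using t60 X rt by (intro mult_mono) auto
  moreover have "pi * X \<le> 31416 / 10000 * X" using pi_approx X by (intro mult_right_mono) auto
  ultimately have le2: "beta_bound c (m - 1) + beta_bound c (m + 1)
     \<le> 2 * (pi / 4 * (r * t)) + 2 * (3 / (4 * pi) * (r * h)) - 2 * h + c * t ^ 3 * (202 / 100) + 319 / 100 * X"
    using le X unfolding X1 X2 by argo
  have l: "ell m = pi / 4 * (r * t) + 3 / (4 * pi) * (r * h) - 51 / 100 * X - h + 402 / 1000 * t ^ 3"
    unfolding ell_def Let_def t_def[symmetric] r_def[symmetric] X_def h_def by (simp add: algebra_simps)
  have "(101 / 100 * c + 211 / 100 * r) * t ^ 3 < 402 / 1000 * t ^ 3"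
    using c(2) rt0 unfolding r_def by (intro mult_strict_right_mono) auto
  then have "101 / 100 * (c * t ^ 3) + 211 / 100 * X < 402 / 1000 * t ^ 3"
    unfolding X_def by (simp add: algebra_simps)
  moreover have "c * t ^ 3 * (202 / 100) = 202 / 100 * (c * t ^ 3)" by simp
  ultimately show ?thesis using le2 X unfolding l by argo
qed

section \<open>A verified computation of small overpartition numbers\<close>

text \<open>Tags encode the position and sign of the nonzero coefficients of \<open>\<Theta>\<close>, so that evaluating the recurrence
  needs additions only; a list of overpartition numbers starts with the one of largest index.\<close>
datatype theta_tag = Skip | Plus | Minus

text \<open>\<open>a\<close> collects the entries tagged \<open>Plus\<close>, \<open>b\<close> those
  tagged \<open>Minus\<close>, and the common factor 2 is applied once at the end.\<close>

fun theta_step :: "int \<Rightarrow> int \<Rightarrow> theta_tag list \<Rightarrow> int list \<Rightarrow> int" where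
  "theta_step a b (Skip # ts) (x # xs) = theta_step a b ts xs"
| "theta_step a b (Plus # ts) (x # xs) = theta_step (a + x) b ts xs"
| "theta_step a b (Minus # ts) (x # xs) = theta_step a (b + x) ts xs"
| "theta_step a b ts [] = 2 * (a - b)"
| "theta_step a b [] (x # xs) = 0"

text \<open>Between \<open>k^2\<close> and \<open>(k + 1)^2\<close> lie \<open>2 k\<close>
  non-squares; position \<open>i\<close> of the list from \<open>k = 0\<close> stands for the
  coefficient \<open>i + 1\<close>. The signs are those of \<open>- theta_coeff\<close>, because the
  recurrence is solved for the newest number.\<close>

fun theta_tags :: "nat \<Rightarrow> nat \<Rightarrow> theta_tag list" where
  "theta_tags k 0 = []"
| "theta_tags k (Suc j) = replicate (2 * k) Skip @ (if even k then Plus else Minus) # theta_tags (Suc k) j"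

fun extend :: "theta_tag list \<Rightarrow> nat \<Rightarrow> int list \<Rightarrow> int list" where
  "extend ts 0 xs = xs"
| "extend ts (Suc n) xs = extend ts n (theta_step 0 0 ts xs # xs)"

text \<open>Increments of the scaled root shrink slowly by concavity, so the search starts at a
  guess \<open>d\<close> for the increment and descends for at most \<open>f\<close> trials.\<close>

fun sqrt_step :: "nat \<Rightarrow> int \<Rightarrow> int \<Rightarrow> int \<Rightarrow> int" where
  "sqrt_step 0 r d m = r"
| "sqrt_step (Suc f) r d m = (if (r + d) * (r + d) \<le> 100000000 * m then r + d else sqrt_step f r (d - 1) m)"

text \<open>Fixed point form of \<open>10\<^sup>1\<^sup>0 m\<^sup>3 beta_bound (1 / 10) m\<close>, where \<open>r\<close> is a lower bound of \<open>10\<^sup>4 sqrt m\<close>.\<close>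
definition beta_value :: "int \<Rightarrow> int \<Rightarrow> int" where
  "beta_value m r = r * (785398 * m + 238700) - 10000000000 * m + 1000000000"

text \<open>The arguments \<open>x\<close>, \<open>y\<close>, \<open>z\<close> are three consecutive overpartition numbers divided by a common power
  of two and rounded down.\<close>
definition beta_check :: "int \<Rightarrow> int \<Rightarrow> int \<Rightarrow> int \<Rightarrow> int \<Rightarrow> bool" where
  "beta_check m r x y z \<longleftrightarrow> r * r \<le> 100000000 * m \<and> (x + 1) * (z + 1) \<le> y * y \<and>
     ((y + 1) * (y + 1) - x * z) * (10000000000 * (m * m * m)) \<le> (y + 1) * (y + 1) * beta_value m r"

text \<open>The root \<open>r\<close> is updated by trying the previous increment \<open>r - q\<close> first. The exponent \<open>e\<close> grows whenever the
  rounded numbers exceed \<open>2\<^sup>3\<^sup>7\<close>. Neither the quality of \<open>r\<close> nor the choice of \<open>e\<close> matters for soundness.\<close>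
fun beta_run :: "theta_tag list \<Rightarrow> nat \<Rightarrow> bool \<Rightarrow> int \<Rightarrow> int \<Rightarrow> int \<Rightarrow> nat \<Rightarrow> int list \<Rightarrow> bool" where
  "beta_run ts (Suc n) c m q r e (x3 # x2 # x1 # xs) =
     beta_run ts n (c \<and> beta_check m r (drop_bit e x1) (drop_bit e x2) (drop_bit e x3))
       (m + 1) r (sqrt_step 10 r (r - q) (m + 1)) (if 137438953472 \<le> drop_bit e x2 then Suc e else e)
       (theta_step 0 0 ts (x3 # x2 # x1 # xs) # x3 # x2 # x1 # xs)"
| "beta_run ts n c m q r e xs = (c \<and> n = 0)"

text \<open>Fixed point form of \<open>10\<^sup>1\<^sup>0 m\<^sup>4 ell m\<close>.\<close>
definition ell_value :: "int \<Rightarrow> int \<Rightarrow> int" where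
  "ell_value m r = r * (785398 * (m * m) + 238700 * m - 510000) - 10000000000 * (m * m) + 4020000000 * m"

text \<open>The inequality \<open>(1 - u (n - 1)) * (1 - u (n + 1)) < ell^2\<close> with
  denominators cleared, on five exact consecutive overpartition numbers. For small \<open>n\<close>
  the product itself is compared, without passing to the average.\<close>

definition ell_check :: "int \<Rightarrow> int \<Rightarrow> int \<Rightarrow> int \<Rightarrow> int \<Rightarrow> int \<Rightarrow> int \<Rightarrow> bool" where
  "ell_check m r v w x y z \<longleftrightarrow> 0 \<le> r \<and> r * r \<le> 100000000 * m \<and> v * x \<le> w * w \<and> x * z \<le> y * y \<and> 0 < ell_value m r \<and>
     (w * w - v * x) * (y * y - x * z) * (10000000000 * (m * m * (m * m)) * (10000000000 * (m * m * (m * m))))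
       < ell_value m r * ell_value m r * (w * y * (w * y))"

fun ell_run :: "theta_tag list \<Rightarrow> nat \<Rightarrow> bool \<Rightarrow> int \<Rightarrow> int \<Rightarrow> int \<Rightarrow> int list \<Rightarrow> bool" where
  "ell_run ts (Suc n) c m q r (x5 # x4 # x3 # x2 # x1 # xs) =
     ell_run ts n (c \<and> ell_check m r x1 x2 x3 x4 x5) (m + 1) r (sqrt_step 100 r (r - q) (m + 1))
       (theta_step 0 0 ts (x5 # x4 # x3 # x2 # x1 # xs) # x5 # x4 # x3 # x2 # x1 # xs)"
| "ell_run ts n c m q r xs = (c \<and> n = 0)"

text \<open>The \<open>31^2 = 961\<close> tags exceed the largest index 902 that the evaluations
  reach.\<close>

definition tags900 :: "theta_tag list" where "tags900 = theta_tags 0 31"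

lemmas tags900_code [code] = tags900_def[simplified, code_unfold]

section \<open>Correctness of the evaluation\<close>

definition overpart_list :: "nat \<Rightarrow> int list" where
  "overpart_list n = map (\<lambda>i. int (overpart (n - i))) [0..<Suc n]"

lemma overpart_list_0: "overpart_list 0 = [1]"
proof -
  have "overpart 0 = 1" using bounded_overpart_eq[of 0 0] bounded_overpart_0[of 0] by simp
  then show ?thesis by (simp add: overpart_list_def)
qed

lemma overpart_list_Suc: "overpart_list (Suc n) = int (overpart (Suc n)) # overpart_list n"
proof -
  have "[0..<Suc (Suc n)] = 0 # map Suc [0..<Suc n]" by (simp add: map_Suc_upt upt_conv_Cons del: upt_Suc)
  then show ?thesis unfolding overpart_list_def by (simp del: upt_Suc)
qed

lemma overpart_list_Cons: "\<exists>ys. overpart_list n = int (overpart n) # ys"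
proof (cases n)
  case 0
  then show ?thesis by (simp add: overpart_list_def)
next
  case (Suc l)
  then show ?thesis by (simp add: overpart_list_Suc)
qed

fun tag_value :: "theta_tag \<Rightarrow> int" where
  "tag_value Skip = 0" | "tag_value Plus = 1" | "tag_value Minus = -1"

definition square_tag :: "nat \<Rightarrow> theta_tag" where
  "square_tag N = (if \<exists>k. N = k\<^sup>2 then if odd N then Plus else Minus else Skip)"

lemma theta_step_eq:
  "length xs \<le> length ts \<Longrightarrow>
    theta_step a b ts xs = 2 * (a - b + (\<Sum>i<length xs. tag_value (ts ! i) * xs ! i))"
proof (induction a b ts xs rule: theta_step.induct)
qed (auto simp: sum.lessThan_Suc_shift algebra_simps simp del: sum.lessThan_Suc)

lemma not_square_between: "k\<^sup>2 < N \<Longrightarrow> N < (Suc k)\<^sup>2 \<Longrightarrow> \<not> (\<exists>j. N = j\<^sup>2)"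
  by (metis less_Suc_eq_le not_less power2_less_imp_less power2_nat_le_eq_le zero_le)

lemma theta_tags_length: "length (theta_tags k j) + k\<^sup>2 = (k + j)\<^sup>2"
proof (induction k j rule: theta_tags.induct)
  case (2 k j)
  have "length (theta_tags k (Suc j)) + k\<^sup>2 = length (theta_tags (Suc k) j) + (Suc k)\<^sup>2"
    by (simp add: power2_eq_square)
  then show ?case using 2 by simp
qed simp

lemma theta_tags_nth: "i < length (theta_tags k j) \<Longrightarrow> theta_tags k j ! i = square_tag (k\<^sup>2 + i + 1)"
proof (induction k j arbitrary: i rule: theta_tags.induct)
  case (2 k j)
  consider "i < 2 * k" | "i = 2 * k" | "i > 2 * k" by linarith
  then show ?case
  proof cases
    case 1
    have "\<not> (\<exists>l. k\<^sup>2 + i + 1 = l\<^sup>2)"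
      by (rule not_square_between[of k]) (use 1 in \<open>auto simp: power2_eq_square\<close>)
    then have "square_tag (k\<^sup>2 + i + 1) = Skip" unfolding square_tag_def by (simp only: if_False)
    then show ?thesis using 1 by (simp add: nth_append)
  next
    case 2
    have e: "k\<^sup>2 + i + 1 = (Suc k)\<^sup>2" using 2 by (simp add: power2_eq_square)
    have "square_tag ((Suc k)\<^sup>2) = (if even k then Plus else Minus)"
      unfolding square_tag_def by auto
    then show ?thesis unfolding e using 2 by (simp add: nth_append)
  next
    case 3
    define l where "l = i - 2 * k - 1"
    have l: "i = 2 * k + 1 + l" using 3 by (simp add: l_def)
    have "theta_tags (Suc k) j ! l = square_tag ((Suc k)\<^sup>2 + l + 1)"
      by (rule 2(1)) (use 2(2) l in simp)
    also have "(Suc k)\<^sup>2 + l + 1 = k\<^sup>2 + i + 1" unfolding l by (simp add: power2_eq_square)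
    finally show ?thesis unfolding l by (simp add: nth_append)
  qed
qed simp

lemma theta_coeff_square_tag:
  assumes "N > 0" shows "theta_coeff N = - 2 * of_int (tag_value (square_tag N))"
  using assms by (auto simp: theta_coeff_def square_tag_def minus_one_power_iff)

text \<open>The convolution identity is solved for \<open>overpart (Suc n)\<close> by
  \<open>theta_coeff 0 = 1\<close>; \<open>n < j^2\<close> guarantees a tag for every entry.\<close>

lemma theta_step_overpart_list:
  assumes n: "n < j\<^sup>2"
  shows "theta_step 0 0 (theta_tags 0 j) (overpart_list n) # overpart_list n = overpart_list (Suc n)"
proof -
  have len: "length (overpart_list n) = Suc n" by (simp add: overpart_list_def)
  have lt: "length (theta_tags 0 j) = j\<^sup>2" using theta_tags_length[of 0 j] by simp
  have "theta_step 0 0 (theta_tags 0 j) (overpart_list n)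
      = 2 * (\<Sum>i<Suc n. tag_value (theta_tags 0 j ! i) * overpart_list n ! i)"
    using theta_step_eq[of "overpart_list n" "theta_tags 0 j" 0 0] n lt len by simp
  also have "(\<Sum>i<Suc n. tag_value (theta_tags 0 j ! i) * overpart_list n ! i)
      = (\<Sum>i<Suc n. tag_value (square_tag (Suc i)) * int (overpart (n - i)))"
  proof (rule sum.cong[OF refl])
    fix i assume i: "i \<in> {..<Suc n}"
    have "theta_tags 0 j ! i = square_tag (Suc i)" using theta_tags_nth[of i 0 j] i n lt by simp
    moreover have "overpart_list n ! i = int (overpart (n - i))"
      unfolding overpart_list_def using i by (subst nth_map) (auto simp del: upt_Suc)
    ultimately show "tag_value (theta_tags 0 j ! i) * overpart_list n ! i = tag_value (square_tag (Suc i)) * int (overpart (n - i))"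
      by simp
  qed
  finally have step: "theta_step 0 0 (theta_tags 0 j) (overpart_list n)
      = 2 * (\<Sum>i<Suc n. tag_value (square_tag (Suc i)) * int (overpart (n - i)))" .
  have "0 = (\<Sum>i\<le>Suc n. theta_coeff i * of_nat (overpart (Suc n - i)))"
    using overpart_convolution[of "Suc n"] by simp
  also have "\<dots> = theta_coeff 0 * of_nat (overpart (Suc n)) + (\<Sum>i<Suc n. theta_coeff (Suc i) * of_nat (overpart (n - i)))"
    unfolding lessThan_Suc_atMost[symmetric] by (subst sum.lessThan_Suc_shift) simp
  also have "\<dots> = of_nat (overpart (Suc n)) - of_int (2 * (\<Sum>i<Suc n. tag_value (square_tag (Suc i)) * int (overpart (n - i))))"
  proof -
    have "(\<Sum>i<Suc n. theta_coeff (Suc i) * of_nat (overpart (n - i)))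
        = (\<Sum>i<Suc n. - of_int (2 * (tag_value (square_tag (Suc i)) * int (overpart (n - i)))))"
      by (rule sum.cong) (simp_all add: theta_coeff_square_tag)
    moreover have "theta_coeff 0 = 1" by (simp add: theta_coeff_def)
    ultimately show ?thesis by (simp add: sum_negf sum_distrib_left del: sum.lessThan_Suc)
  qed
  finally have "complex_of_int (theta_step 0 0 (theta_tags 0 j) (overpart_list n)) = complex_of_int (int (overpart (Suc n)))"
    unfolding step by simp
  then show ?thesis unfolding overpart_list_Suc by (simp only: of_int_eq_iff)
qed

lemma extend_overpart_list:
  "n + k \<le> j\<^sup>2 \<Longrightarrow> extend (theta_tags 0 j) k (overpart_list n) = overpart_list (n + k)"
proof (induction k arbitrary: n)
  case (Suc k)
  then show ?case using theta_step_overpart_list[of n j] Suc.IH[of "Suc n"] by simp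
qed simp

text \<open>Only the list and the index are invariants. \<open>r\<close> and \<open>e\<close> stay
  existential, since \<open>beta_check\<close> tests \<open>r\<close> itself and rounding down is
  sound for any \<open>e\<close>.\<close>

lemma beta_run_sound:
  assumes "beta_run (theta_tags 0 j) k c (int m) q r e (overpart_list (Suc m))" "m \<ge> 1" "m + k < j\<^sup>2"
  shows "c \<and> (\<forall>i<k. \<exists>r e. beta_check (int (m + i)) r (drop_bit e (int (overpart (m + i - 1))))
     (drop_bit e (int (overpart (m + i)))) (drop_bit e (int (overpart (m + i + 1)))))"
  using assms
proof (induction k arbitrary: c m q r e)
  case 0
  then show ?case by simp
next
  case (Suc k)
  obtain l where l: "m = Suc l" using Suc.prems(2) by (cases m) auto
  obtain ys where ys: "overpart_list l = int (overpart l) # ys" using overpart_list_Cons by blast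
  have xs: "overpart_list (Suc m) = int (overpart (m + 1)) # int (overpart m) # int (overpart (m - 1)) # ys"
    unfolding l using ys by (simp add: overpart_list_Suc)
  have step: "theta_step 0 0 (theta_tags 0 j) (overpart_list (Suc m)) # overpart_list (Suc m) = overpart_list (Suc (Suc m))"
    by (rule theta_step_overpart_list) (use Suc.prems in simp)
  let ?chk = "beta_check (int m) r (drop_bit e (int (overpart (m - 1)))) (drop_bit e (int (overpart m))) (drop_bit e (int (overpart (m + 1))))"
  have "\<exists>r' e'. beta_run (theta_tags 0 j) k (c \<and> ?chk) (int (Suc m)) r r' e' (overpart_list (Suc (Suc m)))"
    using Suc.prems(1) step unfolding xs by (auto simp: add.commute simp del: drop_bit_of_nat)
  then obtain r' e' where "beta_run (theta_tags 0 j) k (c \<and> ?chk) (int (Suc m)) r r' e' (overpart_list (Suc (Suc m)))"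
    by blast
  from Suc.IH[OF this] Suc.prems
  have IH: "c \<and> ?chk" "\<forall>i<k. \<exists>r e. beta_check (int (Suc m + i)) r (drop_bit e (int (overpart (Suc m + i - 1))))
     (drop_bit e (int (overpart (Suc m + i)))) (drop_bit e (int (overpart (Suc m + i + 1))))" by auto
  show ?case
  proof (intro conjI allI impI)
    show c using IH(1) by blast
    fix i assume "i < Suc k"
    then show "\<exists>r e. beta_check (int (m + i)) r (drop_bit e (int (overpart (m + i - 1))))
     (drop_bit e (int (overpart (m + i)))) (drop_bit e (int (overpart (m + i + 1))))"
      using IH by (cases i) (auto simp del: drop_bit_of_nat)
  qed
qed

lemma ell_run_sound:
  assumes "ell_run (theta_tags 0 j) k c (int m) q r (overpart_list (m + 2))" "m \<ge> 2" "m + 1 + k < j\<^sup>2"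
  shows "c \<and> (\<forall>i<k. \<exists>r. ell_check (int (m + i)) r (int (overpart (m + i - 2))) (int (overpart (m + i - 1)))
     (int (overpart (m + i))) (int (overpart (m + i + 1))) (int (overpart (m + i + 2))))"
  using assms
proof (induction k arbitrary: c m q r)
  case 0
  then show ?case by simp
next
  case (Suc k)
  obtain l where l: "m = Suc (Suc l)" using Suc.prems(2) by (metis One_nat_def Suc_1 Suc_le_D Suc_le_mono)
  obtain ys where ys: "overpart_list l = int (overpart l) # ys" using overpart_list_Cons by blast
  have xs: "overpart_list (m + 2) = int (overpart (m + 2)) # int (overpart (m + 1)) # int (overpart m)
      # int (overpart (m - 1)) # int (overpart (m - 2)) # ys"
    unfolding l using ys by (simp add: overpart_list_Suc)
  have step: "theta_step 0 0 (theta_tags 0 j) (overpart_list (m + 2)) # overpart_list (m + 2) = overpart_list (Suc m + 2)"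
    using theta_step_overpart_list[of "m + 2" j] Suc.prems by simp
  let ?chk = "ell_check (int m) r (int (overpart (m - 2))) (int (overpart (m - 1))) (int (overpart m))
    (int (overpart (m + 1))) (int (overpart (m + 2)))"
  have "\<exists>r'. ell_run (theta_tags 0 j) k (c \<and> ?chk) (int (Suc m)) r r' (overpart_list (Suc m + 2))"
    using Suc.prems(1) unfolding step[symmetric] unfolding xs by (auto simp: add.commute)
  then obtain r' where "ell_run (theta_tags 0 j) k (c \<and> ?chk) (int (Suc m)) r r' (overpart_list (Suc m + 2))"
    by blast
  from Suc.IH[OF this] Suc.prems
  have IH: "c \<and> ?chk" "\<forall>i<k. \<exists>r. ell_check (int (Suc m + i)) r (int (overpart (Suc m + i - 2)))
     (int (overpart (Suc m + i - 1))) (int (overpart (Suc m + i))) (int (overpart (Suc m + i + 1)))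
     (int (overpart (Suc m + i + 2)))" by auto
  show ?case
  proof (intro conjI allI impI)
    show c using IH(1) by blast
    fix i assume "i < Suc k"
    then show "\<exists>r. ell_check (int (m + i)) r (int (overpart (m + i - 2))) (int (overpart (m + i - 1)))
     (int (overpart (m + i))) (int (overpart (m + i + 1))) (int (overpart (m + i + 2)))"
      using IH by (cases i) auto
  qed
qed

lemma overpart_pos: "0 < overpart n"
proof -
  have "(replicate_mset n 1, {}) \<in> overpartitions n"
    by (auto simp: overpartitions_def)
  then show ?thesis unfolding overpart_def using finite_overpartitions card_gt_0_iff by blast
qed

lemma u_pos: "0 < u m"
  unfolding u_def using overpart_pos by simp

lemma scaled_root_le:
  assumes "r * r \<le> 100000000 * int m"
  shows "real_of_int r \<le> 10000 * sqrt (real m)"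
proof -
  have "real_of_int (r * r) \<le> real_of_int (100000000 * int m)" using assms by (simp only: of_int_le_iff)
  then have "real_of_int r \<le> sqrt (100000000 * real m)" by (intro real_le_rsqrt) (simp add: power2_eq_square)
  also have "\<dots> = 10000 * sqrt (real m)" by (simp add: real_sqrt_mult)
  finally show ?thesis .
qed

lemma pi_quotient_bounds: "785398 / 1000000 \<le> pi / 4" "238700 / 1000000 \<le> 3 / (4 * pi)"
  using pi_approx by (simp_all add: field_simps)

lemma beta_value_le:
  assumes r: "r * r \<le> 100000000 * int m" and m: "m \<ge> 1"
  shows "real_of_int (beta_value (int m) r) \<le> beta_bound (1 / 10) (real m) * (10000000000 * real m ^ 3)"
proof -
  define S where "S = sqrt (real m)"
  have S: "S > 0" "S * S = real m" using m by (simp_all add: S_def)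
  have "real_of_int (beta_value (int m) r)
      = real_of_int r * (785398 * real m + 238700) - 10000000000 * real m + 1000000000"
    by (simp add: beta_value_def)
  also have "\<dots> \<le> 10000 * S * (785398 * real m + 238700) - 10000000000 * real m + 1000000000"
    using mult_right_mono[OF scaled_root_le[OF r], of "785398 * real m + 238700"] unfolding S_def by simp
  also have "\<dots> = 10000000000 * (S * (785398 / 1000000 * real m + 238700 / 1000000) - real m + 1 / 10)"
    by (simp add: algebra_simps)
  also have "\<dots> \<le> 10000000000 * (S * (pi / 4 * real m + 3 / (4 * pi)) - real m + 1 / 10)"
  proof -
    have "S * (785398 / 1000000 * real m + 238700 / 1000000) \<le> S * (pi / 4 * real m + 3 / (4 * pi))"
      by (intro mult_left_mono add_mono mult_right_mono pi_quotient_bounds) (use S in auto)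
    then show ?thesis by simp
  qed
  also have "S * (pi / 4 * real m + 3 / (4 * pi)) - real m + 1 / 10 = beta_bound (1 / 10) (real m) * real m ^ 3"
    unfolding beta_bound_def Let_def S_def[symmetric] S(2)[symmetric]
    using S(1) by (simp add: field_simps power2_eq_square power3_eq_cube)
  finally show ?thesis by (simp add: mult_ac)
qed

lemma ell_value_le:
  assumes r: "r * r \<le> 100000000 * int m" and m: "m \<ge> 1"
  shows "real_of_int (ell_value (int m) r) \<le> ell (real m) * (10000000000 * real m ^ 4)"
proof -
  define S where "S = sqrt (real m)"
  have S: "S > 0" "S * S = real m" using m by (simp_all add: S_def)
  have c: "0 \<le> 785398 * (real m)\<^sup>2 + 238700 * real m - 510000"
  proof -
    have "1 \<le> real m" "1 \<le> (real m)\<^sup>2" using m by simp_all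
    then show ?thesis by argo
  qed
  have "real_of_int (ell_value (int m) r)
      = real_of_int r * (785398 * (real m)\<^sup>2 + 238700 * real m - 510000) - 10000000000 * (real m)\<^sup>2 + 4020000000 * real m"
    by (simp add: ell_value_def power2_eq_square)
  also have "\<dots> \<le> 10000 * S * (785398 * (real m)\<^sup>2 + 238700 * real m - 510000) - 10000000000 * (real m)\<^sup>2 + 4020000000 * real m"
    using mult_right_mono[OF scaled_root_le[OF r] c] unfolding S_def by simp
  also have "\<dots> = 10000000000 * (S * (785398 / 1000000 * (real m)\<^sup>2 + 238700 / 1000000 * real m - 51 / 100) - (real m)\<^sup>2 + 402 / 1000 * real m)"
    by (simp add: algebra_simps)
  also have "\<dots> \<le> 10000000000 * (S * (pi / 4 * (real m)\<^sup>2 + 3 / (4 * pi) * real m - 51 / 100) - (real m)\<^sup>2 + 402 / 1000 * real m)"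
  proof -
    have "S * (785398 / 1000000 * (real m)\<^sup>2 + 238700 / 1000000 * real m - 51 / 100) \<le> S * (pi / 4 * (real m)\<^sup>2 + 3 / (4 * pi) * real m - 51 / 100)"
      by (intro mult_left_mono diff_mono add_mono mult_right_mono pi_quotient_bounds) (use S in auto)
    then show ?thesis by simp
  qed
  also have "S * (pi / 4 * (real m)\<^sup>2 + 3 / (4 * pi) * real m - 51 / 100) - (real m)\<^sup>2 + 402 / 1000 * real m = ell (real m) * real m ^ 4"
    unfolding ell_def Let_def S_def[symmetric] S(2)[symmetric]
    using S(1) by (simp add: field_simps power_numeral_reduce power2_eq_square)
  finally show ?thesis by (simp add: mult_ac)
qed

lemma drop_bit_bounds:
  "0 \<le> drop_bit e (int a)" "real_of_int (drop_bit e (int a)) * 2 ^ e \<le> real a"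
  "real a \<le> (real_of_int (drop_bit e (int a)) + 1) * 2 ^ e"
proof -
  define q where "q = drop_bit e (int a)"
  have q: "q = int a div 2 ^ e" by (simp add: q_def drop_bit_eq_div)
  show "0 \<le> drop_bit e (int a)" by simp
  have e: "int a = q * 2 ^ e + int a mod 2 ^ e" unfolding q by (simp only: div_mult_mod_eq)
  have mod: "0 \<le> int a mod 2 ^ e" "int a mod 2 ^ e < 2 ^ e" by simp_all
  have "q * 2 ^ e \<le> int a" "int a \<le> (q + 1) * 2 ^ e"
    unfolding distrib_right using e mod by linarith+
  then have "real_of_int (q * 2 ^ e) \<le> real_of_int (int a)" "real_of_int (int a) \<le> real_of_int ((q + 1) * 2 ^ e)"
    by (simp_all only: of_int_le_iff)
  then show "real_of_int (drop_bit e (int a)) * 2 ^ e \<le> real a"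
     "real a \<le> (real_of_int (drop_bit e (int a)) + 1) * 2 ^ e"
    unfolding q_def[symmetric] by simp_all
qed

text \<open>Numerator and denominator are rounded in the unfavourable direction each time, and the
  scale \<open>P\<close> cancels. If \<open>M \<le> B\<close>, the second claim is trivial;
  otherwise \<open>M - B\<close> is positive and inequalities may be multiplied by it.\<close>

lemma rounded_ratio_bounds:
  fixes a b c X Y Z P B M :: real
  assumes P: "P > 0" and X: "0 \<le> X" "X * P \<le> a" "a \<le> (X + 1) * P"
    and Y: "0 \<le> Y" "Y * P \<le> b" "b \<le> (Y + 1) * P" and b: "0 < b"
    and Z: "0 \<le> Z" "Z * P \<le> c" "c \<le> (Z + 1) * P" and M: "0 < M"
    and le: "(X + 1) * (Z + 1) \<le> Y * Y" "((Y + 1) * (Y + 1) - X * Z) * M \<le> (Y + 1) * (Y + 1) * B"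
  shows "a * c / b\<^sup>2 \<le> 1" "1 - a * c / b\<^sup>2 \<le> B / M"
proof -
  have ac: "0 \<le> a" "0 \<le> c" using X Z P by (meson mult_nonneg_nonneg order_trans less_imp_le)+
  have "a * c \<le> ((X + 1) * P) * ((Z + 1) * P)" using X Z ac P by (intro mult_mono) auto
  also have "\<dots> = ((X + 1) * (Z + 1)) * (P * P)" by simp
  also have "\<dots> \<le> (Y * Y) * (P * P)" using le(1) P by (intro mult_right_mono) auto
  also have "\<dots> = (Y * P) * (Y * P)" by simp
  also have "\<dots> \<le> b * b" using Y P b by (intro mult_mono) auto
  finally show "a * c / b\<^sup>2 \<le> 1" using b by (simp add: power2_eq_square)
  have "b * b * (M - B) \<le> a * c * M"
  proof (cases "M \<le> B")
    case True
    then have "b * b * (M - B) \<le> 0" by (intro mult_nonneg_nonpos) auto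
    also have "0 \<le> a * c * M" using ac M by simp
    finally show ?thesis .
  next
    case False
    have "b * b \<le> ((Y + 1) * P) * ((Y + 1) * P)" using Y b by (intro mult_mono) auto
    then have "b * b * (M - B) \<le> ((Y + 1) * P) * ((Y + 1) * P) * (M - B)" using False by (intro mult_right_mono) auto
    also have "\<dots> = ((Y + 1) * (Y + 1) * M - (Y + 1) * (Y + 1) * B) * (P * P)" by (simp add: algebra_simps)
    also have "\<dots> \<le> (X * Z * M) * (P * P)" using le(2) P by (intro mult_right_mono) (auto simp: left_diff_distrib)
    also have "\<dots> = (X * P) * (Z * P) * M" by simp
    also have "\<dots> \<le> a * c * M"
    proof (rule mult_right_mono)
      show "(X * P) * (Z * P) \<le> a * c" by (rule mult_mono) (use X Z P ac in auto)
    qed (use M in simp)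
    finally show ?thesis .
  qed
  then show "1 - a * c / b\<^sup>2 \<le> B / M" using b M by (simp add: field_simps power2_eq_square)
qed

lemma beta_check_sound:
  assumes chk: "beta_check (int m) r (drop_bit e (int (overpart (m - 1)))) (drop_bit e (int (overpart m)))
      (drop_bit e (int (overpart (m + 1))))" and m: "m \<ge> 1"
  shows "0 \<le> 1 - u m" "1 - u m \<le> beta_bound (1 / 10) (real m)"
proof -
  define X Y Z where "X = drop_bit e (int (overpart (m - 1)))" and "Y = drop_bit e (int (overpart m))"
    and "Z = drop_bit e (int (overpart (m + 1)))"
  have chk': "r * r \<le> 100000000 * int m" "(X + 1) * (Z + 1) \<le> Y * Y"
     "((Y + 1) * (Y + 1) - X * Z) * (10000000000 * (int m * int m * int m)) \<le> (Y + 1) * (Y + 1) * beta_value (int m) r"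
    using chk unfolding beta_check_def X_def Y_def Z_def by simp_all
  define M where "M = 10000000000 * real m ^ 3"
  have M: "M > 0" using m by (simp add: M_def)
  have 2: "(real_of_int X + 1) * (real_of_int Z + 1) \<le> real_of_int Y * real_of_int Y"
  proof -
    have "real_of_int ((X + 1) * (Z + 1)) \<le> real_of_int (Y * Y)" using chk'(2) by (simp only: of_int_le_iff)
    then show ?thesis by simp
  qed
  have 3: "((real_of_int Y + 1) * (real_of_int Y + 1) - real_of_int X * real_of_int Z) * M
      \<le> (real_of_int Y + 1) * (real_of_int Y + 1) * real_of_int (beta_value (int m) r)"
  proof -
    have "real_of_int (((Y + 1) * (Y + 1) - X * Z) * (10000000000 * (int m * int m * int m)))
        \<le> real_of_int ((Y + 1) * (Y + 1) * beta_value (int m) r)" using chk'(3) by (simp only: of_int_le_iff)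
    then show ?thesis by (simp add: M_def power3_eq_cube)
  qed
  note bnd = rounded_ratio_bounds[of "2 ^ e :: real" "real_of_int X" "real (overpart (m - 1))" "real_of_int Y"
      "real (overpart m)" "real_of_int Z" "real (overpart (m + 1))" M, OF _ _ _ _ _ _ _ _ _ _ _ M 2 3,
      folded u_def]
  have "u m \<le> 1" "1 - u m \<le> real_of_int (beta_value (int m) r) / M"
    using drop_bit_bounds[where e = e and a = "overpart (m - 1)", folded X_def] drop_bit_bounds[where e = e and a = "overpart m", folded Y_def]
      drop_bit_bounds[where e = e and a = "overpart (m + 1)", folded Z_def] overpart_pos[of m]
    by (intro bnd; simp)+
  moreover have "real_of_int (beta_value (int m) r) / M \<le> beta_bound (1 / 10) (real m)"
    using beta_value_le[OF chk'(1) m] M unfolding M_def[symmetric] by (simp add: divide_le_eq)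
  ultimately show "0 \<le> 1 - u m" "1 - u m \<le> beta_bound (1 / 10) (real m)" by simp_all
qed

lemma ell_check_sound:
  assumes chk: "ell_check (int n) r (int (overpart (n - 2))) (int (overpart (n - 1))) (int (overpart n))
      (int (overpart (n + 1))) (int (overpart (n + 2)))" and n: "n \<ge> 2"
  shows "0 \<le> 1 - u (n - 1)" "0 \<le> 1 - u (n + 1)" "0 < ell (real n)"
    "(1 - u (n - 1)) * (1 - u (n + 1)) < (ell (real n))\<^sup>2"
proof -
  define v w x y z where "v = real (overpart (n - 2))" and "w = real (overpart (n - 1))"
    and "x = real (overpart n)" and "y = real (overpart (n + 1))" and "z = real (overpart (n + 2))"
  note defs = v_def w_def x_def y_def z_def
  define M L where "M = 10000000000 * real n ^ 4" and "L = real_of_int (ell_value (int n) r)"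
  have M: "M > 0" using n by (simp add: M_def)
  have w: "w > 0" and y: "y > 0" using overpart_pos by (simp_all add: defs)
  have chk': "r * r \<le> 100000000 * int n" "v * x \<le> w * w" "x * z \<le> y * y" "0 < L"
    "(w * w - v * x) * (y * y - x * z) * (M * M) < L * L * (w * y * (w * y))"
  proof -
    let ?a = "\<lambda>i. int (overpart i)"
    note c = chk[unfolded ell_check_def]
    show "r * r \<le> 100000000 * int n" "0 < L" using c by (simp_all add: L_def)
    have "real_of_int (?a (n - 2) * ?a n) \<le> real_of_int (?a (n - 1) * ?a (n - 1))"
      "real_of_int (?a n * ?a (n + 2)) \<le> real_of_int (?a (n + 1) * ?a (n + 1))"
      using c by (simp_all only: of_int_le_iff)
    then show "v * x \<le> w * w" "x * z \<le> y * y" by (simp_all add: defs)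
    have "real_of_int ((?a (n - 1) * ?a (n - 1) - ?a (n - 2) * ?a n) * (?a (n + 1) * ?a (n + 1) - ?a n * ?a (n + 2)) *
        (10000000000 * (int n * int n * (int n * int n)) * (10000000000 * (int n * int n * (int n * int n)))))
      < real_of_int (ell_value (int n) r * ell_value (int n) r * (?a (n - 1) * ?a (n + 1) * (?a (n - 1) * ?a (n + 1))))"
      using c by (simp only: of_int_less_iff)
    moreover have "M = 10000000000 * (real n * real n * (real n * real n))"
      by (simp add: M_def power4_eq_xxxx mult.assoc)
    ultimately show "(w * w - v * x) * (y * y - x * z) * (M * M) < L * L * (w * y * (w * y))"
      unfolding L_def defs by simp
  qed
  have um: "u (n - 1) = v * x / w\<^sup>2" and up: "u (n + 1) = x * z / y\<^sup>2"
    using n by (simp_all add: u_def defs numeral_2_eq_2)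
  have bm: "1 - u (n - 1) = (w * w - v * x) / (w * w)" and bp: "1 - u (n + 1) = (y * y - x * z) / (y * y)"
    unfolding um up using w y by (simp_all add: diff_divide_distrib power2_eq_square)
  show "0 \<le> 1 - u (n - 1)" "0 \<le> 1 - u (n + 1)" unfolding bm bp using chk' by simp_all
  have L: "L \<le> ell (real n) * M" using ell_value_le[OF chk'(1)] n by (simp add: L_def M_def)
  then have "0 < ell (real n) * M" using chk'(4) by linarith
  then show "0 < ell (real n)" using M by (simp add: zero_less_mult_iff)
  have "(1 - u (n - 1)) * (1 - u (n + 1)) < (L / M)\<^sup>2"
    unfolding bm bp using chk'(5) w y M by (simp add: divide_simps power2_eq_square mult_ac)
  also have "\<dots> \<le> (ell (real n))\<^sup>2"
    using L M chk'(4) by (intro power_mono) (simp_all add: divide_le_eq)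
  finally show "(1 - u (n - 1)) * (1 - u (n + 1)) < (ell (real n))\<^sup>2" .
qed

section \<open>The evaluations and the three ranges of n\<close>

text \<open>The 51 checks \<open>n = 30..80\<close> start from the numbers up to index 32. The
  constants approximate \<open>10^4 sqrt 29\<close> and \<open>10^4 sqrt 30\<close>; their
  difference is the first guess for the increment.\<close>

lemma ell_run_30_to_80: "ell_run tags900 51 True 30 53852 54772 (extend tags900 32 [1])"
  by code_simp

text \<open>The 821 checks \<open>m = 80..900\<close> start from the numbers up to index 81. The
  growing shift keeps the multiplied numbers near 38 bits, and the constants approximate
  \<open>10^4 sqrt 79\<close> and \<open>10^4 sqrt 80\<close>.\<close>

lemma beta_run_80_to_900: "beta_run tags900 821 True 80 88881 89442 0 (extend tags900 81 [1])"
  by code_simp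

lemma extend_overpart_list_0: "n \<le> 961 \<Longrightarrow> extend tags900 n [1] = overpart_list n"
  using extend_overpart_list[of 0 n 31] by (simp add: tags900_def overpart_list_0 del: theta_tags.simps)

lemma u_bounds_medium:
  assumes "80 \<le> m" "m \<le> 900"
  shows "0 \<le> 1 - u m" "1 - u m \<le> beta_bound (1 / 10) (real m)"
proof -
  have "beta_run (theta_tags 0 31) 821 True (int 80) 88881 89442 0 (overpart_list (Suc 80))"
    using beta_run_80_to_900 unfolding extend_overpart_list_0[of 81, simplified] unfolding tags900_def by simp
  from beta_run_sound[OF this] have "\<forall>i<821. \<exists>r e. beta_check (int (80 + i)) r (drop_bit e (int (overpart (80 + i - 1))))
     (drop_bit e (int (overpart (80 + i)))) (drop_bit e (int (overpart (80 + i + 1))))" by simp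
  moreover have "m - 80 < 821" "80 + (m - 80) = m" using assms by simp_all
  ultimately obtain r e where
    "beta_check (int m) r (drop_bit e (int (overpart (m - 1)))) (drop_bit e (int (overpart m)))
      (drop_bit e (int (overpart (m + 1))))" by metis
  from beta_check_sound[OF this] assms
  show "0 \<le> 1 - u m" "1 - u m \<le> beta_bound (1 / 10) (real m)" by simp_all
qed

text \<open>AM-GM: it suffices to bound the average, to which upper bounds of the single
  \<open>1 - u\<close> apply directly.\<close>

lemma u_product_less_of_average:
  assumes b: "0 \<le> 1 - u (n - 1)" "0 \<le> 1 - u (n + 1)"
    and a: "(1 - u (n - 1) + (1 - u (n + 1))) / 2 < l"
  shows "0 < l" "(1 - u (n - 1)) * (1 - u (n + 1)) < l\<^sup>2"
proof -
  let ?a = "1 - u (n - 1)" and ?b = "1 - u (n + 1)"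
  have nn: "0 \<le> (?a + ?b) / 2" using b by simp
  show "0 < l" using nn a by linarith
  have "?a * ?b \<le> ((?a + ?b) / 2)\<^sup>2"
    using sum_squares_ge_zero[of "?a - ?b" 0] by (simp add: power2_eq_square algebra_simps)
  also have "\<dots> < l\<^sup>2" using a nn by (intro power_strict_mono) auto
  finally show "?a * ?b < l\<^sup>2" .
qed

lemma u_product_less_ell:
  assumes n: "30 \<le> n"
  shows "0 \<le> 1 - u (n - 1) \<and> 0 \<le> 1 - u (n + 1) \<and> 0 < ell (real n) \<and>
    (1 - u (n - 1)) * (1 - u (n + 1)) < (ell (real n))\<^sup>2"
proof -
  have average: ?thesis
    if c: "0 \<le> c" "101 / 100 * c + 211 / 100 * (1 / k) < 402 / 1000" and k: "0 < k" "k\<^sup>2 \<le> real n" and n60: "60 \<le> n"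
      and b: "\<And>m. m \<in> {n - 1, n + 1} \<Longrightarrow> 0 \<le> 1 - u m \<and> 1 - u m \<le> beta_bound c (real m)" for c k
  proof -
    have "k \<le> sqrt (real n)" using k by (intro real_le_rsqrt) simp
    then have "1 / sqrt (real n) \<le> 1 / k" using k by (intro frac_le) auto
    then have "101 / 100 * c + 211 / 100 * (1 / sqrt (real n)) < 402 / 1000" using c by argo
    then have "(beta_bound c (real n - 1) + beta_bound c (real n + 1)) / 2 < ell (real n)"
      using beta_average_less_ell[of "real n" c] c n60 by simp
    moreover have "real (n - 1) = real n - 1" "real (n + 1) = real n + 1" using n by simp_all
    moreover from this have "1 - u (n - 1) \<le> beta_bound c (real n - 1)" "1 - u (n + 1) \<le> beta_bound c (real n + 1)"
      using b[of "n - 1"] b[of "n + 1"] by (simp_all add: add.commute)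
    ultimately have "(1 - u (n - 1) + (1 - u (n + 1))) / 2 < ell (real n)" by argo
    with b[of "n - 1"] b[of "n + 1"] show ?thesis
      using u_product_less_of_average[of n "ell (real n)"] by blast
  qed
  consider "n \<le> 80" | "81 \<le> n" "n \<le> 899" | "900 \<le> n" by linarith
  then show ?thesis
  proof cases
    case 1
    have "ell_run (theta_tags 0 31) 51 True (int 30) 53852 54772 (overpart_list (30 + 2))"
      using ell_run_30_to_80 unfolding extend_overpart_list_0[of 32, simplified] unfolding tags900_def by simp
    from ell_run_sound[OF this] have "\<forall>i<51. \<exists>r. ell_check (int (30 + i)) r (int (overpart (30 + i - 2)))
      (int (overpart (30 + i - 1))) (int (overpart (30 + i))) (int (overpart (30 + i + 1))) (int (overpart (30 + i + 2)))"
      by simp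
    moreover have "n - 30 < 51" "30 + (n - 30) = n" using 1 n by simp_all
    ultimately obtain r where
      "ell_check (int n) r (int (overpart (n - 2))) (int (overpart (n - 1))) (int (overpart n))
        (int (overpart (n + 1))) (int (overpart (n + 2)))" by metis
    from ell_check_sound[OF this] n show ?thesis by simp
  next
    case 2
    show ?thesis
    \<comment> \<open>\<open>9 = sqrt 81\<close>: the condition reads about
      \<open>0.101 + 0.234 < 0.402\<close>. With \<open>c = 9/40\<close> it would fail here, which
      is why the computation verifies the sharper 1/10.\<close>
    proof (rule average[of "1 / 10" 9])
      fix m assume "m \<in> {n - 1, n + 1}"
      then have "80 \<le> m" "m \<le> 900" using 2 by auto
      then show "0 \<le> 1 - u m \<and> 1 - u m \<le> beta_bound (1 / 10) (real m)" using u_bounds_medium by blast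
    qed (use 2 in auto)
  next
    case 3
    show ?thesis
    \<comment> \<open>\<open>30 = sqrt 900\<close>: about \<open>0.227 + 0.070 < 0.402\<close>.
      Neighbours of \<open>n \<ge> 900\<close> are at least 899, and their neighbours at least
      898.\<close>
    proof (rule average[of "9 / 40" 30])
      fix m assume "m \<in> {n - 1, n + 1}"
      then have "899 \<le> m" using 3 by auto
      then show "0 \<le> 1 - u m \<and> 1 - u m \<le> beta_bound (9 / 40) (real m)" using u_bounds_large by blast
    qed (use 3 in auto)
  qed
qed

theorem theorem2p6:
  fixes n :: nat
  assumes "n \<ge> 30"
  shows "g n < phi (s n)"
proof -
  note b = u_product_less_ell[OF assms]
  \<comment> \<open>Positivity of \<open>u\<close> keeps the product below 1, so \<open>s n\<close>
    is positive and \<open>phi\<close> does not divide by 0.\<close>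
  have "(1 - u (n - 1)) * (1 - u (n + 1)) < 1 * 1"
    by (rule mult_strict_mono) (use b u_pos[of "n - 1"] u_pos[of "n + 1"] in auto)
  then show ?thesis using b g_less_phi[OF assms] by simp
qed

end
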